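(* There is a polynomial-time algorithm that, given a graph $G$ of diameter at most $2$, decides whether $G$ has a homeomorphically irreducible spanning tree (HIST).
   Context: All graphs are finite, simple and undirected. A homeomorphically irreducible spanning tree (HIST) of a connected graph $G$ is a spanning tree $T$ of $G$ in which no vertex has degree exactly $2$ (degrees measured in $T$). The diameter of a connected graph is the maximum, over all pairs of vertices, of the length of a shortest path between them. *)

theory Defs
  imports "Graph_Theory.Graph_Theory" "HOL-Computational_Algebra.Polynomial"
begin

section \<open>Homeomorphically irreducible spanning trees\<close>

text \<open>
  A finite simple undirected graph is a \<^locale>\<open>pair_graph\<close>: every edge is
  represented by its two opposite arcs.  Hence the degree of a vertex is its
  \<^const>\<open>out_degree\<close>.
\<close>

text \<open>
  The library's \<open>tree\<close> is not usable here: its \<open>forest\<close> forbids directed cycles,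
  and in a symmetric digraph each edge already gives a directed cycle of length 2.
  The cycles of length at least 3 of a \<^locale>\<open>pair_graph\<close> are exactly the (traversals
  of the) cycles of the undirected graph.
\<close>

definition undirected_tree :: "'a pair_pre_digraph \<Rightarrow> bool" where
  "undirected_tree T \<longleftrightarrow>
     pair_graph T \<and> Digraph_Component.connected (with_proj T) \<and>
     (\<nexists>p. pre_digraph.cycle (with_proj T) p \<and> length p \<ge> 3)"

definition HIST :: "'a pair_pre_digraph \<Rightarrow> 'a pair_pre_digraph \<Rightarrow> bool" where
  "HIST T G \<longleftrightarrow>
     undirected_tree T \<and> spanning (with_proj T) (with_proj G) \<and>
     (\<forall>v \<in> pverts T. out_degree (with_proj T) v \<noteq> 2)"

definition distance :: "'a pair_pre_digraph \<Rightarrow> 'a \<Rightarrow> 'a \<Rightarrow> ereal" where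
  "distance G u v = wf_digraph.\<mu> (with_proj G) (\<lambda>_. 1) u v"

definition graph_diameter :: "'a pair_pre_digraph \<Rightarrow> ereal" where
  "graph_diameter G = (SUP u \<in> pverts G. SUP v \<in> pverts G. distance G u v)"


section \<open>Random access machines\<close>

text \<open>
  The model of computation is the random access machine of Cook and Reckhow (arithmetic
  restricted to addition and truncated subtraction, indirect addressing, sequential
  input), over natural-number registers, with the jump instructions organised into
  structured conditionals and loops.  Every instruction and every test costs one unit.
  As there is no multiplication, a run of \<open>t\<close> steps can lengthen the binary
  representation of the largest number present by at most \<open>t\<close> bits (up to the fixed
  constants of the program), so that polynomial time in this model coincides with
  polynomial time on Turing machines.
\<close>

datatype prog =
    Skip
  | Const nat nat
  | Add nat nat nat
  | Sub nat nat nat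
  | Load nat nat
  | Store nat nat
  | Read nat
  | Seq prog prog
  | If nat prog prog
  | While nat prog

text \<open>A configuration consists of the registers and the unread part of the input.\<close>

type_synonym config = "(nat \<Rightarrow> nat) \<times> nat list"

text \<open>\<open>exec c (x, is) t (x', is')\<close>: from \<open>(x, is)\<close>, the program \<open>c\<close> halts in \<open>(x', is')\<close>
  after exactly \<open>t\<close> steps. Reading beyond the end of the input yields 0.\<close>

inductive exec :: "prog \<Rightarrow> config \<Rightarrow> nat \<Rightarrow> config \<Rightarrow> bool" where
  Skip: "exec Skip (x, is) 1 (x, is)"
| Const: "exec (Const i a) (x, is) 1 (x(i := a), is)"
| Add: "exec (Add i j k) (x, is) 1 (x(i := x j + x k), is)"
| Sub: "exec (Sub i j k) (x, is) 1 (x(i := x j - x k), is)"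
| Load: "exec (Load i j) (x, is) 1 (x(i := x (x j)), is)"
| Store: "exec (Store i j) (x, is) 1 (x(x i := x j), is)"
| Read_Nil: "exec (Read i) (x, []) 1 (x(i := 0), [])"
| Read_Cons: "exec (Read i) (x, a # is) 1 (x(i := a), is)"
| Seq: "exec c s t s' \<Longrightarrow> exec d s' t' s'' \<Longrightarrow> exec (Seq c d) s (t + t') s''"
| If_True: "x i > 0 \<Longrightarrow> exec c (x, is) t s' \<Longrightarrow> exec (If i c d) (x, is) (t + 1) s'"
| If_False: "x i = 0 \<Longrightarrow> exec d (x, is) t s' \<Longrightarrow> exec (If i c d) (x, is) (t + 1) s'"
| While_True: "x i > 0 \<Longrightarrow> exec c (x, is) t s' \<Longrightarrow> exec (While i c) s' t' s'' \<Longrightarrow>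
    exec (While i c) (x, is) (t + t' + 1) s''"
| While_False: "x i = 0 \<Longrightarrow> exec (While i c) (x, is) 1 (x, is)"

inductive_cases exec_elims:
  "exec Skip s t s'" "exec (Const i a) s t s'" "exec (Add i j k) s t s'"
  "exec (Sub i j k) s t s'" "exec (Load i j) s t s'" "exec (Store i j) s t s'"
  "exec (Read i) s t s'" "exec (Seq c d) s t s'" "exec (If i c d) s t s'"
  "exec (While i c) s t s'"

lemma exec_deterministic:
  "exec c s t s' \<Longrightarrow> exec c s u s'' \<Longrightarrow> u = t \<and> s'' = s'"
proof (induction arbitrary: u s'' rule: exec.induct)
  case (Seq c s t s' d t' r)
  show ?case
    using Seq.prems by (rule exec_elims(8)) (metis Seq.IH)
next
  case (If_True x i c "is" t s' d)
  show ?case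
    using If_True.prems by (rule exec_elims(9)) (use If_True.IH If_True.hyps in fastforce)+
next
  case (If_False x i d "is" t s' c)
  show ?case
    using If_False.prems by (rule exec_elims(9)) (use If_False.IH If_False.hyps in fastforce)+
next
  case (While_True x i c "is" t s' t' r)
  from While_True.prems obtain t1 s1 t2 where
    "u = Suc (t1 + t2)" "exec c (x, is) t1 s1" "exec (While i c) s1 t2 s''"
    by (rule exec_elims(10)) (use While_True.hyps in auto)
  then show ?case
    using While_True.IH by (metis Suc_eq_plus1)
next
  case (While_False x i c "is")
  show ?case
    using While_False.prems by (rule exec_elims(10)) (use While_False.hyps in auto)
qed (erule exec_elims; simp)+

text \<open>All registers are initially 0, and the answer (1 for yes, 0 for no) is left in
  register 0.\<close>

definition answers_within :: "prog \<Rightarrow> nat list \<Rightarrow> nat \<Rightarrow> bool \<Rightarrow> bool" where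
  "answers_within c inp b answer \<longleftrightarrow>
     (\<exists>t x is. exec c (\<lambda>_. 0, inp) t (x, is) \<and> t \<le> b \<and> x 0 = of_bool answer)"

text \<open>
  The input representing \<open>G\<close>: the number \<open>n\<close> of vertices, followed by the \<open>n\<^sup>2\<close> entries
  of the adjacency matrix, row by row, for the enumeration \<open>vs\<close> of the vertices.
\<close>

definition encode_graph :: "'a list \<Rightarrow> 'a pair_pre_digraph \<Rightarrow> nat list" where
  "encode_graph vs G = length vs # [of_bool ((u, v) \<in> parcs G). u \<leftarrow> vs, v \<leftarrow> vs]"

end

theory Submission
  imports Defs
begin

text \<open>
  A graph with at least 20 vertices and diameter at most 2 has a HIST unless it is an instance of
  one of two obstructions: some vertex with a non-neighbour has only neighbours of degree at most 2
  (\<open>starved\<close>), or a triangle \<open>a\<close>, \<open>t\<close>, \<open>b\<close> is attached to a complete bipartite graph between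
  \<open>{x, y}\<close> and all remaining vertices (\<open>triangled\<close>). Both are first-order sentences about the adjacency
  relation, and a fixed first-order sentence is decided in polynomial time by nested loops; the
  finitely many smaller graphs are looked up in a table.

  For the existence of a HIST one fixes a vertex \<open>d\<close> of minimum degree. If the degree is at least 3,
  every vertex at distance 2 from \<open>d\<close> is assigned to one of its neighbours in the neighbourhood \<open>X\<close>
  of \<open>d\<close>. This is a HIST rooted at \<open>d\<close> unless some \<open>x\<close> in \<open>X\<close> is bad, that is, has a single child.
  Minimality of the number of bad vertices and the diameter condition restrict the edges at the bad
  vertices and at their children so strongly that the tree can be repaired locally: bad vertices are linked
  to other vertices of \<open>X\<close>, or their children are moved together below a common neighbour.
\<close>

text \<open>The obstacle is the degree of the root. A link turns a child of \<open>d\<close> into a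
  child of another vertex of \<open>X\<close>, so after repairing s bad vertices by links the root
  keeps \<open>card X\<close> - s children, and exactly two are forbidden. For minimum degree 4 with
  two bad vertices, and for minimum degree 3 with one, linking all of them runs into exactly this;
  such cases need structural arguments and a large graph, whereas minimum degree at least 5 needs no
  bound on the number of vertices. The bound 20 comes from degree 3: the second neighbourhood has at
  least 16 vertices, at least 13 of them lie in one fibre, each of these is adjacent to one of two
  particular vertices, and so at least 7 share one; 7 is what a tree on three hubs with common
  neighbours consumes. In a graph this large both obstructions force a vertex of degree at most 2,
  so they play a role only when \<open>d\<close> has degree 2; a vertex of degree 1 has a dominating
  neighbour.\<close>

section \<open>Step bounds for programs\<close>

definition run :: "prog \<Rightarrow> config \<Rightarrow> nat \<Rightarrow> config \<Rightarrow> bool" where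
  "run c s b s' \<longleftrightarrow> (\<exists>t\<le>b. exec c s t s')"

lemma run_mono: "run c s b s' \<Longrightarrow> b \<le> b' \<Longrightarrow> run c s b' s'"
  by (meson order_trans run_def)

lemma run_atomic:
  "run Skip (x, is) 1 (x, is)"
  "y = x(i := a) \<Longrightarrow> run (Const i a) (x, is) 1 (y, is)"
  "y = x(i := x j + x k) \<Longrightarrow> run (Add i j k) (x, is) 1 (y, is)"
  "y = x(i := x j - x k) \<Longrightarrow> run (Sub i j k) (x, is) 1 (y, is)"
  "y = x(i := x (x j)) \<Longrightarrow> run (Load i j) (x, is) 1 (y, is)"
  "y = x(x i := x j) \<Longrightarrow> run (Store i j) (x, is) 1 (y, is)"
  "y = x(i := a) \<Longrightarrow> run (Read i) (x, a # is) 1 (y, is)"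
  unfolding run_def by (rule exI[of _ 1], simp add: exec.intros[simplified])+

lemma run_Seq: "run c s b s' \<Longrightarrow> run d s' b' s'' \<Longrightarrow> run (Seq c d) s (b + b') s''"
  unfolding run_def by (meson add_mono exec.Seq)

text \<open>One budget \<open>b\<close> serves both branches, and only the branch taken has to meet
  it. This is why \<open>run\<close> carries an upper bound instead of the exact number of
  steps.\<close>

lemma run_If:
  assumes "if x i > 0 then run c (x, is) b s' else run d (x, is) b s'"
  shows "run (If i c d) (x, is) (b + 1) s'"
proof -
  obtain t where t: "t \<le> b" "if x i > 0 then exec c (x, is) t s' else exec d (x, is) t s'"
    using assms by (auto simp: run_def split: if_splits)
  then have "exec (If i c d) (x, is) (t + 1) s'"
    by (cases "x i = 0") (auto intro: If_True[simplified] If_False[simplified])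
  then show ?thesis
    using t(1) by (auto simp: run_def)
qed

text \<open>Every loop of the programs counts a register down to 0, so the number \<open>m\<close>
  of rounds is fixed beforehand and the invariant can be indexed by the completed rounds. Each round
  pays one extra step for its test, and the failing test is the last step.\<close>

lemma run_While:
  assumes step: "\<And>j s. j < m \<Longrightarrow> P j s \<Longrightarrow> \<exists>s'. run c s b s' \<and> P (Suc j) s'"
    and counter: "\<And>j s. j \<le> m \<Longrightarrow> P j s \<Longrightarrow> fst s i = m - j"
    and init: "P 0 s"
  shows "\<exists>s'. run (While i c) s (m * (b + 1) + 1) s' \<and> P m s'"
proof -
  have "\<exists>s'. run (While i c) s (k * (b + 1) + 1) s' \<and> P m s'" if "P (m - k) s" "k \<le> m" for k s
    using that
  proof (induction k arbitrary: s)
    case 0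
    then have "fst s i = 0"
      using counter[of m s] by simp
    then have "exec (While i c) s 1 s"
      by (metis While_False prod.collapse)
    then show ?case
      using 0 unfolding run_def by (metis One_nat_def add.left_neutral diff_zero mult_0 order_refl)
  next
    case (Suc k)
    obtain s1 t where s1: "t \<le> b" "exec c s t s1" "P (Suc (m - Suc k)) s1"
      using step[of "m - Suc k" s] Suc.prems unfolding run_def by auto
    have "Suc (m - Suc k) = m - k"
      using Suc.prems by simp
    then obtain s' u where s': "u \<le> k * (b + 1) + 1" "exec (While i c) s1 u s'" "P m s'"
      using Suc.IH[of s1] s1(3) Suc.prems unfolding run_def by auto
    have "fst s i > 0"
      using counter[of "m - Suc k" s] Suc.prems by simp
    then have "exec (While i c) s (t + u + 1) s'"
      using s1(2) s'(2) While_True by (metis prod.collapse)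
    moreover have "t + u + 1 \<le> Suc k * (b + 1) + 1"
      using s1(1) s'(1) by simp
    ultimately show ?case
      using s'(3) unfolding run_def by blast
  qed
  from this[of m s] init show ?thesis
    by simp
qed

lemma run_If_Const':
  assumes "y = x(0 := of_bool b)" "x i = 0 \<longleftrightarrow> b"
  shows "run (If i (Const 0 0) (Const 0 1)) (x, inp) (1 + 1) (y, inp)"
  using assms by (cases b; intro run_If; auto intro!: run_atomic simp del: One_nat_def)+

lemma run_If_Const:
  assumes "y = x(0 := of_bool b)" "x i > 0 \<longleftrightarrow> b"
  shows "run (If i (Const 0 1) (Const 0 0)) (x, inp) (1 + 1) (y, inp)"
  using assms by (cases b; intro run_If; auto intro!: run_atomic simp del: One_nat_def)+

section \<open>Compiling first-order formulas\<close>

text \<open>Variables are de Bruijn levels: under \<open>k\<close> quantifiers, \<open>Exi\<close> binds the variable \<open>k\<close>.\<close>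

datatype fo = Adj nat nat | Same nat nat | Neg fo | Conj fo fo | Exi fo

fun sat :: "'a set \<Rightarrow> ('a \<Rightarrow> 'a \<Rightarrow> bool) \<Rightarrow> nat \<Rightarrow> (nat \<Rightarrow> 'a) \<Rightarrow> fo \<Rightarrow> bool" where
  "sat D A k \<rho> (Adj i j) \<longleftrightarrow> A (\<rho> i) (\<rho> j)"
| "sat D A k \<rho> (Same i j) \<longleftrightarrow> \<rho> i = \<rho> j"
| "sat D A k \<rho> (Neg \<phi>) \<longleftrightarrow> \<not> sat D A k \<rho> \<phi>"
| "sat D A k \<rho> (Conj \<phi> \<psi>) \<longleftrightarrow> sat D A k \<rho> \<phi> \<and> sat D A k \<rho> \<psi>"
| "sat D A k \<rho> (Exi \<phi>) \<longleftrightarrow> (\<exists>a\<in>D. sat D A (Suc k) (\<rho>(k := a)) \<phi>)"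

text \<open>Apart from scoping, \<open>K\<close> caps the quantifier depth at the atoms. All
  registers of variables then lie below \<open>matrix K\<close>, so an evaluation never overwrites
  the adjacency matrix.\<close>

fun scoped :: "nat \<Rightarrow> nat \<Rightarrow> fo \<Rightarrow> bool" where
  "scoped K k (Adj i j) \<longleftrightarrow> i < k \<and> j < k \<and> k \<le> K"
| "scoped K k (Same i j) \<longleftrightarrow> i < k \<and> j < k \<and> k \<le> K"
| "scoped K k (Neg \<phi>) \<longleftrightarrow> scoped K k \<phi>"
| "scoped K k (Conj \<phi> \<psi>) \<longleftrightarrow> scoped K k \<phi> \<and> scoped K k \<psi>"
| "scoped K k (Exi \<phi>) \<longleftrightarrow> scoped K (Suc k) \<phi>"

text \<open>Register 1 holds the constant 1, register 2 the number \<open>n\<close> of vertices, register 4 the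
  address \<open>matrix K\<close> of the adjacency matrix. The variable \<open>k\<close> owns four registers: its value,
  the value times \<open>n\<close> (there is no multiplication), a loop counter and a hit counter.\<close>

abbreviation (input) val_reg :: "nat \<Rightarrow> nat" where "val_reg k \<equiv> 5 + 4 * k"
abbreviation (input) row_reg :: "nat \<Rightarrow> nat" where "row_reg k \<equiv> 6 + 4 * k"
abbreviation (input) loop_reg :: "nat \<Rightarrow> nat" where "loop_reg k \<equiv> 7 + 4 * k"
abbreviation (input) hit_reg :: "nat \<Rightarrow> nat" where "hit_reg k \<equiv> 8 + 4 * k"
abbreviation (input) matrix :: "nat \<Rightarrow> nat" where "matrix K \<equiv> 9 + 4 * K"

text \<open>The loop for a quantifier does not stop at a witness: it adds up the 0/1 answers for all
  \<open>n\<close> values. Subtracting the hit counter, which has just been cleared, serves to copy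
  \<open>n\<close> into the loop counter.\<close>

fun compile :: "nat \<Rightarrow> fo \<Rightarrow> prog" where
  "compile k (Adj i j) =
    Seq (Add 3 (row_reg i) (val_reg j)) (Seq (Add 3 3 4) (Load 0 3))"
| "compile k (Same i j) =
    Seq (Sub 0 (val_reg i) (val_reg j)) (Seq (Sub 3 (val_reg j) (val_reg i))
      (Seq (Add 0 0 3) (If 0 (Const 0 0) (Const 0 1))))"
| "compile k (Neg \<phi>) = Seq (compile k \<phi>) (Sub 0 1 0)"
| "compile k (Conj \<phi> \<psi>) = Seq (compile k \<phi>) (If 0 (compile k \<psi>) Skip)"
| "compile k (Exi \<phi>) =
    Seq (Const (val_reg k) 0) (Seq (Const (row_reg k) 0) (Seq (Const (hit_reg k) 0)
      (Seq (Sub (loop_reg k) 2 (hit_reg k))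
        (Seq (While (loop_reg k)
            (Seq (compile (Suc k) \<phi>) (Seq (Add (hit_reg k) (hit_reg k) 0)
              (Seq (Add (val_reg k) (val_reg k) 1) (Seq (Add (row_reg k) (row_reg k) 2)
                (Sub (loop_reg k) (loop_reg k) 1))))))
          (If (hit_reg k) (Const 0 1) (Const 0 0))))))"

text \<open>The argument is the number of vertices. In the quantifier case 5 counts the four
  bookkeeping instructions and the test of a round, and 7 counts the four initialisations, the
  failing test and the final conditional, which takes two steps.\<close>

fun cost :: "fo \<Rightarrow> nat poly" where
  "cost (Adj i j) = [:3:]"
| "cost (Same i j) = [:5:]"
| "cost (Neg \<phi>) = cost \<phi> + [:1:]"
| "cost (Conj \<phi> \<psi>) = cost \<phi> + cost \<psi> + [:2:]"
| "cost (Exi \<phi>) = [:0, 1:] * (cost \<phi> + [:5:]) + [:7:]"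

definition env :: "nat \<Rightarrow> nat \<Rightarrow> (nat \<Rightarrow> nat \<Rightarrow> bool) \<Rightarrow> nat \<Rightarrow> (nat \<Rightarrow> nat) \<Rightarrow> (nat \<Rightarrow> nat) \<Rightarrow> bool" where
  "env K n A k \<rho> x \<longleftrightarrow> x 1 = 1 \<and> x 2 = n \<and> x 4 = matrix K \<and>
    (\<forall>i<k. x (val_reg i) = \<rho> i \<and> x (row_reg i) = \<rho> i * n \<and> \<rho> i < n) \<and>
    (\<forall>i<n. \<forall>j<n. x (matrix K + i * n + j) = of_bool (A i j))"

text \<open>An evaluation at depth \<open>k\<close> may change register 0 with the answer, the
  scratch register 3, and the blocks of the variables bound inside the formula, which lie from
  \<open>val_reg k\<close> up to the matrix.\<close>

definition keeps :: "nat \<Rightarrow> nat \<Rightarrow> (nat \<Rightarrow> nat) \<Rightarrow> (nat \<Rightarrow> nat) \<Rightarrow> bool" where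
  "keeps K k x y \<longleftrightarrow> (\<forall>r. r \<noteq> 0 \<longrightarrow> r \<noteq> 3 \<longrightarrow> r < val_reg k \<or> r \<ge> matrix K \<longrightarrow> y r = x r)"

lemma keeps_trans: "keeps K k x y \<Longrightarrow> keeps K k y z \<Longrightarrow> keeps K k x z"
  by (simp add: keeps_def)

lemma env_keeps: "env K n A k \<rho> x \<Longrightarrow> keeps K k x y \<Longrightarrow> k \<le> K \<Longrightarrow> env K n A k \<rho> y"
  unfolding env_def keeps_def by simp

lemma scoped_le: "scoped K k \<phi> \<Longrightarrow> k \<le> K"
  by (induction K k \<phi> rule: scoped.induct) auto

text \<open>\<open>keeps\<close> carries the induction: the body of a quantifier runs at depth
  \<open>Suc k\<close> and hence preserves the four registers of the variable \<open>k\<close> that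
  control the loop. By the invariant \<open>P\<close> the hit counter is positive exactly if one of
  the values tried so far satisfies the body.\<close>

lemma compile_correct:
  assumes "scoped K k \<phi>" "env K n A k \<rho> x"
  shows "\<exists>y. run (compile k \<phi>) (x, inp) (poly (cost \<phi>) n) (y, inp) \<and>
    y 0 = of_bool (sat {..<n} A k \<rho> \<phi>) \<and> keeps K k x y"
  using assms
proof (induction \<phi> arbitrary: k \<rho> x)
  case (Adj i j)
  define x1 where "x1 = x(3 := x (row_reg i) + x (val_reg j))"
  define x2 where "x2 = x1(3 := x1 3 + x1 4)"
  define x3 where "x3 = x2(0 := x2 (x2 3))"
  have "run (compile k (Adj i j)) (x, inp) (1 + (1 + 1)) (x3, inp)"
    unfolding compile.simps by (rule run_Seq run_atomic x1_def x2_def x3_def)+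
  moreover have "x3 0 = of_bool (A (\<rho> i) (\<rho> j))"
    using Adj by (simp add: x1_def x2_def x3_def env_def add.commute add.left_commute)
  moreover have "keeps K k x x3"
    by (simp add: x1_def x2_def x3_def keeps_def)
  moreover have "1 + (1 + 1) \<le> poly (cost (Adj i j)) n"
    by simp
  ultimately show ?case
    unfolding sat.simps using run_mono by blast
next
  case (Same i j)
  define x1 where "x1 = x(0 := x (val_reg i) - x (val_reg j))"
  define x2 where "x2 = x1(3 := x1 (val_reg j) - x1 (val_reg i))"
  define x3 where "x3 = x2(0 := x2 0 + x2 3)"
  define x4 where "x4 = x3(0 := of_bool (\<rho> i = \<rho> j))"
  have *: "x3 0 = 0 \<longleftrightarrow> \<rho> i = \<rho> j"
    using Same by (auto simp: x1_def x2_def x3_def env_def)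
  have "run (If 0 (Const 0 0) (Const 0 1)) (x3, inp) (1 + 1) (x4, inp)"
    using x4_def * by (rule run_If_Const')
  note If = this
  have "run (compile k (Same i j)) (x, inp) (1 + (1 + (1 + (1 + 1)))) (x4, inp)"
    unfolding compile.simps by (rule run_Seq run_atomic x1_def x2_def x3_def x4_def If)+
  moreover have "keeps K k x x4"
    by (simp add: x1_def x2_def x3_def x4_def keeps_def)
  moreover have "x4 0 = of_bool (\<rho> i = \<rho> j)"
    by (simp add: x4_def)
  moreover have "1 + (1 + (1 + (1 + 1))) \<le> poly (cost (Same i j)) n"
    by simp
  ultimately show ?case
    unfolding sat.simps using run_mono by blast
next
  case (Neg \<phi>)
  then obtain y where y: "run (compile k \<phi>) (x, inp) (poly (cost \<phi>) n) (y, inp)"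
    "y 0 = of_bool (sat {..<n} A k \<rho> \<phi>)" "keeps K k x y"
    by fastforce
  have "y 1 = 1"
    using Neg.prems y(3) by (simp add: env_def keeps_def)
  moreover have "run (compile k (Neg \<phi>)) (x, inp) (poly (cost \<phi>) n + 1) (y(0 := y 1 - y 0), inp)"
    unfolding compile.simps by (rule run_Seq run_atomic refl y)+
  moreover have "keeps K k x (y(0 := y 1 - y 0))"
    using y(3) by (simp add: keeps_def)
  moreover have "(y(0 := y 1 - y 0)) 0 = of_bool (sat {..<n} A k \<rho> (Neg \<phi>))"
    using y(2) \<open>y 1 = 1\<close> by simp
  moreover have "poly (cost \<phi>) n + 1 = poly (cost (Neg \<phi>)) n"
    by simp
  ultimately show ?case
    by metis
next
  case (Conj \<phi> \<psi>)
  obtain y where y: "run (compile k \<phi>) (x, inp) (poly (cost \<phi>) n) (y, inp)"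
    "y 0 = of_bool (sat {..<n} A k \<rho> \<phi>)" "keeps K k x y"
    using Conj.IH(1)[of k \<rho> x] Conj.prems by auto
  have "env K n A k \<rho> y"
    using env_keeps Conj.prems y(3) scoped_le by (metis scoped.simps(4))
  then obtain z where z: "run (compile k \<psi>) (y, inp) (poly (cost \<psi>) n) (z, inp)"
    "z 0 = of_bool (sat {..<n} A k \<rho> \<psi>)" "keeps K k y z"
    using Conj.IH(2)[of k \<rho> y] Conj.prems by auto
  let ?w = "if sat {..<n} A k \<rho> \<phi> then z else y"
  have "run (If 0 (compile k \<psi>) Skip) (y, inp) (poly (cost \<psi>) n + 1 + 1) (?w, inp)"
    using y(2) run_mono[OF z(1)] run_mono[OF run_atomic(1)] by (intro run_If) auto
  note If = this
  have "run (compile k (Conj \<phi> \<psi>)) (x, inp) (poly (cost \<phi>) n + (poly (cost \<psi>) n + 1 + 1)) (?w, inp)"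
    unfolding compile.simps by (rule run_Seq y If)+
  moreover have "keeps K k x ?w"
    using y(3) z(3) keeps_trans by auto
  moreover have "?w 0 = of_bool (sat {..<n} A k \<rho> (Conj \<phi> \<psi>))"
    using y(2) z(2) by simp
  moreover have "poly (cost \<phi>) n + (poly (cost \<psi>) n + 1 + 1) \<le> poly (cost (Conj \<phi> \<psi>)) n"
    by simp
  ultimately show ?case
    using run_mono by blast
next
  case (Exi \<phi>)
  have kK: "Suc k \<le> K"
    using Exi.prems scoped_le by (metis scoped.simps(5))
  let ?b = "poly (cost \<phi>) n"
  define x1 where "x1 = x(val_reg k := 0)"
  define x2 where "x2 = x1(row_reg k := 0)"
  define x3 where "x3 = x2(hit_reg k := 0)"
  define x4 where "x4 = x3(loop_reg k := x3 2 - x3 (hit_reg k))"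
  define P where "P j s \<longleftrightarrow> (\<exists>y :: nat \<Rightarrow> nat. s = (y, inp) \<and> keeps K k x y \<and> y (val_reg k) = j \<and> y (row_reg k) = j * n \<and>
    y (loop_reg k) = n - j \<and> (y (hit_reg k) > 0 \<longleftrightarrow> (\<exists>a<j. sat {..<n} A (Suc k) (\<rho>(k := a)) \<phi>)))" for j s
  let ?body = "Seq (compile (Suc k) \<phi>) (Seq (Add (hit_reg k) (hit_reg k) 0)
              (Seq (Add (val_reg k) (val_reg k) 1) (Seq (Add (row_reg k) (row_reg k) 2)
                (Sub (loop_reg k) (loop_reg k) 1))))"
  have "P 0 (x4, inp)"
    using Exi.prems kK by (simp add: P_def keeps_def env_def x1_def x2_def x3_def x4_def)
  moreover have "fst s (loop_reg k) = n - j" if "P j s" for j s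
    using that by (auto simp: P_def)
  moreover have "\<exists>s'. run ?body s (?b + 4) s' \<and> P (Suc j) s'" if j: "j < n" and "P j s" for j s
  proof -
    obtain y where s: "s = (y, inp)" and y: "keeps K k x y" "y (val_reg k) = j" "y (row_reg k) = j * n"
      "y (loop_reg k) = n - j" "y (hit_reg k) > 0 \<longleftrightarrow> (\<exists>a<j. sat {..<n} A (Suc k) (\<rho>(k := a)) \<phi>)"
      using \<open>P j s\<close> unfolding P_def by (elim exE conjE) (rule that)
    have "env K n A k \<rho> y"
      using env_keeps Exi.prems y(1) kK Suc_leD by blast
    then have "env K n A (Suc k) (\<rho>(k := j)) y"
      using j y(2,3) unfolding env_def by (auto simp: less_Suc_eq)
    then obtain z where z: "run (compile (Suc k) \<phi>) (y, inp) ?b (z, inp)"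
      "z 0 = of_bool (sat {..<n} A (Suc k) (\<rho>(k := j)) \<phi>)" "keeps K (Suc k) y z"
      using Exi.IH[of "Suc k" "\<rho>(k := j)" y] Exi.prems(1) unfolding scoped.simps by blast
    have zk: "z r = y r" if "r < val_reg (Suc k)" "r \<noteq> 0" "r \<noteq> 3" for r
      using z(3) that unfolding keeps_def by blast
    have z12: "z 1 = 1" "z 2 = n"
      using zk[of 1] zk[of 2] \<open>env K n A k \<rho> y\<close> by (auto simp: env_def)
    define z1 where "z1 = z(hit_reg k := z (hit_reg k) + z 0)"
    define z2 where "z2 = z1(val_reg k := z1 (val_reg k) + z1 1)"
    define z3 where "z3 = z2(row_reg k := z2 (row_reg k) + z2 2)"
    define z4 where "z4 = z3(loop_reg k := z3 (loop_reg k) - z3 1)"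
    have "run ?body s (?b + (1 + (1 + (1 + 1)))) (z4, inp)"
      unfolding s by (rule run_Seq run_atomic z1_def z2_def z3_def z4_def z)+
    moreover have "keeps K k x z4"
      using y(1) z(3) kK unfolding keeps_def by (simp add: z1_def z2_def z3_def z4_def)
    then have "P (Suc j) (z4, inp)"
      using z12 zk[of "val_reg k"] zk[of "row_reg k"] zk[of "loop_reg k"] zk[of "hit_reg k"] y z(2)
      unfolding P_def by (auto simp: less_Suc_eq z1_def z2_def z3_def z4_def)
    moreover have "?b + (1 + (1 + (1 + 1))) = ?b + 4"
      by simp
    ultimately show ?thesis
      by metis
  qed
  ultimately obtain s where s: "run (While (loop_reg k) ?body) (x4, inp) (n * ((?b + 4) + 1) + 1) s" "P n s"
    using run_While[of n P ?body "?b + 4" "loop_reg k" "(x4, inp)"] by blast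
  obtain y where sy: "s = (y, inp)" and y: "keeps K k x y"
      "y (hit_reg k) > 0 \<longleftrightarrow> sat {..<n} A k \<rho> (Exi \<phi>)"
      using \<open>P n s\<close> unfolding P_def by auto
  define y1 where "y1 = y(0 := of_bool (sat {..<n} A k \<rho> (Exi \<phi>)))"
  have "run (If (hit_reg k) (Const 0 1) (Const 0 0)) (y, inp) (1 + 1) (y1, inp)"
    using y1_def y(2) by (rule run_If_Const)
  note If = this
  have "run (compile k (Exi \<phi>)) (x, inp) (1 + (1 + (1 + (1 + ((n * ((?b + 4) + 1) + 1) + (1 + 1)))))) (y1, inp)"
    unfolding compile.simps by (rule run_Seq run_atomic x1_def x2_def x3_def x4_def s(1)[unfolded sy] If)+
  moreover have "keeps K k x y1"
    using y(1) by (simp add: keeps_def y1_def)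
  moreover have "y1 0 = of_bool (sat {..<n} A k \<rho> (Exi \<phi>))"
    by (simp only: y1_def fun_upd_same)
  moreover have "1 + (1 + (1 + (1 + ((n * ((?b + 4) + 1) + 1) + (1 + 1))))) \<le> poly (cost (Exi \<phi>)) n"
    by simp
  ultimately show ?case
    using run_mono by blast
qed

section \<open>The program\<close>

text \<open>A complete binary decision tree over \<open>m\<close> input bits. Its size is
  exponential in \<open>m\<close> but constant for each of the finitely many small inputs, and
  \<open>f\<close> may be any predicate because it is evaluated when the program is defined, not
  when it runs.\<close>

fun tabulate :: "nat \<Rightarrow> (nat list \<Rightarrow> bool) \<Rightarrow> prog" where
  "tabulate 0 f = Const 0 (of_bool (f []))"
| "tabulate (Suc m) f = Seq (Read 3) (If 3 (tabulate m (\<lambda>l. f (1 # l))) (tabulate m (\<lambda>l. f (0 # l))))"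

lemma tabulate_correct:
  assumes "set l \<subseteq> {0, 1}"
  shows "\<exists>y. run (tabulate (length l) f) (x, l) (2 * length l + 1) (y, []) \<and> y 0 = of_bool (f l)"
  using assms
proof (induction l arbitrary: f x)
  case Nil
  have "run (Const 0 (of_bool (f []))) (x, []) 1 (x(0 := of_bool (f [])), [])"
    by (rule run_atomic refl)+
  then have "run (tabulate (length []) f) (x, []) (2 * length [] + 1) (x(0 := of_bool (f [])), [])"
    by (simp only: list.size tabulate.simps mult_0_right add_0)
  then show ?case
    by (metis fun_upd_same)
next
  case (Cons a l)
  let ?x = "x(3 := a)"
  obtain y where y: "run (tabulate (length l) (\<lambda>l. f (a # l))) (?x, l) (2 * length l + 1) (y, [])"
    "y 0 = of_bool (f (a # l))"
    using Cons by (metis insert_subset list.simps(15))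
  have "run (If 3 (tabulate (length l) (\<lambda>l. f (1 # l))) (tabulate (length l) (\<lambda>l. f (0 # l)))) (?x, l)
    ((2 * length l + 1) + 1) (y, [])"
    using y Cons.prems by (intro run_If) auto
  note If = this
  have "run (tabulate (length (a # l)) f) (x, a # l) (1 + ((2 * length l + 1) + 1)) (y, [])"
    unfolding tabulate.simps list.size add_Suc_right add_0_right by (rule run_Seq run_atomic refl If)+
  then show ?case
    using y(2) by (intro exI[of _ y]) simp
qed

text \<open>Register 5 is compared with a constant by counting it down. The argument
  \<open>j\<close> records how much has been subtracted, so \<open>small\<close> receives the
  original value of the register at the moment it reaches 0.\<close>

fun dispatch :: "(nat \<Rightarrow> prog) \<Rightarrow> prog \<Rightarrow> nat \<Rightarrow> nat \<Rightarrow> prog" where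
  "dispatch small large 0 j = large"
| "dispatch small large (Suc m) j = If 5 (Seq (Sub 5 5 1) (dispatch small large m (Suc j))) (small j)"

lemma dispatch_small:
  assumes "x 5 < m" "x 1 = 1"
    and "\<And>y. \<exists>z. run (small (j + x 5)) (y, inp) b (z, []) \<and> z 0 = r"
  shows "\<exists>z. run (dispatch small large m j) (x, inp) (2 * m + b) (z, []) \<and> z 0 = r"
  using assms
proof (induction m arbitrary: x j)
  case (Suc m)
  show ?case
  proof (cases "x 5 = 0")
    case True
    then obtain z where z: "run (small j) (x, inp) b (z, [])" "z 0 = r"
      using Suc.prems(3) by auto
    have "run (dispatch small large (Suc m) j) (x, inp) (b + 1) (z, [])"
      unfolding dispatch.simps using True z by (intro run_If) simp
    then have "run (dispatch small large (Suc m) j) (x, inp) (2 * Suc m + b) (z, [])"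
      by (rule run_mono) simp
    then show ?thesis
      using z(2) by blast
  next
    case False
    let ?x = "x(5 := x 5 - x 1)"
    have *: "Suc j + ?x 5 = j + x 5"
      using False Suc.prems by simp
    have "\<exists>z. run (dispatch small large m (Suc j)) (?x, inp) (2 * m + b) (z, []) \<and> z 0 = r"
    proof (rule Suc.IH)
      show "\<exists>z. run (small (Suc j + ?x 5)) (y, inp) b (z, []) \<and> z 0 = r" for y
        unfolding * by (rule Suc.prems)
    qed (use Suc.prems False in auto)
    then obtain z where z: "run (dispatch small large m (Suc j)) (?x, inp) (2 * m + b) (z, [])" "z 0 = r"
      by blast
    have "run (Seq (Sub 5 5 1) (dispatch small large m (Suc j))) (x, inp) (1 + (2 * m + b)) (z, [])"
      by (rule run_Seq run_atomic refl z)+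
    then have "run (dispatch small large (Suc m) j) (x, inp) ((1 + (2 * m + b)) + 1) (z, [])"
      unfolding dispatch.simps using False by (intro run_If) simp
    then show ?thesis
      using z(2) by (intro exI[of _ z]) simp
  qed
qed simp

lemma dispatch_large:
  assumes "x 5 \<ge> m" "x 1 = 1"
    and "\<And>y. (\<And>r. r < 5 \<Longrightarrow> y r = x r) \<Longrightarrow> \<exists>z. run large (y, inp) b (z, []) \<and> z 0 = r"
  shows "\<exists>z. run (dispatch small large m j) (x, inp) (2 * m + b) (z, []) \<and> z 0 = r"
  using assms
proof (induction m arbitrary: x j)
  case 0
  then show ?case by auto
next
  case (Suc m)
  let ?x = "x(5 := x 5 - x 1)"
  have "\<exists>z. run (dispatch small large m (Suc j)) (?x, inp) (2 * m + b) (z, []) \<and> z 0 = r"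
    by (rule Suc.IH) (use Suc.prems in auto)
  then obtain z where z: "run (dispatch small large m (Suc j)) (?x, inp) (2 * m + b) (z, [])" "z 0 = r"
    by blast
  have "run (Seq (Sub 5 5 1) (dispatch small large m (Suc j))) (x, inp) (1 + (2 * m + b)) (z, [])"
    by (rule run_Seq run_atomic refl z)+
  then have "run (dispatch small large (Suc m) j) (x, inp) ((1 + (2 * m + b)) + 1) (z, [])"
    unfolding dispatch.simps using Suc.prems by (intro run_If) simp
  then show ?case
    using z(2) by (intro exI[of _ z]) simp
qed

text \<open>Register 6 receives \<open>n\<^sup>2\<close>; then the matrix is copied to memory, register 7 being the write pointer.\<close>

definition decide_fo :: "nat \<Rightarrow> fo \<Rightarrow> prog" where
  "decide_fo K \<phi> =
    Seq (Const 4 (matrix K)) (Seq (Const 6 0) (Seq (Add 5 2 6)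
      (Seq (While 5 (Seq (Add 6 6 2) (Sub 5 5 1)))
        (Seq (Const 7 (matrix K))
          (Seq (While 6 (Seq (Read 0) (Seq (Store 7 0) (Seq (Add 7 7 1) (Sub 6 6 1)))))
            (compile 0 \<phi>))))))"

lemma decide_fo_correct:
  assumes "scoped K 0 \<phi>" "x 1 = 1" "x 2 = n" "length l = n * n"
    and l: "\<And>i j. i < n \<Longrightarrow> j < n \<Longrightarrow> l ! (i * n + j) = of_bool (A i j)"
  shows "\<exists>y. run (decide_fo K \<phi>) (x, l) (4 + (n * 3 + 1) + (n * n * 5 + 1) + poly (cost \<phi>) n) (y, []) \<and>
    y 0 = of_bool (sat {..<n} A 0 \<rho> \<phi>)"
proof -
  define x1 where "x1 = x(4 := matrix K)"
  define x2 where "x2 = x1(6 := 0)"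
  define x3 where "x3 = x2(5 := x2 2 + x2 6)"
  define P where "P j s \<longleftrightarrow> (\<exists>y :: nat \<Rightarrow> nat. s = (y, l) \<and> y 1 = 1 \<and> y 2 = n \<and> y 4 = matrix K \<and> y 5 = n - j \<and> y 6 = j * n)" for j s
  have "\<exists>s'. run (While 5 (Seq (Add 6 6 2) (Sub 5 5 1))) (x3, l) (n * ((1 + 1) + 1) + 1) s' \<and> P n s'"
  proof (rule run_While)
    fix j s assume "j < n" "P j s"
    then obtain y where s: "s = (y, l)" and y: "y 1 = 1" "y 2 = n" "y 4 = matrix K" "y 5 = n - j" "y 6 = j * n"
      unfolding P_def by (elim exE conjE) (rule that)
    define y1 where "y1 = y(6 := y 6 + y 2)"
    define y2 where "y2 = y1(5 := y1 5 - y1 1)"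
    have "run (Seq (Add 6 6 2) (Sub 5 5 1)) s (1 + 1) (y2, l)"
      unfolding s by (rule run_Seq run_atomic y1_def y2_def)+
    moreover have "P (Suc j) (y2, l)"
      using y by (simp add: P_def y1_def y2_def)
    ultimately show "\<exists>s'. run (Seq (Add 6 6 2) (Sub 5 5 1)) s (1 + 1) s' \<and> P (Suc j) s'"
      by blast
  qed (use assms in \<open>auto simp: P_def x1_def x2_def x3_def\<close>)
  then obtain y where y: "run (While 5 (Seq (Add 6 6 2) (Sub 5 5 1))) (x3, l) (n * ((1 + 1) + 1) + 1) (y, l)"
    "y 1 = 1" "y 2 = n" "y 4 = matrix K" "y 6 = n * n"
    unfolding P_def by blast
  define y1 where "y1 = y(7 := matrix K)"
  let ?read = "Seq (Read 0) (Seq (Store 7 0) (Seq (Add 7 7 1) (Sub 6 6 1)))"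
  define Q where "Q j s \<longleftrightarrow> (\<exists>y :: nat \<Rightarrow> nat. s = (y, drop j l) \<and> y 1 = 1 \<and> y 2 = n \<and> y 4 = matrix K \<and> y 6 = n * n - j \<and>
    y 7 = matrix K + j \<and> (\<forall>i<j. y (matrix K + i) = l ! i))" for j s
  have "\<exists>s'. run (While 6 ?read) (y1, l) (n * n * ((1 + (1 + (1 + 1))) + 1) + 1) s' \<and> Q (n * n) s'"
  proof (rule run_While)
    fix j s assume j: "j < n * n" and "Q j s"
    then obtain y where s: "s = (y, drop j l)" and y: "y 1 = 1" "y 2 = n" "y 4 = matrix K" "y 6 = n * n - j"
      "y 7 = matrix K + j" "\<forall>i<j. y (matrix K + i) = l ! i"
      unfolding Q_def by (elim exE conjE) (rule that)
    define y1 where "y1 = y(0 := l ! j)"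
    define y2 where "y2 = y1(y1 7 := y1 0)"
    define y3 where "y3 = y2(7 := y2 7 + y2 1)"
    define y4 where "y4 = y3(6 := y3 6 - y3 1)"
    have d: "drop j l = l ! j # drop (Suc j) l"
      using j assms(4) by (simp add: Cons_nth_drop_Suc)
    have "run ?read s (1 + (1 + (1 + 1))) (y4, drop (Suc j) l)"
      unfolding s d by (rule run_Seq run_atomic y1_def y2_def y3_def y4_def)+
    moreover have "Q (Suc j) (y4, drop (Suc j) l)"
      using y by (auto simp: Q_def less_Suc_eq y1_def y2_def y3_def y4_def)
    ultimately show "\<exists>s'. run ?read s (1 + (1 + (1 + 1))) s' \<and> Q (Suc j) s'"
      by blast
  qed (use y in \<open>auto simp: Q_def y1_def\<close>)
  then obtain z where z: "run (While 6 ?read) (y1, l) (n * n * ((1 + (1 + (1 + 1))) + 1) + 1) (z, [])"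
    "z 1 = 1" "z 2 = n" "z 4 = matrix K" "\<forall>i<n * n. z (matrix K + i) = l ! i"
    unfolding Q_def using assms(4) by auto
  have "i * n + j < n * n" if "i < n" "j < n" for i j
  proof -
    have "i * n + j < Suc i * n"
      using that by simp
    also have "\<dots> \<le> n * n"
      using that by (intro mult_right_mono) auto
    finally show ?thesis .
  qed
  then have "env K n A 0 \<rho> z"
    using z l unfolding env_def by (simp add: add.assoc)
  then obtain w where w: "run (compile 0 \<phi>) (z, []) (poly (cost \<phi>) n) (w, [])" "w 0 = of_bool (sat {..<n} A 0 \<rho> \<phi>)"
    using compile_correct[OF assms(1)] by blast
  have "run (decide_fo K \<phi>) (x, l) (1 + (1 + (1 + ((n * ((1 + 1) + 1) + 1) +
    (1 + ((n * n * ((1 + (1 + (1 + 1))) + 1) + 1) + poly (cost \<phi>) n)))))) (w, [])"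
    unfolding decide_fo_def by (rule run_Seq run_atomic x1_def x2_def x3_def y1_def y z w)+
  then have "run (decide_fo K \<phi>) (x, l) (4 + (n * 3 + 1) + (n * n * 5 + 1) + poly (cost \<phi>) n) (w, [])"
    by (rule run_mono) simp
  then show ?thesis
    using w(2) by blast
qed

definition solver :: "nat \<Rightarrow> nat \<Rightarrow> (nat \<Rightarrow> nat list \<Rightarrow> bool) \<Rightarrow> fo \<Rightarrow> prog" where
  "solver N K f \<phi> = Seq (Read 2) (Seq (Const 1 1) (Seq (Const 5 0) (Seq (Add 5 2 5)
    (dispatch (\<lambda>n. tabulate (n * n) (f n)) (decide_fo K \<phi>) N 0))))"

lemma poly_nat_mono: "(m :: nat) \<le> n \<Longrightarrow> poly p m \<le> poly p n"
  by (induction p) (auto intro!: add_mono mult_mono)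

text \<open>The input has length n * n + 1, so a polynomial that is linear apart from
  \<open>cost \<phi>\<close> already covers the quadratic time for copying the matrix. The constant
  term absorbs the table lookup, whose n * n is bounded by \<open>N * N\<close>.\<close>

lemma solver_correct:
  fixes f N K \<phi>
  assumes "scoped K 0 \<phi>"
  defines "p \<equiv> [:2 * N + 2 * (N * N) + 20, 10:] + cost \<phi>"
  assumes l: "length l = n * n" "\<And>i j. i < n \<Longrightarrow> j < n \<Longrightarrow> l ! (i * n + j) = of_bool (A i j)"
    and small: "n < N \<Longrightarrow> f n l = answer" and large: "n \<ge> N \<Longrightarrow> sat {..<n} A 0 \<rho> \<phi> = answer"
  shows "answers_within (solver N K f \<phi>) (n # l) (poly p (length (n # l))) answer"
proof -
  define x1 :: "nat \<Rightarrow> nat" where "x1 = (\<lambda>_. 0)(2 := n)"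
  define x2 where "x2 = x1(1 := 1)"
  define x3 where "x3 = x2(5 := 0)"
  define x4 where "x4 = x3(5 := x3 2 + x3 5)"
  let ?D = "dispatch (\<lambda>n. tabulate (n * n) (f n)) (decide_fo K \<phi>) N 0"
  have *: "x4 5 = n" "x4 1 = 1" "x4 2 = n"
    by (auto simp: x1_def x2_def x3_def x4_def)
  have len: "length (n # l) = n * n + 1"
    using l(1) by simp
  have "\<exists>z b. run ?D (x4, l) (2 * N + b) (z, []) \<and> z 0 = of_bool answer \<and>
    2 * N + b + 4 \<le> poly p (length (n # l))"
  proof (cases "n < N")
    case True
    have "set l \<subseteq> {0, 1}"
    proof
      fix a assume "a \<in> set l"
      then obtain k where k: "k < n * n" "a = l ! k"
        using l(1) by (metis in_set_conv_nth)
      have "k = (k div n) * n + k mod n" "k div n < n" "k mod n < n"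
        using k(1) by (auto simp: less_mult_imp_div_less) (metis mod_less_divisor mult_is_0 neq0_conv not_less0)
      then show "a \<in> {0, 1}"
        using k(2) l(2)[of "k div n" "k mod n"] by auto
    qed
    then have "\<exists>z. run (tabulate (n * n) (f n)) (y, l) (2 * (n * n) + 1) (z, []) \<and> z 0 = of_bool answer" for y
      using tabulate_correct[of l "f n" y] l(1) small True by simp
    then obtain z where z: "run ?D (x4, l) (2 * N + (2 * (n * n) + 1)) (z, [])" "z 0 = of_bool answer"
      using dispatch_small[of x4 N "\<lambda>n. tabulate (n * n) (f n)" 0 l "2 * (n * n) + 1" "of_bool answer"] * True
      by auto
    have "n * n \<le> N * N"
      using True by (intro mult_mono) auto
    then have "2 * N + (2 * (n * n) + 1) + 4 \<le> poly p (length (n # l))"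
      unfolding p_def by simp
    then show ?thesis
      using z by blast
  next
    case False
    let ?b = "4 + (n * 3 + 1) + (n * n * 5 + 1) + poly (cost \<phi>) n"
    have "\<exists>z. run (decide_fo K \<phi>) (y, l) ?b (z, []) \<and> z 0 = of_bool answer"
      if "\<And>r. r < 5 \<Longrightarrow> y r = x4 r" for y
    proof -
      have "y 1 = 1" "y 2 = n"
        using that[of 1] that[of 2] * by simp_all
      moreover have "answer = sat {..<n} A 0 \<rho> \<phi>"
        using large False by simp
      ultimately show ?thesis
        using decide_fo_correct[OF assms(1), of y n l A \<rho>] l by blast
    qed
    note main = this
    have "\<exists>z. run ?D (x4, l) (2 * N + ?b) (z, []) \<and> z 0 = of_bool answer"
    proof (rule dispatch_large)
      show "N \<le> x4 5" "x4 1 = 1"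
        using * False by simp_all
      show "\<exists>z. run (decide_fo K \<phi>) (y, l) ?b (z, []) \<and> z 0 = of_bool answer"
        if "\<And>r. r < 5 \<Longrightarrow> y r = x4 r" for y
        using that by (rule main)
    qed
    then obtain z where z: "run ?D (x4, l) (2 * N + ?b) (z, [])" "z 0 = of_bool answer"
      by blast
    have "n \<le> length (n # l)"
      unfolding len by (cases n) auto
    then have "poly (cost \<phi>) n \<le> poly (cost \<phi>) (length (n # l))"
      by (rule poly_nat_mono)
    moreover have "n * 3 \<le> n * n * 3 + 3"
      by (cases n) auto
    ultimately have "2 * N + ?b + 4 \<le> poly p (length (n # l))"
      unfolding p_def len by (simp add: algebra_simps)
    then show ?thesis
      using z by blast
  qed
  then obtain z b where z: "run ?D (x4, l) (2 * N + b) (z, [])" "z 0 = of_bool answer"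
    "2 * N + b + 4 \<le> poly p (length (n # l))"
    by blast
  have "run (solver N K f \<phi>) (\<lambda>_. 0, n # l) (1 + (1 + (1 + (1 + (2 * N + b))))) (z, [])"
    unfolding solver_def by (rule run_Seq run_atomic x1_def x2_def x3_def x4_def z)+
  then show ?thesis
    using z(2,3) unfolding answers_within_def run_def by fastforce
qed

text \<open>A spanning tree is given by parent pointers towards a root \<open>r\<close>; degree 2 then means two children
  at the root and one child elsewhere.\<close>

definition has_hist :: "'a set \<Rightarrow> ('a \<Rightarrow> 'a \<Rightarrow> bool) \<Rightarrow> bool" where
  "has_hist V E \<longleftrightarrow> (\<exists>r par. r \<in> V \<and> par r = r \<and> (\<forall>v\<in>V - {r}. par v \<in> V \<and> E v (par v)) \<and>
    (\<forall>v\<in>V. \<exists>k. (par ^^ k) v = r) \<and>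
    card {v \<in> V - {r}. par v = r} \<noteq> 2 \<and> (\<forall>u\<in>V - {r}. card {v \<in> V - {r}. par v = u} \<noteq> 1))"

definition starved :: "'a set \<Rightarrow> ('a \<Rightarrow> 'a \<Rightarrow> bool) \<Rightarrow> bool" where
  "starved V E \<longleftrightarrow> (\<exists>v\<in>V. (\<exists>u\<in>V. u \<noteq> v \<and> \<not> E v u) \<and> (\<forall>w. E v w \<longrightarrow> card {x. E w x} \<le> 2))"

definition triangled :: "'a set \<Rightarrow> ('a \<Rightarrow> 'a \<Rightarrow> bool) \<Rightarrow> bool" where
  "triangled V E \<longleftrightarrow> (\<exists>x\<in>V. \<exists>y\<in>V. \<exists>a\<in>V. \<exists>t\<in>V. \<exists>b\<in>V. x \<noteq> y \<and> \<not> E x y \<and>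
    {z. E a z} = {x, t, b} \<and> {z. E t z} = {x, a, b} \<and> {z. E b z} = {y, a, t} \<and>
    (\<forall>u\<in>V - {x, y, a, t, b}. {z. E u z} = {x, y}))"

section \<open>Parent functions and graphs of diameter two\<close>

lemma has_histI:
  assumes "r \<in> V" "par r = r" "\<And>v. v \<in> V \<Longrightarrow> v \<noteq> r \<Longrightarrow> par v \<in> V \<and> E v (par v)"
    "\<And>v. v \<in> V \<Longrightarrow> \<exists>k. (par ^^ k) v = r"
    "card {v \<in> V - {r}. par v = r} \<noteq> 2"
    "\<And>u. u \<in> V \<Longrightarrow> u \<noteq> r \<Longrightarrow> card {v \<in> V - {r}. par v = u} \<noteq> 1"
  shows "has_hist V E"
  unfolding has_hist_def using assms by (intro exI[of _ r] exI[of _ par]) auto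

lemma reach_refl: fixes f :: "'a \<Rightarrow> 'a" shows "\<exists>k. (f ^^ k) r = r"
  by (rule exI[of _ 0]) simp

lemma reach_step: fixes f :: "'a \<Rightarrow> 'a" shows "\<exists>k. (f ^^ k) (f v) = r \<Longrightarrow> \<exists>k. (f ^^ k) v = r"
  by (metis comp_apply funpow_Suc_right)

lemma reach1: fixes f :: "'a \<Rightarrow> 'a" shows "f v = r \<Longrightarrow> \<exists>k. (f ^^ k) v = r"
  using reach_step[of f v r] reach_refl[of f r] by simp

lemma reach2: fixes f :: "'a \<Rightarrow> 'a" shows "f (f v) = r \<Longrightarrow> \<exists>k. (f ^^ k) v = r"
  using reach_step[of f v r] reach1[of f "f v" r] by simp

lemma reach3: fixes f :: "'a \<Rightarrow> 'a" shows "f (f (f v)) = r \<Longrightarrow> \<exists>k. (f ^^ k) v = r"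
  using reach_step[of f v r] reach2[of f "f v" r] by simp

lemma reach_cong:
  assumes "\<exists>k. (g ^^ k) v = r" "v \<in> A" "\<And>u. u \<in> A \<Longrightarrow> f u = g u \<and> g u \<in> A"
  shows "\<exists>k. (f ^^ k) v = r"
proof -
  have "(f ^^ k) v = (g ^^ k) v \<and> (g ^^ k) v \<in> A" for k
    using assms(2,3) by (induction k) auto
  then show ?thesis
    using assms(1) by metis
qed

lemma Collect_insert_Diff:
  "{v \<in> insert a A - {x}. P v} = (if a \<noteq> x \<and> P a then insert a {v \<in> A - {x}. P v} else {v \<in> A - {x}. P v})"
  by auto

lemma card_fiber_none:
  assumes "\<And>v. v \<in> A \<Longrightarrow> g v \<noteq> u"
  shows "card {v \<in> A. g v = u} \<noteq> 1"
proof -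
  have "{v \<in> A. g v = u} = {}"
    using assms by blast
  then show ?thesis
    by (simp only: card.empty)
qed

locale diam2_graph =
  fixes V :: "'a set" and E :: "'a \<Rightarrow> 'a \<Rightarrow> bool"
  assumes finite_V: "finite V"
    and sym: "E u v \<Longrightarrow> E v u"
    and irrefl: "\<not> E u u"
    and wf: "E u v \<Longrightarrow> u \<in> V"
    and diam: "u \<in> V \<Longrightarrow> v \<in> V \<Longrightarrow> u = v \<or> E u v \<or> (\<exists>w. E u w \<and> E w v)"
begin

abbreviation nbrs :: "'a \<Rightarrow> 'a set" where
  "nbrs u \<equiv> {v. E u v}"

lemma wf': "E u v \<Longrightarrow> v \<in> V"
  using sym wf by blast

lemma nbrs_subset: "nbrs u \<subseteq> V"
  using wf' by auto

lemma finite_nbrs: "finite (nbrs u)"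
  using nbrs_subset finite_V by (rule finite_subset)

lemma has_hist_dominating:
  assumes "v \<in> V" "\<And>u. u \<in> V \<Longrightarrow> u \<noteq> v \<Longrightarrow> E u v" "card V \<ge> 4"
  shows "has_hist V E"
proof (rule has_histI[of v _ "\<lambda>_. v"])
  have "{u \<in> V - {v}. v = v} = V - {v}"
    by auto
  then show "card {u \<in> V - {v}. v = v} \<noteq> 2"
    using assms finite_V by simp
  show "\<exists>k. ((\<lambda>_. v) ^^ k) u = v" for u :: 'a
    by (rule reach1) simp
qed (use assms in auto)

section \<open>A vertex of degree two\<close>

text \<open>The vertex \<open>d\<close> sees both hubs and serves as a switch. Without it the leaves
  split into \<open>P\<close> at \<open>x\<close> and \<open>Q\<close> at \<open>y\<close>, at least
  three in total; if \<open>P\<close> is empty or \<open>Q\<close> is a singleton, \<open>d\<close>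
  joins \<open>Q\<close>, otherwise it joins \<open>P\<close>, and no side is left with exactly one
  leaf.\<close>

lemma split_leaves:
  assumes "finite L" "card L \<ge> 4" "d \<in> L" "E d x" "E d y" "\<And>v. v \<in> L \<Longrightarrow> E v x \<or> E v y"
  obtains Y where "Y \<subseteq> L" "\<And>v. v \<in> Y \<Longrightarrow> E v y" "\<And>v. v \<in> L - Y \<Longrightarrow> E v x" "card Y \<noteq> 1" "card (L - Y) \<noteq> 1"
proof -
  define Q where "Q = {v \<in> L - {d}. \<not> E v x}"
  define P where "P = {v \<in> L - {d}. E v x}"
  have L: "L = insert d (P \<union> Q)" "d \<notin> P \<union> Q" "P \<inter> Q = {}"
    using assms(3) by (auto simp: P_def Q_def)
  have fin: "finite P" "finite Q"
    using assms(1) by (auto simp: P_def Q_def)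
  have card: "card P + card Q \<ge> 3"
    using assms(2) fin L by (simp add: card_Un_disjoint)
  have Q: "\<And>v. v \<in> Q \<Longrightarrow> E v y" and P: "\<And>v. v \<in> P \<Longrightarrow> E v x"
    using assms(6) by (auto simp: P_def Q_def)
  have "L - Q = insert d P" "L - insert d Q = P"
    using L by auto
  then have cards: "card (L - Q) = Suc (card P)" "card (L - insert d Q) = card P" "card (insert d Q) = Suc (card Q)"
    using L(2) fin by auto
  show ?thesis
  proof (cases "card P = 0 \<or> card Q = 1")
    case True
    show ?thesis
    proof (rule that[of "insert d Q"])
      show "card (insert d Q) \<noteq> 1" "card (L - insert d Q) \<noteq> 1"
        using True card cards by auto
    qed (use L P Q assms in auto)
  next
    case False
    show ?thesis
    proof (rule that[of Q])
      show "card Q \<noteq> 1" "card (L - Q) \<noteq> 1"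
        using False card cards by auto
    qed (use L P Q assms in auto)
  qed
qed

text \<open>The core on \<open>K\<close>, rooted at \<open>x\<close>, gives \<open>x\<close> one
  child and \<open>y\<close> none; all other vertices become leaves at one of the two hubs. As
  neither hub receives exactly one leaf, the root does not end up with two children nor
  \<open>y\<close> with one.\<close>

lemma has_hist_two_hubs:
  assumes K: "K \<subseteq> V" "x \<in> K" "y \<in> K" "x \<noteq> y"
    and c: "c x = x" "\<And>v. v \<in> K \<Longrightarrow> v \<noteq> x \<Longrightarrow> c v \<in> K \<and> E v (c v)" "\<And>v. v \<in> K \<Longrightarrow> \<exists>k. (c ^^ k) v = x"
    and deg: "card {v \<in> K - {x}. c v = x} = 1" "{v \<in> K - {x}. c v = y} = {}"
      "\<And>u. u \<in> K \<Longrightarrow> u \<noteq> x \<Longrightarrow> u \<noteq> y \<Longrightarrow> card {v \<in> K - {x}. c v = u} \<noteq> 1"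
    and L: "card (V - K) \<ge> 4" "d \<in> V - K" "E d x" "E d y" "\<And>v. v \<in> V - K \<Longrightarrow> E v x \<or> E v y"
  shows "has_hist V E"
proof -
  obtain Y where Y: "Y \<subseteq> V - K" "\<And>v. v \<in> Y \<Longrightarrow> E v y" "\<And>v. v \<in> V - K - Y \<Longrightarrow> E v x"
      "card Y \<noteq> 1" "card (V - K - Y) \<noteq> 1"
    using split_leaves[OF _ L(1-4)] L(5) finite_V by blast
  define par where "par v = (if v \<in> K then c v else if v \<in> Y then y else x)" for v
  have cK: "c v \<in> K" if "v \<in> K" for v
    using c(1,2) K(2) that by (cases "v = x") auto
  have inK: "\<exists>k. (par ^^ k) v = x" if "v \<in> K" for v
    by (rule reach_cong[OF c(3)[OF that] that]) (use cK in \<open>auto simp: par_def\<close>)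
  have chld: "{v \<in> V - {x}. par v = x} = {v \<in> K - {x}. c v = x} \<union> (V - K - Y)"
    "{v \<in> V - {x}. par v = y} = Y"
    "u \<noteq> x \<Longrightarrow> u \<noteq> y \<Longrightarrow> {v \<in> V - {x}. par v = u} = {v \<in> K - {x}. c v = u}" for u
    using K deg(2) Y(1) by (auto simp: par_def split: if_splits)
  have finK: "finite {v \<in> K - {x}. c v = x}"
    using finite_subset[OF K(1) finite_V] by simp
  have disj: "{v \<in> K - {x}. c v = x} \<inter> (V - K - Y) = {}"
    by auto
  show ?thesis
  proof (rule has_histI[of x _ par])
    show "\<exists>k. (par ^^ k) v = x" if "v \<in> V" for v
    proof (cases "v \<in> K")
      case False
      then show ?thesis
        using K inK[of x] inK[of y] reach_step[of par v x] by (auto simp: par_def)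
    qed (rule inK)
    show "card {v \<in> V - {x}. par v = x} \<noteq> 2"
      unfolding chld using finK disj Y(5) deg(1) finite_V by (subst card_Un_disjoint) auto
    show "card {v \<in> V - {x}. par v = u} \<noteq> 1" if "u \<in> V" "u \<noteq> x" for u
    proof (cases "u = y")
      case False
      have "card {v \<in> K - {x}. c v = u} \<noteq> 1"
      proof (cases "u \<in> K")
        case False
        then have "{v \<in> K - {x}. c v = u} = {}"
          using c(2) by auto
        then show ?thesis
          by (metis card.empty zero_neq_one)
      qed (use deg(3) that \<open>u \<noteq> y\<close> in blast)
      then show ?thesis
        using chld(3)[of u] that False by simp
    qed (use chld Y in simp)
    show "par v \<in> V \<and> E v (par v)" if "v \<in> V" "v \<noteq> x" for v
      using that K c Y by (auto simp: par_def)
  qed (use K c in \<open>auto simp: par_def\<close>)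
qed

lemma card_ge_of_Diff:
  assumes "finite K" "card K \<le> m" "card V \<ge> m + 4"
  shows "card (V - K) \<ge> 4"
  using assms diff_card_le_card_Diff[of K V] by linarith

text \<open>By the diameter condition every vertex outside \<open>x\<close>, \<open>y\<close> is
  adjacent to one of them, so a core joining the two hubs suffices. Three cores are considered: the
  edge between \<open>x\<close> and \<open>y\<close>; a common neighbour \<open>c\<close> with a
  further neighbour \<open>e\<close>; a path through \<open>a\<close> and \<open>b\<close> with a
  pendant vertex at each of them. If none exists, one of the obstructions appears.\<close>

lemma has_hist_degree_two:
  assumes d: "d \<in> V" "nbrs d = {x, y}" "x \<noteq> y" and n: "card V \<ge> 10"
    and "\<not> starved V E" "\<not> triangled V E"
  shows "has_hist V E"
proof -
  have dx: "E d x" "E d y" and dN: "\<And>v. E d v \<Longrightarrow> v = x \<or> v = y"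
    using d(2) by auto
  have V: "x \<in> V" "y \<in> V" and dne: "d \<noteq> x" "d \<noteq> y"
    using dx wf' irrefl by auto
  have dom: "E v x \<or> E v y" if "v \<in> V" "v \<noteq> x" "v \<noteq> y" "v \<noteq> d" for v
    using diam[OF that(1) d(1)] that dN sym by blast
  then have dom': "E v x \<or> E v y" if "v \<in> V" "v \<noteq> x" "v \<noteq> y" for v
    using that dx by blast
  show ?thesis
  proof (cases "E x y")
    case True
    show ?thesis
    proof (rule has_hist_two_hubs[of "{x, y}" x y "\<lambda>_. x" d])
      show "card (V - {x, y}) \<ge> 4"
        using n by (intro card_ge_of_Diff[of _ 2]) (auto simp: card_insert_if)
      show "\<exists>k. ((\<lambda>_. x) ^^ k) v = x" for v :: 'a
        by (rule reach1) simp
      have "{v \<in> {x, y} - {x}. x = x} = {y}"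
        using d(3) by auto
      then show "card {v \<in> {x, y} - {x}. x = x} = 1"
        by simp
    qed (use True V d dx dne dom' sym in auto)
  next
    case xy: False
    then have yx: "\<not> E y x"
      using sym by blast
    show ?thesis
    proof (cases "\<exists>c e. E c x \<and> E c y \<and> E c e \<and> e \<noteq> x \<and> e \<noteq> y")
      case True
      then obtain c e where c: "E c x" "E c y" "E c e" "e \<noteq> x" "e \<noteq> y"
        by blast
      have ne: "c \<noteq> x" "c \<noteq> y" "c \<noteq> e" "c \<noteq> d" "e \<noteq> d"
        using c xy yx irrefl dN sym by blast+
      let ?p = "(\<lambda>_. c)(x := x, c := x)"
      show ?thesis
      proof (rule has_hist_two_hubs[of "{x, y, c, e}" x y ?p d])
        show "card (V - {x, y, c, e}) \<ge> 4"
          using n by (intro card_ge_of_Diff[of _ 4]) (auto simp: card_insert_if)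
        show "\<exists>k. (?p ^^ k) v = x" for v
          by (rule reach2) simp
        note neq = ne ne[symmetric] c(4,5) c(4,5)[symmetric] d(3) d(3)[symmetric]
        have sets: "{v \<in> {x, y, c, e} - {x}. ?p v = x} = {c}" "{v \<in> {x, y, c, e} - {x}. ?p v = c} = {y, e}"
          "{v \<in> {x, y, c, e} - {x}. ?p v = e} = {}" "{v \<in> {x, y, c, e} - {x}. ?p v = y} = {}"
          by (simp_all only: Collect_insert_Diff) (simp_all add: neq)
        show "card {v \<in> {x, y, c, e} - {x}. ?p v = x} = 1"
          unfolding sets by simp
        show "{v \<in> {x, y, c, e} - {x}. ?p v = y} = {}"
          by (fact sets)
        show "card {v \<in> {x, y, c, e} - {x}. ?p v = u} \<noteq> 1" if "u \<in> {x, y, c, e}" "u \<noteq> x" "u \<noteq> y" for u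
        proof -
          have "u = c \<or> u = e"
            using that by simp
          then show ?thesis
            by (elim disjE; simp only: sets) (simp_all add: neq)
        qed
        show "?p v \<in> {x, y, c, e} \<and> E v (?p v)" if "v \<in> {x, y, c, e}" "v \<noteq> x" for v
        proof -
          have "v = y \<or> v = c \<or> v = e"
            using that by simp
          then show ?thesis
            using c(1-3) c(2,3)[THEN sym] by (elim disjE) (simp_all add: neq)
        qed
        show "{x, y, c, e} \<subseteq> V"
          using V wf[OF c(1)] wf'[OF c(3)] by simp
        show "d \<in> V - {x, y, c, e}"
          using d(1) dne by (simp add: neq)
      qed (use d(3) dx dom' in simp_all)
    next
      case False
      \<comment> \<open>A common neighbour of the hubs is thus a dead end, and the hubs can only be
        joined through an edge between \<open>A\<close> and \<open>B\<close>.\<close>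
      then have C: "e = x \<or> e = y" if "E c x" "E c y" "E c e" for c e
        using that by blast
      define A where "A = {a. E a x \<and> \<not> E a y}"
      define B where "B = {b. E b y \<and> \<not> E b x}"
      have AB: "A \<inter> B = {}" "x \<notin> A" "y \<notin> A" "x \<notin> B" "y \<notin> B"
        using irrefl xy yx by (auto simp: A_def B_def)
      show ?thesis
      proof (cases "\<exists>a b u w. a \<in> A \<and> b \<in> B \<and> E a b \<and> E a u \<and> E b w \<and> u \<noteq> x \<and> u \<noteq> b \<and> w \<noteq> y \<and> w \<noteq> a \<and> u \<noteq> w")
        case True
        then obtain a b u w where ab: "a \<in> A" "b \<in> B" "E a b" "E a u" "E b w" "u \<noteq> x" "u \<noteq> b" "w \<noteq> y" "w \<noteq> a" "u \<noteq> w"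
          by blast
        have ne: "a \<noteq> b" "a \<noteq> x" "a \<noteq> y" "b \<noteq> x" "b \<noteq> y" "u \<noteq> a" "w \<noteq> b" "u \<noteq> y" "w \<noteq> x"
          using ab AB irrefl sym by (auto simp: A_def B_def)
        have dne': "d \<noteq> a" "d \<noteq> b" "d \<noteq> u" "d \<noteq> w"
          using ab dx dN ne sym unfolding A_def B_def by blast+
        let ?p = "(\<lambda>_. b)(x := x, a := x, b := a, u := a)"
        let ?K = "{x, y, a, b, u, w}"
        show ?thesis
        proof (rule has_hist_two_hubs[of ?K x y ?p d])
          show "card (V - ?K) \<ge> 4"
            using n by (intro card_ge_of_Diff[of _ 6]) (auto simp: card_insert_if)
          show "\<exists>k. (?p ^^ k) v = x" for v
            by (rule reach3) (simp add: ne ne[symmetric] ab(6,7,10) ab(6,7,10)[symmetric])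
          note neq = ne ne[symmetric] ab(6-10) ab(6-10)[symmetric] d(3) d(3)[symmetric]
          have sets: "{v \<in> ?K - {x}. ?p v = x} = {a}" "{v \<in> ?K - {x}. ?p v = y} = {}" "{v \<in> ?K - {x}. ?p v = a} = {b, u}"
            "{v \<in> ?K - {x}. ?p v = b} = {y, w}" "{v \<in> ?K - {x}. ?p v = u} = {}" "{v \<in> ?K - {x}. ?p v = w} = {}"
            by (simp_all only: Collect_insert_Diff) (simp_all add: neq)
          show "card {v \<in> ?K - {x}. ?p v = x} = 1"
            unfolding sets by simp
          show "{v \<in> ?K - {x}. ?p v = y} = {}"
            by (fact sets)
          show "card {v \<in> ?K - {x}. ?p v = r} \<noteq> 1" if "r \<in> ?K" "r \<noteq> x" "r \<noteq> y" for r
          proof -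
            have "r = a \<or> r = b \<or> r = u \<or> r = w"
              using that by simp
            then show ?thesis
              by (elim disjE; simp only: sets) (simp_all add: neq)
          qed
          have E: "E a x" "E b a" "E u a" "E y b" "E w b"
            using ab(1-5) sym unfolding A_def B_def by auto
          show "?p v \<in> ?K \<and> E v (?p v)" if "v \<in> ?K" "v \<noteq> x" for v
          proof -
            have "v = y \<or> v = a \<or> v = b \<or> v = u \<or> v = w"
              using that by simp
            then show ?thesis
              using E by (elim disjE) (simp_all add: neq)
          qed
          show "?K \<subseteq> V"
            using V E wf by blast
          show "d \<in> V - ?K"
            using d(1) dne dne' by simp
        qed (use d(3) dx dom' in \<open>simp_all add: ne ne[symmetric] ab(6-10) ab(6-10)[symmetric]\<close>)
      next
        case False
        then have stuck: "u = w" if "a \<in> A" "b \<in> B" "E a b" "E a u" "E b w" "u \<noteq> x" "u \<noteq> b" "w \<noteq> y" "w \<noteq> a" for a b u w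
          using that by blast
        have no_third: "\<not> E a y" "\<not> E b x" if "a \<in> A" "b \<in> B" for a b
          using that by (auto simp: A_def B_def)
        have nbrA: "z = x \<or> z \<in> A \<or> z \<in> B" if "a \<in> A" "E a z" for a z
        proof (rule ccontr)
          assume z: "\<not> ?thesis"
          then have "z \<noteq> y" "z \<noteq> x"
            using that by (auto simp: A_def)
          then have "E z x" "E z y"
            using dom'[of z] z that wf' by (auto simp: A_def B_def)
          then show False
            using C[of z a] that sym AB by (metis)
        qed
        have nbrB: "z = y \<or> z \<in> A \<or> z \<in> B" if "b \<in> B" "E b z" for b z
        proof (rule ccontr)
          assume z: "\<not> ?thesis"
          then have "z \<noteq> x" "z \<noteq> y"
            using that by (auto simp: B_def)
          then have "E z x" "E z y"
            using dom'[of z] z that wf' by (auto simp: A_def B_def)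
          then show False
            using C[of z b] that sym AB by (metis)
        qed
        have deg3: "\<exists>w. E v w \<and> (\<exists>p q r. E w p \<and> E w q \<and> E w r \<and> p \<noteq> q \<and> p \<noteq> r \<and> q \<noteq> r)"
          if vu: "v \<in> V" "u \<in> V" "u \<noteq> v" "\<not> E v u" for v u
        proof -
          obtain w where "E v w" "\<not> card (nbrs w) \<le> 2"
            using vu \<open>\<not> starved V E\<close> unfolding starved_def by blast
          then have w: "E v w" "card (nbrs w) \<ge> 3"
            by simp_all
          obtain S where "S \<subseteq> nbrs w" "card S = 3"
            using w(2) obtain_subset_with_card_n by metis
          then obtain p q r where "{p, q, r} \<subseteq> nbrs w" "p \<noteq> q" "p \<noteq> r" "q \<noteq> r"
            by (auto simp: card_3_iff)
          then show ?thesis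
            using w(1) by blast
        qed
        \<comment> \<open>\<open>x\<close> and \<open>y\<close> are not adjacent, so neither of them
          may witness starvation. The resulting \<open>a0\<close> and \<open>b0\<close> have three
          neighbours, which by \<open>C\<close> excludes common neighbours of \<open>x\<close> and
          \<open>y\<close>.\<close>
        obtain a0 where a0: "E x a0" "\<exists>p q r. E a0 p \<and> E a0 q \<and> E a0 r \<and> p \<noteq> q \<and> p \<noteq> r \<and> q \<noteq> r"
          using deg3[of x y] V d(3) xy by blast
        obtain b0 where b0: "E y b0" "\<exists>p q r. E b0 p \<and> E b0 q \<and> E b0 r \<and> p \<noteq> q \<and> p \<noteq> r \<and> q \<noteq> r"
          using deg3[of y x] V d(3) yx by blast
        have a0A: "a0 \<in> A"
        proof (rule ccontr)
          assume "a0 \<notin> A"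
          then have "E a0 x" "E a0 y"
            using a0(1) sym by (auto simp: A_def)
          then show False
            using C[of a0] a0(2) by metis
        qed
        have b0B: "b0 \<in> B"
        proof (rule ccontr)
          assume "b0 \<notin> B"
          then have "E b0 x" "E b0 y"
            using b0(1) sym by (auto simp: B_def)
          then show False
            using C[of b0] b0(2) by metis
        qed
        have extra: "\<exists>u. E a0 u \<and> u \<noteq> p \<and> u \<noteq> q" "\<exists>u. E b0 u \<and> u \<noteq> p \<and> u \<noteq> q" for p q
          using a0(2) b0(2) by metis+
        text \<open>A cross edge whose ends both have a further neighbour is the long edge of the triangle.\<close>
        have crossing: "\<exists>a b t. a \<in> A \<and> b \<in> B \<and> E a b \<and> E a t \<and> E b t \<and> t \<noteq> x \<and> t \<noteq> y"
        proof -
          have *: ?thesis if "a \<in> A" "b \<in> B" "E a b" "E a u" "u \<noteq> x" "u \<noteq> b" "E b w" "w \<noteq> y" "w \<noteq> a" for a b u w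
            using stuck[OF that(1-3,4,7,5,6,8,9)] that by metis
          show ?thesis
          proof (cases "E a0 b0")
            case True
            then show ?thesis
              using *[OF a0A b0B] extra(1)[of x b0] extra(2)[of y a0] by metis
          next
            case False
            have "a0 \<noteq> b0" "a0 \<in> V" "b0 \<in> V"
              using a0A b0B AB a0 b0 wf' by auto
            then obtain m where m: "E a0 m" "E m b0"
              using diam False by blast
            \<comment> \<open>If the middle vertex lies in \<open>A\<close>, then \<open>m\<close>,
              \<open>b0\<close> is a cross edge and \<open>a0\<close> a further neighbour of
              \<open>m\<close>; if it lies in \<open>B\<close>, then \<open>a0\<close>,
              \<open>m\<close> is a cross edge and \<open>b0\<close> a further neighbour of
              \<open>m\<close>.\<close>
            then consider "m \<in> A" | "m \<in> B"
              using nbrA[OF a0A m(1)] b0B no_third a0A sym unfolding B_def by blast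
            then show ?thesis
            proof cases
              case 1
              have "a0 \<noteq> x" "a0 \<noteq> b0"
                using a0 b0 irrefl \<open>a0 \<noteq> b0\<close> by blast+
              then show ?thesis
                using *[OF 1 b0B m(2), of a0] m sym extra(2)[of y m] by metis
            next
              case 2
              have "b0 \<noteq> y" "b0 \<noteq> a0"
                using a0 b0 irrefl \<open>a0 \<noteq> b0\<close> by blast+
              then show ?thesis
                using *[OF a0A 2 m(1) _ _ _ m(2)] extra(1)[of x m] by metis
            qed
          qed
        qed
        \<comment> \<open>Stated for \<open>x'\<close> and \<open>y'\<close> in either order,
          because the third vertex of the triangle may lie in \<open>A\<close> or in
          \<open>B\<close>.\<close>
        have build: "triangled V E"
          if xy': "{x', y'} = {x, y}" "A' = {v. E v x' \<and> \<not> E v y'}" "B' = {v. E v y' \<and> \<not> E v x'}"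
            and abt: "a \<in> A'" "t \<in> A'" "b \<in> B'" "E a b" "E a t" "E b t"
            and stuck': "\<And>a b u w. a \<in> A' \<Longrightarrow> b \<in> B' \<Longrightarrow> E a b \<Longrightarrow> E a u \<Longrightarrow> E b w \<Longrightarrow> u \<noteq> x' \<Longrightarrow> u \<noteq> b \<Longrightarrow>
              w \<noteq> y' \<Longrightarrow> w \<noteq> a \<Longrightarrow> u = w"
          for x' y' A' B' a t b
        proof -
          have xyV: "x' \<in> V" "y' \<in> V" "x' \<noteq> y'" "\<not> E x' y'" "\<not> E y' x'"
            using xy'(1) V xy yx d(3) by (auto simp: doubleton_eq_iff)
          have dom2: "E v x' \<or> E v y'" if "v \<in> V" "v \<noteq> x'" "v \<noteq> y'" for v
            using dom'[of v] that xy'(1) by (auto simp: doubleton_eq_iff)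
          have C2: "e = x' \<or> e = y'" if "E c x'" "E c y'" "E c e" for c e
            using C[of c e] that xy'(1) by (auto simp: doubleton_eq_iff)
          have ne: "a \<noteq> b" "a \<noteq> t" "b \<noteq> t" "a \<noteq> x'" "t \<noteq> x'" "b \<noteq> y'" "a \<noteq> y'" "t \<noteq> y'" "b \<noteq> x'"
            using abt irrefl xyV unfolding xy'(2,3) by blast+
          have bN: "nbrs b = {y', a, t}"
          proof -
            have "w = t" if "E b w" "w \<noteq> y'" "w \<noteq> a" for w
              using stuck'[OF abt(1,3,4,5) that(1)] that ne by blast
            then show ?thesis
              using abt sym unfolding xy'(3) by auto
          qed
          have aN: "nbrs a = {x', t, b}"
          proof -
            have "u = t" if "E a u" "u \<noteq> x'" "u \<noteq> b" for u
              using stuck'[OF abt(1,3,4) that(1) abt(6) that(2,3)] ne by blast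
            then show ?thesis
              using abt unfolding xy'(2) by auto
          qed
          have tN: "nbrs t = {x', a, b}"
          proof -
            have "u = a" if "E t u" "u \<noteq> x'" "u \<noteq> b" for u
              using stuck'[OF abt(2,3) sym[OF abt(6)] that(1) sym[OF abt(4)] that(2,3)] ne by blast
            then show ?thesis
              using abt sym unfolding xy'(2) by auto
          qed
          \<comment> \<open>\<open>u\<close> reaches \<open>a\<close> and \<open>b\<close> in two
            steps without touching the triangle, and the only neighbour of \<open>a\<close> outside
            the triangle is \<open>x'\<close>, that of \<open>b\<close> is
            \<open>y'\<close>.\<close>
          have "nbrs u = {x', y'}" if u: "u \<in> V - {x', y', a, t, b}" for u
          proof -
            have nb: "\<not> E u b" "\<not> E u a" "\<not> E u t"
              using bN aN tN u sym by blast+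
            have "u \<in> V" "u \<noteq> a" "u \<noteq> b"
              using u by auto
            then obtain w w' where w: "E u w" "E w b" "E u w'" "E w' a"
              using diam[of u b] diam[of u a] nb abt(4) wf wf' by blast
            have "w \<in> nbrs b" "w' \<in> nbrs a"
              using w(2,4) sym by auto
            then have "w = y'" "w' = x'"
              using w(1,3) nb unfolding aN bN by auto
            then have "E u x'" "E u y'"
              using w by auto
            then show ?thesis
              using C2[of u] by auto
          qed
          moreover have "a \<in> V" "t \<in> V" "b \<in> V"
            using abt(4,6) wf wf' by auto
          ultimately show ?thesis
            unfolding triangled_def using xyV aN tN bN
            by (intro bexI[of _ x'] bexI[of _ y'] bexI[of _ a] bexI[of _ t] bexI[of _ b] conjI ballI) simp_all
        qed
        obtain a b t where abt: "a \<in> A" "b \<in> B" "E a b" "E a t" "E b t" "t \<noteq> x" "t \<noteq> y"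
          using crossing by blast
        consider "t \<in> A" | "t \<in> B"
          using nbrA[OF abt(1,4)] abt(6) by blast
        then have "triangled V E"
        proof cases
          case 1
          then show ?thesis
            using build[of x y A B a t b] abt stuck unfolding A_def B_def by blast
        next
          case 2
          have "u = w" if "a \<in> B" "b \<in> A" "E a b" "E a u" "E b w" "u \<noteq> y" "u \<noteq> b" "w \<noteq> x" "w \<noteq> a" for a b u w
            using stuck[OF that(2,1) sym[OF that(3)] that(5,4,8,9,6,7)] by simp
          then show ?thesis
            using build[of y x B A b t a] abt 2 sym unfolding A_def B_def by blast
        qed
        then show ?thesis
          using \<open>\<not> triangled V E\<close> by simp
      qed
    qed
  qed
qed

section \<open>Three common neighbours\<close>

text \<open>The number 7 is what the tree consumes: \<open>f\<close> joins \<open>q\<close> and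
  \<open>s\<close> to the root \<open>p\<close>, and each of the three hubs gets two leaves. The
  hubs then have degree at least 3, so any further vertices may be added to them. The vertices of
  \<open>L\<close> hang on hubs, directly or through one intermediate vertex, as prescribed by
  \<open>g\<close>.\<close>

lemma has_hist_three_hubs:
  assumes hubs: "p \<in> V" "q \<in> V" "s \<in> V" "p \<noteq> q" "p \<noteq> s" "q \<noteq> s"
    and M: "M \<subseteq> V - {p, q, s}" "card M \<ge> 7" "\<And>v. v \<in> M \<Longrightarrow> E v p \<and> E v q \<and> E v s"
    and L: "L = V - {p, q, s} - M"
      "\<And>v. v \<in> L \<Longrightarrow> E v (g v) \<and> (g v \<in> {p, q, s} \<or> g v \<in> L \<and> g (g v) \<in> {p, q, s})"
      "\<And>u. u \<in> L \<Longrightarrow> card {v \<in> L. g v = u} \<noteq> 1"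
  shows "has_hist V E"
proof -
  obtain T where T: "T \<subseteq> M" "card T = 7" "finite T"
    using obtain_subset_with_card_n[OF M(2)] by metis
  obtain ms where ms: "set ms = T" "distinct ms"
    using finite_distinct_list[OF T(3)] by blast
  have "length ms = 7"
    using distinct_card[OF ms(2)] ms(1) T(2) by simp
  then obtain f q1 q2 s1 s2 r1 r2 where "ms = [f, q1, q2, s1, s2, r1, r2]"
    by (auto simp: numeral_eq_Suc length_Suc_conv)
  then have in_M: "f \<in> M" "q1 \<in> M" "q2 \<in> M" "s1 \<in> M" "s2 \<in> M" "r1 \<in> M" "r2 \<in> M"
    and dist: "distinct [f, q1, q2, s1, s2, r1, r2]"
    using ms T(1) by auto
  define par where "par v = (if v = p then p else if v = q \<or> v = s then f else if v = q1 \<or> v = q2 then q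
    else if v = s1 \<or> v = s2 then s else if v \<in> M then p else g v)" for v
  have M': "v \<in> V" "v \<noteq> p" "v \<noteq> q" "v \<noteq> s" "v \<notin> L" if "v \<in> M" for v
    using that M(1) L(1) by auto
  have L': "v \<in> V" "v \<noteq> p" "v \<noteq> q" "v \<noteq> s" "v \<notin> M" if "v \<in> L" for v
    using that L(1) by auto
  have cases: "v = p \<or> v = q \<or> v = s \<or> v \<in> M \<or> v \<in> L" if "v \<in> V" for v
    using that L(1) by auto
  have par_hubs: "par p = p" "par q = f" "par s = f" "par f = p"
    using hubs(4-6) in_M(1) M'[OF in_M(1)] dist by (auto simp: par_def)
  have par_M: "par v \<in> {p, q, s}" if "v \<in> M" for v
    using M'[OF that] that by (auto simp: par_def)
  have par_L: "par v = g v" if "v \<in> L" for v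
    using L'[OF that] in_M by (auto simp: par_def)
  have par_spec: "par q1 = q" "par q2 = q" "par s1 = s" "par s2 = s" "par r1 = p" "par r2 = p"
    using M'[OF in_M(2)] M'[OF in_M(3)] M'[OF in_M(4)] M'[OF in_M(5)] M'[OF in_M(6)] M'[OF in_M(7)] in_M dist
    by (auto simp: par_def)
  have reach_hub: "\<exists>k. (par ^^ k) v = p" if "v \<in> {p, q, s}" for v
  proof -
    have "par (par v) = p"
      using that par_hubs by auto
    then show ?thesis
      by (rule reach2)
  qed
  have reach_L: "\<exists>k. (par ^^ k) v = p" if v: "v \<in> L" for v
  proof -
    have "\<exists>k. (par ^^ k) (g v) = p"
    proof (cases "g v \<in> {p, q, s}")
      case True
      then show ?thesis
        by (rule reach_hub)
    next
      case False
      then have "g v \<in> L" "g (g v) \<in> {p, q, s}"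
        using L(2)[OF v] by auto
      then show ?thesis
        using reach_step[of par "g v" p] reach_hub par_L by metis
    qed
    then show ?thesis
      using reach_step[of par v p] par_L[OF v] by simp
  qed
  have fin: "finite {v \<in> V - {p}. par v = u}" for u
    using finite_V by simp
  show ?thesis
  proof (rule has_histI[of p _ par])
    show "par v \<in> V \<and> E v (par v)" if v: "v \<in> V" "v \<noteq> p" for v
    proof -
      consider "v = q \<or> v = s" | "v \<in> M" | "v \<in> L"
        using cases[OF v(1)] v(2) by blast
      then show ?thesis
      proof cases
        case 1
        have "E q f" "E s f"
          using M(3)[OF in_M(1)] sym by blast+
        then show ?thesis
          using 1 par_hubs(2,3) M'(1)[OF in_M(1)] by auto
      next
        case 2
        then show ?thesis
          using par_M[OF 2] M(3)[OF 2] hubs(1-3) by auto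
      next
        case 3
        then show ?thesis
          using par_L[OF 3] L(2)[OF 3] wf' by auto
      qed
    qed
    show "\<exists>k. (par ^^ k) v = p" if v: "v \<in> V" for v
    proof -
      consider "v \<in> {p, q, s}" | "v \<in> M" | "v \<in> L"
        using cases[OF v(1)] by blast
      then show ?thesis
      proof cases
        case 2
        show ?thesis
          by (rule reach_step[OF reach_hub[OF par_M[OF 2]]])
      qed (use reach_hub reach_L in auto)
    qed
    have "{f, r1, r2} \<subseteq> {v \<in> V - {p}. par v = p}"
      using in_M M' par_hubs(4) par_spec(5,6) by auto
    then have "card {f, r1, r2} \<le> card {v \<in> V - {p}. par v = p}"
      using fin by (intro card_mono)
    then show "card {v \<in> V - {p}. par v = p} \<noteq> 2"
      using dist by simp
    show "card {v \<in> V - {p}. par v = u} \<noteq> 1" if u: "u \<in> V" "u \<noteq> p" for u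
    proof -
      have two: ?thesis if "a \<in> V" "b \<in> V" "a \<noteq> p" "b \<noteq> p" "a \<noteq> b" "par a = u" "par b = u" for a b
      proof -
        have "card {a, b} \<le> card {v \<in> V - {p}. par v = u}"
          using that by (intro card_mono fin) auto
        then show ?thesis
          using that(5) by simp
      qed
      consider "u = q" | "u = s" | "u = f" | "u \<in> M" "u \<noteq> f" | "u \<in> L"
        using cases[OF u(1)] u(2) by blast
      then show ?thesis
      proof cases
        case 1
        then show ?thesis
          using two[of q1 q2] in_M M' par_spec dist by auto
      next
        case 2
        then show ?thesis
          using two[of s1 s2] in_M M' par_spec dist by auto
      next
        case 3
        then show ?thesis
          using two[of q s] hubs par_hubs by auto
      next
        case 4
        have "par v \<noteq> u" if v: "v \<in> V" for v
          using cases[OF v] par_hubs par_M[of v] par_L[of v] L(2)[of v] M'[OF 4(1)] 4(2) u(2) by auto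
        then show ?thesis
          by (intro card_fiber_none) auto
      next
        case 5
        have in_L: "v \<in> L" if v: "v \<in> V" "par v = u" for v
          using cases[OF v(1)] v(2) par_hubs par_M[of v] L'[OF 5] in_M(1) by auto
        have "v \<in> V - {p} \<and> par v = u \<longleftrightarrow> v \<in> L \<and> g v = u" for v
          using in_L[of v] L'(1,2)[of v] par_L[of v] by (cases "v \<in> L") auto
        then have "{v \<in> V - {p}. par v = u} = {v \<in> L. g v = u}"
          by blast
        then show ?thesis
          using L(3)[OF 5] by simp
      qed
    qed
  qed (use hubs par_hubs in auto)
qed

end

section \<open>Trees hanging from a fixed vertex\<close>

lemma card_1_disjoint_union:
  assumes "finite A" "finite B" "A \<inter> B = {}" "card A \<noteq> 1" "card B \<noteq> 1"
  shows "card (A \<union> B) \<noteq> 1"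
  using assms by (simp add: card_Un_disjoint)

locale rooted_graph = diam2_graph +
  fixes d :: 'a
  assumes d_in: "d \<in> V"
begin

definition X :: "'a set" where "X = nbrs d"
definition W :: "'a set" where "W = V - insert d X"

lemma V_iff: "\<And>v. v \<in> V \<longleftrightarrow> v = d \<or> v \<in> X \<or> v \<in> W" and d_X: "d \<notin> X" and d_W: "d \<notin> W" and X_W: "X \<inter> W = {}"
  and finite_X: "finite X" and finite_W: "finite W"
  using d_in nbrs_subset[of d] irrefl finite_V finite_nbrs by (auto simp: X_def W_def)

lemma X_adj: "x \<in> X \<longleftrightarrow> E d x"
  by (simp add: X_def)

lemma W_not_adj: "w \<in> W \<Longrightarrow> \<not> E w d" "w \<in> W \<Longrightarrow> \<not> E d w"
  using sym by (auto simp: W_def X_def)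

lemma nbr_cases: "E u v \<Longrightarrow> v = d \<or> v \<in> X \<or> v \<in> W"
  using wf' V_iff by auto

text \<open>A bad vertex is repaired by a second child, taken from \<open>X\<close>: a linkage supplies one to each vertex of \<open>S\<close>.\<close>

definition linkage :: "'a set \<Rightarrow> ('a \<Rightarrow> 'a) \<Rightarrow> bool" where
  "linkage S lk \<longleftrightarrow> lk d = d \<and> (\<forall>x\<in>X. lk x = d \<or> lk x \<in> X \<and> E x (lk x)) \<and> (\<forall>x\<in>X. \<exists>k. (lk ^^ k) x = d) \<and>
    (\<forall>x\<in>S. {y \<in> X. lk y = x} \<noteq> {}) \<and> (\<forall>x\<in>X - S. {y \<in> X. lk y = x} = {})"

lemma linkage_empty: "linkage {} (\<lambda>_. d)"
  unfolding linkage_def using d_X by (auto intro: reach1)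

text \<open>Greedy induction. A new child \<open>y\<close> of \<open>x\<close> has to be a neighbour
  in \<open>X\<close> that still hangs on \<open>d\<close> and is not the ancestor of
  \<open>x\<close> among the children of \<open>d\<close>, as that would close a cycle. The first
  condition excludes \<open>card S\<close> vertices of \<open>X\<close>, the second at most
  one.\<close>

lemma linkage_exists:
  assumes "finite S" "S \<subseteq> X" "\<And>x. x \<in> S \<Longrightarrow> card S \<le> card (nbrs x \<inter> X)"
  shows "\<exists>lk. linkage S lk \<and> card {x \<in> X. lk x = d} + card S = card X"
  using assms
proof (induction S rule: finite_induct)
  case empty
  show ?case
    using linkage_empty by (intro exI[of _ "\<lambda>_. d"]) simp
next
  case (insert x S)
  have "card S \<le> card (nbrs y \<inter> X)" if "y \<in> S" for y
    using insert.prems(2)[of y] insert.hyps that by simp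
  then obtain lk where lk: "linkage S lk" "card {x \<in> X. lk x = d} + card S = card X"
    using insert.IH insert.prems(1) by blast
  define R where "R = {y \<in> X. lk y = d}"
  define Anc where "Anc = {y \<in> R. \<exists>k. (lk ^^ k) x = y}"
  have x: "x \<in> X" and lkd: "lk d = d"
    using insert.prems lk by (auto simp: linkage_def)
  have fix_d: "(lk ^^ k) d = d" for k
    using lkd by (induction k) auto
  have past: "(lk ^^ Suc k) y = d" if "y \<in> R" for k y
    using that fix_d by (simp add: funpow_swap1 R_def)
  have Anc_eq: "k \<le> k' \<Longrightarrow> (lk ^^ k) x \<in> R \<Longrightarrow> (lk ^^ k') x \<in> R \<Longrightarrow> (lk ^^ k) x = (lk ^^ k') x" for k k'
  proof (rule ccontr)
    assume k: "k \<le> k'" "(lk ^^ k) x \<in> R" "(lk ^^ k') x \<in> R" "(lk ^^ k) x \<noteq> (lk ^^ k') x"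
    then obtain m where "k' = Suc m + k"
      by (metis add.commute add_Suc le_neq_implies_less less_imp_Suc_add)
    then have "(lk ^^ k') x = (lk ^^ Suc m) ((lk ^^ k) x)"
      by (simp only: funpow_add o_apply)
    then show False
      using past[OF k(2), of m] k(3) d_X by (simp add: R_def)
  qed
  have "card Anc \<le> Suc 0"
  proof -
    have "finite Anc"
      using finite_X by (simp add: Anc_def R_def)
    moreover have "a = b" if ab: "a \<in> Anc" "b \<in> Anc" for a b
    proof -
      obtain k k' where "(lk ^^ k) x = a" "(lk ^^ k') x = b" "a \<in> R" "b \<in> R"
        using ab unfolding Anc_def by blast
      then show ?thesis
        using Anc_eq[of k k'] Anc_eq[of k' k] by (cases "k \<le> k'") simp_all
    qed
    ultimately show ?thesis
      by (simp add: card_le_Suc0_iff_eq)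
  qed
  have "x \<in> X - R \<union> Anc"
    using x by (auto simp: Anc_def intro: exI[of _ 0])
  have "card (X - R \<union> Anc) \<le> card (X - R) + card Anc"
    by (rule card_Un_le)
  also have "card (X - R) = card S"
    using lk(2) finite_X by (subst card_Diff_subset) (auto simp: R_def)
  finally have "card (X - R \<union> Anc) \<le> Suc (card S)"
    using \<open>card Anc \<le> Suc 0\<close> by simp
  \<comment> \<open>\<open>x\<close> belongs to the forbidden set and is not its own neighbour, so
    at most \<open>card S\<close> of its neighbours are excluded, fewer than it has in
    \<open>X\<close>.\<close>
  then have "card ((X - R \<union> Anc) - {x}) \<le> card S"
    using \<open>x \<in> X - R \<union> Anc\<close> by simp
  moreover have "finite ((X - R \<union> Anc) - {x})"
    using finite_X by (simp add: Anc_def R_def)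
  ultimately have "\<not> nbrs x \<inter> X \<subseteq> (X - R \<union> Anc) - {x}"
    using insert.prems(2)[of x] insert.hyps card_mono[of "(X - R \<union> Anc) - {x}" "nbrs x \<inter> X"] by auto
  then obtain y where y: "E x y" "y \<in> X" "y \<in> R" "y \<notin> Anc"
    using irrefl by blast
  then have yx: "(lk ^^ k) x \<noteq> y" for k
    by (auto simp: Anc_def)
  have ne: "y \<noteq> d" "y \<noteq> x" "x \<noteq> d"
    using y x d_X irrefl by auto
  define lk' where "lk' = lk(y := x)"
  have "(lk' ^^ k) x = (lk ^^ k) x" for k
    using yx by (induction k) (auto simp: lk'_def)
  then have reach_x: "\<exists>k. (lk' ^^ k) x = d"
    using lk(1) x unfolding linkage_def by metis
  have "\<exists>k. (lk' ^^ k) v = d" if "(lk ^^ m) v = d" for m v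
    using that
  proof (induction m arbitrary: v)
    case 0
    then show ?case
      by (auto intro: exI[of _ 0])
  next
    case (Suc m)
    show ?case
    proof (rule reach_step)
      show "\<exists>k. (lk' ^^ k) (lk' v) = d"
      proof (cases "v = y")
        case True
        then have "lk' v = x"
          by (simp add: lk'_def)
        then show ?thesis
          using reach_x by simp
      next
        case False
        then have "lk' v = lk v"
          by (simp add: lk'_def)
        moreover have "(lk ^^ m) (lk v) = d"
          using Suc.prems by (simp add: funpow_swap1)
        ultimately show ?thesis
          using Suc.IH by simp
      qed
    qed
  qed
  then have "\<forall>v\<in>X. \<exists>k. (lk' ^^ k) v = d"
    using lk(1) unfolding linkage_def by blast
  moreover have "\<forall>v\<in>X. lk' v = d \<or> lk' v \<in> X \<and> E v (lk' v)"
    using lk(1) x y(1) sym by (auto simp: linkage_def lk'_def)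
  moreover have "lk' d = d"
    using lkd ne by (simp add: lk'_def)
  moreover have "{z \<in> X. lk' z = v} = (if v = x then insert y {z \<in> X. lk z = v} else {z \<in> X. lk z = v} - {y})" for v
    using y(2) by (auto simp: lk'_def)
  note ch = this
  have "lk y = d"
    using y(3) by (simp add: R_def)
  have ch_X: "{z \<in> X. lk' z = v} = (if v = x then insert y {z \<in> X. lk z = v} else {z \<in> X. lk z = v})" if "v \<in> X" for v
    using that \<open>lk y = d\<close> d_X unfolding ch by auto
  have "{z \<in> X. lk' z = v} \<noteq> {}" if "v \<in> insert x S" for v
  proof (cases "v = x")
    case True
    then show ?thesis
      unfolding True ch_X[OF x] by simp
  next
    case False
    then have v: "v \<in> S" "v \<in> X"
      using that insert.prems(1) by auto
    then have "{z \<in> X. lk z = v} \<noteq> {}"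
      using lk(1) unfolding linkage_def by blast
    then show ?thesis
      unfolding ch_X[OF v(2)] using False by simp
  qed
  moreover have "{z \<in> X. lk' z = v} = {}" if "v \<in> X - insert x S" for v
  proof -
    have "{z \<in> X. lk z = v} = {}"
      using that lk(1) by (simp add: linkage_def)
    then show ?thesis
      using that ch_X[of v] by simp
  qed
  ultimately have "linkage (insert x S) lk'"
    unfolding linkage_def by blast
  moreover have "card {z \<in> X. lk' z = d} + card (insert x S) = card X"
  proof -
    have "{z \<in> X. lk' z = d} = R - {y}"
      using ne unfolding ch R_def by auto
    moreover have "card R > 0"
      using y(3) finite_X by (auto simp: R_def card_gt_0_iff)
    ultimately show ?thesis
      using lk(2) y(3) insert.hyps finite_X by (simp add: R_def)
  qed
  ultimately show ?case
    by blast
qed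

definition pure :: "('a \<Rightarrow> 'a) \<Rightarrow> bool" where
  "pure \<phi> \<longleftrightarrow> (\<forall>w\<in>W. \<phi> w \<in> X \<and> E w (\<phi> w))"

definition fib :: "('a \<Rightarrow> 'a) \<Rightarrow> 'a \<Rightarrow> 'a set" where
  "fib \<phi> x = {w \<in> W. \<phi> w = x}"

definition bads :: "('a \<Rightarrow> 'a) \<Rightarrow> 'a set" where
  "bads \<phi> = {x \<in> X. card (fib \<phi> x) = 1}"

lemma finite_fib: "finite (fib \<phi> x)"
  using finite_W by (simp add: fib_def)

text \<open>Vertices of \<open>W\<close> have no children under \<open>\<phi>\<close>, so
  \<open>p\<close> and \<open>q\<close> become branch vertices with the children \<open>P\<close>
  and \<open>Q\<close>, or with their union if they coincide. The conditions on \<open>p\<close> and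
  \<open>q\<close> are not symmetric: \<open>q\<close> may lie in \<open>P\<close>, so that the
  second group hangs below a member of the first.\<close>

lemma has_hist_hubs:
  assumes \<phi>: "pure \<phi>" and lk: "linkage S lk" "S \<subseteq> X" "card {x \<in> X. lk x = d} \<noteq> 2"
    and Z: "P \<subseteq> W" "Q \<subseteq> W" "P \<inter> Q = {}" "card P \<noteq> 1" "card Q \<noteq> 1"
    and p: "\<And>z. z \<in> P \<Longrightarrow> E z p \<and> p \<in> W - P - Q" and q: "\<And>z. z \<in> Q \<Longrightarrow> E z q \<and> q \<in> W - Q"
    and fibs: "\<And>x. x \<in> X - S \<Longrightarrow> card (fib \<phi> x - P - Q) \<noteq> 1" "\<And>x. x \<in> S \<Longrightarrow> fib \<phi> x - P - Q \<noteq> {}"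
  shows "has_hist V E"
proof -
  define par where "par v = (if v = d then d else if v \<in> X then lk v else if v \<in> P then p else if v \<in> Q then q else \<phi> v)" for v
  have parX: "par x = lk x" if "x \<in> X" for x
    using that d_X by (auto simp: par_def)
  have parP: "par w = p" if "w \<in> P" for w
    using that Z X_W d_W by (auto simp: par_def)
  have parQ: "par w = q" if "w \<in> Q" for w
    using that Z X_W d_W by (auto simp: par_def)
  have parW: "par w = \<phi> w" if "w \<in> W" "w \<notin> P" "w \<notin> Q" for w
    using that Z X_W d_W by (auto simp: par_def)
  have lkX: "lk x = d \<or> lk x \<in> X \<and> E x (lk x)" if "x \<in> X" for x
    using lk(1) that by (simp add: linkage_def)
  have \<phi>W: "\<phi> w \<in> X" "E w (\<phi> w)" if "w \<in> W" for w
    using \<phi> that by (auto simp: pure_def)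
  have reachX: "\<exists>k. (par ^^ k) x = d" if "x \<in> X" for x
  proof (rule reach_cong)
    show "\<exists>k. (lk ^^ k) x = d" "x \<in> insert d X"
      using lk(1) that by (auto simp: linkage_def)
    show "par u = lk u \<and> lk u \<in> insert d X" if "u \<in> insert d X" for u
      using that parX lkX lk(1) by (auto simp: par_def linkage_def)
  qed
  have reachW: "\<exists>k. (par ^^ k) w = d" if "w \<in> W" "w \<notin> P" "w \<notin> Q" for w
    using reach_step[of par w d] parW[OF that] reachX \<phi>W(1)[OF that(1)] by simp
  have reachP: "\<exists>k. (par ^^ k) w = d" if "w \<in> P" for w
    using reach_step[of par w d] parP[OF that] reachW[of p] p[OF that] by simp
  have reachQ: "\<exists>k. (par ^^ k) w = d" if "w \<in> Q" for w
    using reach_step[of par w d] parQ[OF that] reachW[of q] reachP[of q] q[OF that] by auto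
  have par_ne: "par w \<in> X \<union> W" if "w \<in> W" for w
  proof -
    consider "w \<in> P" | "w \<in> Q" | "w \<notin> P" "w \<notin> Q"
      by blast
    then show ?thesis
    proof cases
      case 1
      then show ?thesis
        using parP p by (metis DiffD1 UnI2)
    next
      case 2
      then show ?thesis
        using parQ q by (metis DiffD1 UnI2)
    next
      case 3
      then show ?thesis
        using parW[OF that] \<phi>W(1)[OF that] by simp
    qed
  qed
  have V': "v \<in> V - {d} \<longleftrightarrow> v \<in> X \<or> v \<in> W" for v
    using V_iff d_X d_W by auto
  show ?thesis
  proof (rule has_histI[of d _ par])
    show "par v \<in> V \<and> E v (par v)" if "v \<in> V" "v \<noteq> d" for v
    proof (cases "v \<in> X")
      case True
      then have "E v d"
        using X_adj sym by metis
      then show ?thesis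
        using lkX[OF True] parX[OF True] d_in wf'[of v "lk v"] by metis
    next
      case False
      then have "v \<in> W"
        using that V_iff by blast
      then consider "v \<in> P" | "v \<in> Q" | "v \<in> W" "v \<notin> P" "v \<notin> Q"
        by blast
      then have "E v (par v)"
      proof cases
        case 1
        then show ?thesis
          using parP p by metis
      next
        case 2
        then show ?thesis
          using parQ q by metis
      next
        case 3
        then show ?thesis
          using parW \<phi>W(2) by metis
      qed
      then show ?thesis
        using wf' by blast
    qed
    show "\<exists>k. (par ^^ k) v = d" if "v \<in> V" for v
      using that V_iff[of v] reachX[of v] reachP[of v] reachQ[of v] reachW[of v] reach_refl[of par d] by metis
    have "{v \<in> V - {d}. par v = d} = {x \<in> X. lk x = d}"
    proof (intro set_eqI iffI)
      fix v assume v: "v \<in> {v \<in> V - {d}. par v = d}"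
      then have "v \<notin> W"
        using par_ne[of v] d_X d_W by auto
      then have "v \<in> X"
        using v V' by blast
      then show "v \<in> {x \<in> X. lk x = d}"
        using v parX[of v] by simp
    next
      fix v assume "v \<in> {x \<in> X. lk x = d}"
      then show "v \<in> {v \<in> V - {d}. par v = d}"
        using V' parX by auto
    qed
    then show "card {v \<in> V - {d}. par v = d} \<noteq> 2"
      using lk(3) by simp
    show "card {v \<in> V - {d}. par v = u} \<noteq> 1" if "u \<in> V" "u \<noteq> d" for u
    proof (cases "u \<in> X")
      case True
      have "{v \<in> V - {d}. par v = u} = {y \<in> X. lk y = u} \<union> (fib \<phi> u - P - Q)"
      proof (intro set_eqI iffI)
        fix v assume v: "v \<in> {v \<in> V - {d}. par v = u}"
        then consider "v \<in> X" | "v \<in> W"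
          using V' by blast
        then show "v \<in> {y \<in> X. lk y = u} \<union> (fib \<phi> u - P - Q)"
        proof cases
          case 2
          have "v \<notin> P" "v \<notin> Q"
            using v True parP[of v] parQ[of v] p[of v] q[of v] X_W by auto
          then show ?thesis
            using v parW 2 by (simp add: fib_def)
        qed (use v parX in simp)
      next
        fix v assume "v \<in> {y \<in> X. lk y = u} \<union> (fib \<phi> u - P - Q)"
        then show "v \<in> {v \<in> V - {d}. par v = u}"
          using V'[of v] parX[of v] parW[of v] by (auto simp: fib_def)
      qed
      moreover have "card ({y \<in> X. lk y = u} \<union> (fib \<phi> u - P - Q)) \<noteq> 1"
      proof (cases "u \<in> S")
        case False
        then have no_child: "{y \<in> X. lk y = u} = {}"
          using lk(1) True by (simp add: linkage_def)
        show ?thesis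
          unfolding no_child using fibs(1)[of u] True False by simp
      next
        case uS: True
        then have "{y \<in> X. lk y = u} \<noteq> {}"
          using lk(1) by (simp add: linkage_def)
        moreover have "{y \<in> X. lk y = u} \<inter> (fib \<phi> u - P - Q) = {}"
          using X_W by (auto simp: fib_def)
        moreover have "finite {y \<in> X. lk y = u}" "finite (fib \<phi> u - P - Q)"
          using finite_X finite_fib by auto
        ultimately have "card {y \<in> X. lk y = u} \<ge> 1" "card (fib \<phi> u - P - Q) \<ge> 1"
          "card ({y \<in> X. lk y = u} \<union> (fib \<phi> u - P - Q)) = card {y \<in> X. lk y = u} + card (fib \<phi> u - P - Q)"
          using fibs(2)[OF uS] by (simp_all add: Suc_le_eq card_gt_0_iff card_Un_disjoint)
        then show ?thesis
          by linarith
      qed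
      ultimately show ?thesis
        by simp
    next
      case False
      then have u: "u \<in> W"
        using that V_iff by auto
      have "{v \<in> V - {d}. par v = u} = (if u = p then P else {}) \<union> (if u = q then Q else {})"
      proof (intro set_eqI iffI)
        fix v assume v: "v \<in> {v \<in> V - {d}. par v = u}"
        then consider "v \<in> X" | "v \<in> W" "v \<notin> P" "v \<notin> Q" | "v \<in> P" | "v \<in> Q"
          using V' by blast
        then show "v \<in> (if u = p then P else {}) \<union> (if u = q then Q else {})"
        proof cases
          case 1
          then show ?thesis
            using v parX[of v] lkX[of v] False that by auto
        next
          case 2
          then show ?thesis
            using v parW[of v] \<phi>W[of v] False by auto
        next
          case 3
          then show ?thesis
            using v parP[of v] by auto
        next
          case 4
          then show ?thesis
            using v parQ[of v] by auto
        qed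
      next
        fix v assume "v \<in> (if u = p then P else {}) \<union> (if u = q then Q else {})"
        then show "v \<in> {v \<in> V - {d}. par v = u}"
          using V'[of v] Z(1,2) parP[of v] parQ[of v] by (auto split: if_splits)
      qed
      moreover have "card ((if u = p then P else {}) \<union> (if u = q then Q else {})) \<noteq> 1"
        using Z finite_subset[OF _ finite_W] by (intro card_1_disjoint_union) auto
      ultimately show ?thesis
        by simp
    qed
  qed (use d_in in \<open>auto simp: par_def\<close>)
qed

text \<open>The case of a single group \<open>Z\<close>, with the links supplied by
  \<open>linkage_exists\<close>. The root keeps \<open>card X - card S\<close> children, whence the
  condition that \<open>card X\<close> is not \<open>card S + 2\<close>.\<close>

lemma has_hist_hub:
  assumes "pure \<phi>" "S \<subseteq> X" "\<And>x. x \<in> S \<Longrightarrow> card S \<le> card (nbrs x \<inter> X)" "card X \<noteq> card S + 2"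
    and "Z \<subseteq> W" "card Z \<noteq> 1" "\<And>z. z \<in> Z \<Longrightarrow> E z t" "Z = {} \<or> t \<in> W"
    and "\<And>x. x \<in> X - S \<Longrightarrow> card (fib \<phi> x - Z) \<noteq> 1" "\<And>x. x \<in> S \<Longrightarrow> fib \<phi> x - Z \<noteq> {}"
  shows "has_hist V E"
proof -
  obtain lk where lk: "linkage S lk" "card {x \<in> X. lk x = d} + card S = card X"
    using linkage_exists[of S] assms(2,3) finite_subset[OF assms(2) finite_X] by blast
  show ?thesis
  proof (rule has_hist_hubs[of \<phi> S lk Z "{}" t t])
    show "card {x \<in> X. lk x = d} \<noteq> 2"
      using lk(2) assms(4) by simp
    show "E z t \<and> t \<in> W - Z - {}" if "z \<in> Z" for z
      using that assms(7,8) irrefl by auto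
  qed (use lk assms in auto)
qed

section \<open>Optimal assignments\<close>

definition optimal :: "('a \<Rightarrow> 'a) \<Rightarrow> bool" where
  "optimal \<phi> \<longleftrightarrow> pure \<phi> \<and> (\<forall>\<psi>. pure \<psi> \<longrightarrow> card (bads \<phi>) \<le> card (bads \<psi>))"

lemma finite_bads: "finite (bads \<phi>)"
  using finite_X by (simp add: bads_def)

lemma bads_X: "bads \<phi> \<subseteq> X"
  by (auto simp: bads_def)

lemma optimal_exists: "\<exists>\<phi>. optimal \<phi>"
proof -
  have "\<exists>x. x \<in> X \<and> E w x" if "w \<in> W" for w
  proof -
    have "w \<in> V" "w \<noteq> d"
      using that V_iff d_W by auto
    then show ?thesis
      using diam[of w d] that W_not_adj d_in X_adj sym by blast
  qed
  then have "pure (\<lambda>w. SOME x. x \<in> X \<and> E w x)"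
    unfolding pure_def by (metis (mono_tags, lifting) someI_ex)
  then obtain \<phi> where "pure \<phi>" "\<forall>\<psi>. pure \<psi> \<longrightarrow> card (bads \<phi>) \<le> card (bads \<psi>)"
    using ex_has_least_nat[of pure _ "\<lambda>\<phi>. card (bads \<phi>)"] by blast
  then show ?thesis
    unfolding optimal_def by blast
qed

lemma optimal_pure: "optimal \<phi> \<Longrightarrow> pure \<phi>"
  by (simp add: optimal_def)

lemma fib_upd: "w \<in> W \<Longrightarrow> fib (\<phi>(w := x)) y = (if y = x then insert w (fib \<phi> y) else fib \<phi> y - {w})"
  by (auto simp: fib_def)

lemma pure_upd: "pure \<phi> \<Longrightarrow> x \<in> X \<Longrightarrow> E w x \<Longrightarrow> pure (\<phi>(w := x))"
  by (auto simp: pure_def)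

lemma fib_W: "w \<in> fib \<phi> x \<longleftrightarrow> w \<in> W \<and> \<phi> w = x"
  by (auto simp: fib_def)

text \<open>The form in which optimality is used in all exchange arguments: a reassignment cannot
  repair \<open>x\<close> without creating a new bad vertex.\<close>

lemma no_improvement:
  assumes "optimal \<phi>" "pure \<psi>" "x \<in> bads \<phi>"
    and "\<And>y. y \<in> X \<Longrightarrow> card (fib \<psi> y) = 1 \<Longrightarrow> y \<noteq> x \<and> card (fib \<phi> y) = 1"
  shows False
proof -
  have "bads \<psi> \<subseteq> bads \<phi> - {x}"
    using assms(4) by (auto simp: bads_def)
  then have "card (bads \<psi>) \<le> card (bads \<phi> - {x})"
    using finite_bads by (intro card_mono) auto
  also have "\<dots> < card (bads \<phi>)"
    using assms(3) finite_bads by (intro psubset_card_mono) auto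
  finally show False
    using assms(1,2) by (auto simp: optimal_def)
qed

lemma badsE:
  assumes "x \<in> bads \<phi>"
  obtains w where "x \<in> X" "fib \<phi> x = {w}" "w \<in> W" "\<phi> w = x"
proof -
  obtain w where w: "x \<in> X" "fib \<phi> x = {w}"
    using assms by (auto simp: bads_def card_1_singleton_iff)
  moreover have "w \<in> W" "\<phi> w = x"
    using w(2) fib_W[of w \<phi> x] by auto
  ultimately show ?thesis
    by (rule that)
qed

lemma card_ge2: "finite A \<Longrightarrow> a \<in> A \<Longrightarrow> b \<in> A \<Longrightarrow> a \<noteq> b \<Longrightarrow> card A \<noteq> 1"
  by (auto simp: card_1_singleton_iff)

text \<open>Moving \<open>w\<close> below \<open>x\<close> gives \<open>x\<close> a second child.
  This repairs \<open>x\<close> unless the old parent of \<open>w\<close> is newly left with a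
  single child, so that parent must have had two.\<close>

lemma bad_nbr_fiber:
  assumes opt: "optimal \<phi>" and x: "x \<in> bads \<phi>" and w: "w \<in> W" "E x w" "\<phi> w \<noteq> x"
  shows "card (fib \<phi> (\<phi> w)) = 2"
proof (rule ccontr)
  assume *: "card (fib \<phi> (\<phi> w)) \<noteq> 2"
  obtain u where u: "x \<in> X" "fib \<phi> x = {u}" "u \<in> W" "\<phi> u = x"
    using x by (rule badsE)
  show False
  proof (rule no_improvement[OF opt _ x])
    show "pure (\<phi>(w := x))"
      using optimal_pure[OF opt] u w sym[OF w(2)] by (intro pure_upd) auto
    fix y assume y: "y \<in> X" "card (fib (\<phi>(w := x)) y) = 1"
    show "y \<noteq> x \<and> card (fib \<phi> y) = 1"
    proof (cases "y = x")
      case True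
      have "w \<noteq> u"
        using u w by auto
      then show ?thesis
        using y u(2) w(1) True by (simp add: fib_upd)
    next
      case False
      show ?thesis
      proof (cases "y = \<phi> w")
        case True
        have "w \<in> fib \<phi> y"
          using True w by (simp add: fib_W)
        then have "card (fib \<phi> y) = Suc (card (fib \<phi> y - {w}))"
          using finite_fib by (metis card.remove)
        then show ?thesis
          using y False True * w by (simp add: fib_upd)
      next
        case y': False
        then have "fib \<phi> y - {w} = fib \<phi> y"
          by (auto simp: fib_W)
        then show ?thesis
          using y False w by (simp add: fib_upd)
      qed
    qed
  qed
qed

text \<open>Otherwise \<open>w\<close> could move below \<open>y\<close>: then \<open>x\<close>
  would be childless, which is harmless, and \<open>y\<close> would have at least two
  children.\<close>

lemma bad_child_nbr:
  assumes opt: "optimal \<phi>" and x: "x \<in> bads \<phi>" "fib \<phi> x = {w}" and y: "y \<in> X" "y \<noteq> x" "E w y"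
  shows "fib \<phi> y = {}"
proof (rule ccontr)
  assume *: "fib \<phi> y \<noteq> {}"
  have w: "w \<in> W" "\<phi> w = x"
    using x(2) fib_W[of w \<phi> x] by auto
  obtain u where u: "u \<in> fib \<phi> y"
    using * by blast
  then have "u \<noteq> w"
    using w y by (auto simp: fib_W)
  show False
  proof (rule no_improvement[OF opt _ x(1)])
    show "pure (\<phi>(w := y))"
      using optimal_pure[OF opt] y by (intro pure_upd) auto
    fix v assume v: "v \<in> X" "card (fib (\<phi>(w := y)) v) = 1"
    have "v \<noteq> y"
    proof
      assume "v = y"
      then show False
        using v(2) w u \<open>u \<noteq> w\<close> finite_fib card_ge2[of "insert w (fib \<phi> y)" u w] by (simp add: fib_upd)
    qed
    moreover have "v \<noteq> x"
      using v y w x(2) by (auto simp: fib_upd)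
    ultimately show "v \<noteq> x \<and> card (fib \<phi> v) = 1"
      using v w by (simp add: fib_upd fib_W)
  qed
qed

text \<open>\<open>half \<phi> x h c z\<close>: the bad vertex \<open>x\<close> could take \<open>c\<close> over from \<open>h\<close>, leaving \<open>h\<close> bad with \<open>z\<close>.\<close>

definition half :: "('a \<Rightarrow> 'a) \<Rightarrow> 'a \<Rightarrow> 'a \<Rightarrow> 'a \<Rightarrow> 'a \<Rightarrow> bool" where
  "half \<phi> x h c z \<longleftrightarrow> h \<in> X \<and> h \<noteq> x \<and> fib \<phi> h = {c, z} \<and> c \<noteq> z \<and> E x c"

definition halves :: "('a \<Rightarrow> 'a) \<Rightarrow> 'a \<Rightarrow> 'a set" where
  "halves \<phi> x = {h. \<exists>c z. half \<phi> x h c z}"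

lemma halfD:
  assumes "half \<phi> x h c z"
  shows "h \<in> X" "h \<noteq> x" "fib \<phi> h = {c, z}" "c \<noteq> z" "E x c" "E c x" "c \<in> W" "z \<in> W" "\<phi> c = h" "\<phi> z = h"
  using assms fib_W[of c \<phi> h] fib_W[of z \<phi> h] sym[of x c] by (auto simp: half_def)

text \<open>Otherwise \<open>x\<close> could take both children of \<open>h\<close>, leaving
  \<open>h\<close> childless.\<close>

lemma half_not_both:
  assumes opt: "optimal \<phi>" and x: "x \<in> bads \<phi>" and h: "half \<phi> x h c z"
  shows "\<not> E x z"
proof
  assume "E x z"
  note h = halfD[OF h]
  obtain u where u: "x \<in> X" "fib \<phi> x = {u}" "u \<in> W" "\<phi> u = x"
    using x by (rule badsE)
  show False
  proof (rule no_improvement[OF opt _ x])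
    show "pure (\<phi>(c := x, z := x))"
      using optimal_pure[OF opt] u h \<open>E x z\<close> sym[OF \<open>E x z\<close>] by (intro pure_upd) auto
    have "fib (\<phi>(c := x, z := x)) x = {z, c, u}" "fib (\<phi>(c := x, z := x)) h = {}"
      "v \<noteq> x \<Longrightarrow> v \<noteq> h \<Longrightarrow> fib (\<phi>(c := x, z := x)) v = fib \<phi> v" for v
      using h u by (auto simp: fib_upd fib_W)
    moreover have "card {z, c, u} \<noteq> 1"
      using h by (intro card_ge2[of _ z c]) auto
    ultimately show "v \<noteq> x \<and> card (fib \<phi> v) = 1"
      if "v \<in> X" "card (fib (\<phi>(c := x, z := x)) v) = 1" for v
      using that by (cases "v = x"; cases "v = h") auto
  qed
qed

text \<open>The summand 2 stands for \<open>d\<close> and the single child of \<open>x\<close>.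
  Every other neighbour in \<open>W\<close> lies in a fibre of size two by
  \<open>bad_nbr_fiber\<close>, and distinct ones lie in distinct fibres by
  \<open>half_not_both\<close>. With a lower bound on the degree this forces neighbours in
  \<open>X\<close>, which can serve as links, or halves.\<close>

lemma bad_degree:
  assumes opt: "optimal \<phi>" and x: "x \<in> bads \<phi>"
  shows "card (nbrs x) \<le> 2 + card (nbrs x \<inter> X) + card (halves \<phi> x)"
proof -
  obtain u where u: "x \<in> X" "fib \<phi> x = {u}" "u \<in> W" "\<phi> u = x"
    using x by (rule badsE)
  define C where "C = nbrs x \<inter> W - {u}"
  have hf: "\<exists>z. half \<phi> x (\<phi> c) c z" if "c \<in> C" for c
  proof -
    have c: "c \<in> W" "E x c" "\<phi> c \<noteq> x"
      using that u fib_W[of c \<phi> x] by (auto simp: C_def)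
    then obtain a b where ab: "fib \<phi> (\<phi> c) = {a, b}" "a \<noteq> b"
      using bad_nbr_fiber[OF opt x] by (meson card_2_iff)
    moreover have "c \<in> fib \<phi> (\<phi> c)" "\<phi> c \<in> X"
      using c optimal_pure[OF opt] by (auto simp: fib_W pure_def)
    ultimately show ?thesis
      using c unfolding half_def by (intro exI[of _ "if c = a then b else a"]) auto
  qed
  have "inj_on \<phi> C"
  proof (rule inj_onI)
    fix c c' assume c: "c \<in> C" "c' \<in> C" "\<phi> c = \<phi> c'"
    obtain z where z: "half \<phi> x (\<phi> c) c z"
      using hf c by blast
    have "c' \<in> fib \<phi> (\<phi> c)"
      using c by (auto simp: fib_W C_def)
    then have "c' = c \<or> c' = z"
      using halfD(3)[OF z] by auto
    then show "c = c'"
      using half_not_both[OF opt x z] c by (auto simp: C_def)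
  qed
  moreover have "\<phi> ` C \<subseteq> halves \<phi> x"
    using hf unfolding halves_def by blast
  moreover have "finite (halves \<phi> x)"
    by (rule finite_subset[OF _ finite_X]) (auto simp: halves_def half_def)
  ultimately have C: "card C \<le> card (halves \<phi> x)"
    by (rule card_inj_on_le)
  have "nbrs x \<subseteq> {d, u} \<union> (nbrs x \<inter> X) \<union> C"
    using nbr_cases by (auto simp: C_def)
  then have "card (nbrs x) \<le> card ({d, u} \<union> (nbrs x \<inter> X) \<union> C)"
    using finite_X finite_W by (intro card_mono) (auto simp: C_def)
  also have "\<dots> \<le> card {d, u} + card (nbrs x \<inter> X) + card C"
    by (meson add_mono card_Un_le le_refl order_trans)
  also have "card {d, u} \<le> 2"
    by (simp add: card_insert_if)
  finally show ?thesis
    using C by linarith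
qed

lemma halves_subset: "halves \<phi> x \<subseteq> X - bads \<phi> - {x}"
  by (auto simp: halves_def half_def bads_def)

lemma common_in_W:
  assumes "u \<in> W" "v \<in> W" "u \<noteq> v" "\<And>y. y \<in> X \<Longrightarrow> E u y \<Longrightarrow> E v y \<Longrightarrow> False"
  shows "E u v \<or> (\<exists>t\<in>W. E u t \<and> E v t)"
proof -
  have "u \<in> V" "v \<in> V"
    using assms V_iff by auto
  then have "E u v \<or> (\<exists>t. E u t \<and> E t v)"
    using diam assms(3) by blast
  moreover have "t \<in> W" if "E u t" "E t v" for t
    using nbr_cases[OF that(1)] that assms sym W_not_adj by blast
  ultimately show ?thesis
    using sym by blast
qed

text \<open>A common neighbour of \<open>w\<close> and \<open>w'\<close> in \<open>X\<close> could
  adopt both and repair two bad vertices at once; if it is \<open>x\<close> or \<open>x'\<close>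
  itself, \<open>bad_child_nbr\<close> excludes it. The diameter condition leaves only the two
  alternatives.\<close>

lemma bad_children_close:
  assumes opt: "optimal \<phi>" and x: "x \<in> bads \<phi>" "fib \<phi> x = {w}" and x': "x' \<in> bads \<phi>" "fib \<phi> x' = {w'}" and "x \<noteq> x'"
  shows "E w w' \<or> (\<exists>t\<in>W. E w t \<and> E w' t)"
proof -
  have w: "w \<in> W" "\<phi> w = x" "w' \<in> W" "\<phi> w' = x'"
    using x(2) x'(2) fib_W[of w \<phi> x] fib_W[of w' \<phi> x'] by auto
  have "w \<noteq> w'"
    using w \<open>x \<noteq> x'\<close> by auto
  moreover have False if y: "y \<in> X" "E w y" "E w' y" for y
  proof (cases "y = x \<or> y = x'")
    case True
    then show False
      using bad_child_nbr[OF opt x' y(1) _ y(3)] bad_child_nbr[OF opt x y(1) _ y(2)] x x' \<open>x \<noteq> x'\<close> by auto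
  next
    case False
    show False
    proof (rule no_improvement[OF opt _ x(1)])
      show "pure (\<phi>(w := y, w' := y))"
        using optimal_pure[OF opt] y by (intro pure_upd)
      have "fib (\<phi>(w := y, w' := y)) y = insert w' (insert w (fib \<phi> y))" "fib (\<phi>(w := y, w' := y)) x = {}"
        "fib (\<phi>(w := y, w' := y)) x' = {}"
        "v \<noteq> x \<Longrightarrow> v \<noteq> x' \<Longrightarrow> v \<noteq> y \<Longrightarrow> fib (\<phi>(w := y, w' := y)) v = fib \<phi> v" for v
        using x(2) x'(2) w False by (auto simp: fib_upd fib_W)
      moreover have "card (insert w' (insert w (fib \<phi> y))) \<noteq> 1"
        using \<open>w \<noteq> w'\<close> finite_fib by (intro card_ge2[of _ w w']) auto
      ultimately show "v \<noteq> x \<and> card (fib \<phi> v) = 1" if "v \<in> X" "card (fib (\<phi>(w := y, w' := y)) v) = 1" for v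
        using that by (cases "v = x"; cases "v = x'"; cases "v = y") auto
    qed
  qed
  ultimately show ?thesis
    using w by (intro common_in_W) auto
qed

text \<open>Badness can be passed from \<open>x\<close> to \<open>h\<close> without changing the
  number of bad vertices, so the new assignment is optimal again and all structural lemmas apply to
  \<open>h\<close> with its child \<open>z\<close>.\<close>

lemma shift:
  assumes opt: "optimal \<phi>" and x: "x \<in> bads \<phi>" and h: "half \<phi> x h c z"
  shows "optimal (\<phi>(c := x))" "bads (\<phi>(c := x)) = insert h (bads \<phi> - {x})"
    "fib (\<phi>(c := x)) h = {z}" "fib (\<phi>(c := x)) x = insert c (fib \<phi> x)"
    "\<And>y. y \<noteq> x \<Longrightarrow> y \<noteq> h \<Longrightarrow> fib (\<phi>(c := x)) y = fib \<phi> y"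
proof -
  note hD = halfD[OF h]
  obtain u where u: "x \<in> X" "fib \<phi> x = {u}" "u \<in> W" "\<phi> u = x"
    using x by (rule badsE)
  show fibs: "fib (\<phi>(c := x)) h = {z}" "fib (\<phi>(c := x)) x = insert c (fib \<phi> x)"
    "\<And>y. y \<noteq> x \<Longrightarrow> y \<noteq> h \<Longrightarrow> fib (\<phi>(c := x)) y = fib \<phi> y"
    using hD by (auto simp: fib_upd fib_W)
  have "card (insert c (fib \<phi> x)) \<noteq> 1"
    using hD u finite_fib by (intro card_ge2[of _ c u]) auto
  then have "y \<in> bads (\<phi>(c := x)) \<longleftrightarrow> y \<in> insert h (bads \<phi> - {x})" for y
    using fibs hD(1,2) unfolding bads_def by (cases "y = x"; cases "y = h") simp_all
  then show bads: "bads (\<phi>(c := x)) = insert h (bads \<phi> - {x})"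
    by blast
  have "h \<notin> bads \<phi>"
    using hD(3,4) by (simp add: bads_def)
  then have "card (bads (\<phi>(c := x))) = Suc (card (bads \<phi> - {x}))"
    using finite_bads unfolding bads by simp
  also have "\<dots> = card (bads \<phi>)"
    using finite_bads x by (rule card_Suc_Diff1)
  finally show "optimal (\<phi>(c := x))"
    using opt u hD by (auto simp: optimal_def intro: pure_upd)
qed

text \<open>\<open>x\<close> can take over \<open>c\<close> and \<open>c'\<close> simultaneously.
  Then \<open>z\<close> and \<open>z'\<close> are lone children, and a common neighbour in
  \<open>X\<close> could adopt both, as in \<open>bad_children_close\<close>.\<close>

lemma half_children_close:
  assumes opt: "optimal \<phi>" and x: "x \<in> bads \<phi>" and h: "half \<phi> x h c z" and h': "half \<phi> x h' c' z'" and "h \<noteq> h'"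
  shows "E z z' \<or> (\<exists>t\<in>W. E z t \<and> E z' t)"
proof (rule common_in_W)
  note hD = halfD[OF h] and hD' = halfD[OF h']
  obtain u where u: "x \<in> X" "fib \<phi> x = {u}" "u \<in> W" "\<phi> u = x"
    using x by (rule badsE)
  show zW: "z \<in> W" "z' \<in> W" and "z \<noteq> z'"
    using hD hD' \<open>h \<noteq> h'\<close> by auto
  fix y assume y: "y \<in> X" "E z y" "E z' y"
  have "y \<noteq> x"
    using half_not_both[OF opt x h] y sym by blast
  let ?\<psi> = "\<phi>(c := x, c' := x, z := y, z' := y)"
  have cc: "c \<noteq> c'" "c \<noteq> z'" "z \<noteq> c'" "u \<noteq> c" "u \<noteq> c'" "u \<noteq> z" "u \<noteq> z'"
    using hD hD' u \<open>h \<noteq> h'\<close> by auto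
  show False
  proof (rule no_improvement[OF opt _ x])
    show "pure ?\<psi>"
      using optimal_pure[OF opt] y u hD hD' by (intro pure_upd) auto
    have "c \<in> fib ?\<psi> x" "c' \<in> fib ?\<psi> x" "z \<in> fib ?\<psi> y" "z' \<in> fib ?\<psi> y"
      using hD hD' cc zW \<open>z \<noteq> z'\<close> by (auto simp: fib_W)
    then have "card (fib ?\<psi> x) \<noteq> 1" "card (fib ?\<psi> y) \<noteq> 1"
      using card_ge2[OF finite_fib, of c ?\<psi> x c'] card_ge2[OF finite_fib, of z ?\<psi> y z'] cc \<open>z \<noteq> z'\<close> by auto
    moreover have "v \<noteq> y \<Longrightarrow> fib ?\<psi> h \<subseteq> (if y = h then {z, z'} else {})" for v
      using hD hD' \<open>y \<noteq> x\<close> by (auto simp: fib_upd split: if_splits)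
    moreover have "y \<noteq> h \<Longrightarrow> fib ?\<psi> h = {}" "y \<noteq> h' \<Longrightarrow> fib ?\<psi> h' = {}"
      using hD hD' by (auto simp: fib_upd)
    moreover have "v \<noteq> x \<Longrightarrow> v \<noteq> y \<Longrightarrow> v \<noteq> h \<Longrightarrow> v \<noteq> h' \<Longrightarrow> fib ?\<psi> v = fib \<phi> v" for v
      using hD hD' by (auto simp: fib_upd fib_W)
    ultimately show "v \<noteq> x \<and> card (fib \<phi> v) = 1" if "v \<in> X" "card (fib ?\<psi> v) = 1" for v
      using that by (cases "v = x"; cases "v = y"; cases "v = h"; cases "v = h'") auto
  qed
qed


section \<open>Minimum degree at least four\<close>

text \<open>No vertex of \<open>W\<close> moves: every bad vertex obtains its second child by a
  link.\<close>

lemma has_hist_links: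
  assumes "optimal \<phi>" "\<And>x. x \<in> bads \<phi> \<Longrightarrow> card (bads \<phi>) \<le> card (nbrs x \<inter> X)" "card X \<noteq> card (bads \<phi>) + 2"
  shows "has_hist V E"
  by (rule has_hist_hub[of \<phi> "bads \<phi>" "{}" d])
    (use assms optimal_pure bads_X in \<open>auto simp: bads_def card_1_singleton_iff\<close>)

lemma fib_singletonD: "fib \<phi> x = {w} \<Longrightarrow> w \<in> W \<and> \<phi> w = x"
  using fib_W[of w \<phi> x] by auto

lemma fib_Diff_other: "(\<And>z. z \<in> Z \<Longrightarrow> \<phi> z \<noteq> y) \<Longrightarrow> fib \<phi> y - Z = fib \<phi> y"
  by (auto simp: fib_W)

text \<open>The children \<open>w\<close> and \<open>w'\<close> move together below
  \<open>t\<close>, which leaves \<open>x\<close> and \<open>x'\<close> childless and gives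
  \<open>t\<close> two children. The remaining bad vertices are linked.\<close>

lemma resolve_pair:
  assumes opt: "optimal \<phi>" and x: "x \<in> bads \<phi>" "fib \<phi> x = {w}" and x': "x' \<in> bads \<phi>" "fib \<phi> x' = {w'}"
    and "x \<noteq> x'" and t: "t \<in> W" "E w t" "E w' t"
    and S: "S = bads \<phi> - {x, x'}" "\<And>y. y \<in> S \<Longrightarrow> card S \<le> card (nbrs y \<inter> X)" "card X \<noteq> card S + 2"
  shows "has_hist V E"
proof -
  have w: "w \<in> W" "\<phi> w = x" "w' \<in> W" "\<phi> w' = x'" "w \<noteq> w'"
    using fib_singletonD[OF x(2)] fib_singletonD[OF x'(2)] \<open>x \<noteq> x'\<close> by auto
  show ?thesis
  proof (rule has_hist_hub[of \<phi> S "{w, w'}" t])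
    show "card (fib \<phi> y - {w, w'}) \<noteq> 1" if "y \<in> X - S" for y
    proof (cases "y = x \<or> y = x'")
      case True
      then have "fib \<phi> y - {w, w'} = {}"
        using x(2) x'(2) by auto
      then show ?thesis
        by (metis card.empty zero_neq_one)
    next
      case False
      then have "fib \<phi> y - {w, w'} = fib \<phi> y"
        using w by (intro fib_Diff_other) auto
      then show ?thesis
        using that False S(1) by (simp add: bads_def)
    qed
    show "fib \<phi> y - {w, w'} \<noteq> {}" if "y \<in> S" for y
    proof -
      have "fib \<phi> y - {w, w'} = fib \<phi> y"
        using that w S(1) by (intro fib_Diff_other) auto
      then show ?thesis
        using that S(1) by (auto simp: bads_def card_1_singleton_iff)
    qed
  qed (use opt optimal_pure bads_X S w t in auto)
qed

text \<open>\<open>x\<close> takes \<open>c\<close> and \<open>c'\<close>, while \<open>z\<close>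
  and \<open>z'\<close> go below \<open>t\<close>; then \<open>x\<close> has three children and
  \<open>h\<close> and \<open>h'\<close> have none. The remaining bad vertices are linked.\<close>

lemma resolve_halves:
  assumes opt: "optimal \<phi>" and x: "x \<in> bads \<phi>" and h: "half \<phi> x h c z" and h': "half \<phi> x h' c' z'" and "h \<noteq> h'"
    and t: "t \<in> W" "E z t" "E z' t"
    and S: "S = bads \<phi> - {x}" "\<And>y. y \<in> S \<Longrightarrow> card S \<le> card (nbrs y \<inter> X)" "card X \<noteq> card S + 2"
  shows "has_hist V E"
proof -
  note hD = halfD[OF h] and hD' = halfD[OF h']
  obtain u where u: "x \<in> X" "fib \<phi> x = {u}" "u \<in> W" "\<phi> u = x"
    using x by (rule badsE)
  have ne: "c \<noteq> c'" "c \<noteq> z'" "z \<noteq> c'" "z \<noteq> z'"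
    using hD hD' \<open>h \<noteq> h'\<close> by auto
  let ?\<psi> = "\<phi>(c := x, c' := x)"
  have "h \<notin> bads \<phi>" "h' \<notin> bads \<phi>"
    using hD(3,4) hD'(3,4) by (auto simp: bads_def)
  have other: "fib ?\<psi> y - {z, z'} = fib \<phi> y" if "y \<noteq> x" "y \<noteq> h" "y \<noteq> h'" for y
    using that hD hD' by (auto simp: fib_upd fib_W)
  show ?thesis
  proof (rule has_hist_hub[of ?\<psi> S "{z, z'}" t])
    show "card (fib ?\<psi> y - {z, z'}) \<noteq> 1" if y: "y \<in> X - S" for y
    proof -
      consider "y = x" | "y = h \<or> y = h'" | "y \<noteq> x" "y \<noteq> h" "y \<noteq> h'"
        by blast
      then show ?thesis
      proof cases
        case 1
        have "c \<in> fib ?\<psi> x - {z, z'}" "c' \<in> fib ?\<psi> x - {z, z'}"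
          using hD hD' ne by (auto simp: fib_W)
        then show ?thesis
          using 1 ne finite_fib by (intro card_ge2[of _ c c']) auto
      next
        case 2
        then have "fib ?\<psi> y - {z, z'} = {}"
          using hD hD' by (auto simp: fib_upd)
        then show ?thesis
          by (metis card.empty zero_neq_one)
      next
        case 3
        then show ?thesis
          unfolding other[OF 3] using y S(1) by (simp add: bads_def)
      qed
    qed
    show "fib ?\<psi> y - {z, z'} \<noteq> {}" if "y \<in> S" for y
    proof -
      have "y \<noteq> x" "y \<noteq> h" "y \<noteq> h'"
        using that S(1) \<open>h \<notin> bads \<phi>\<close> \<open>h' \<notin> bads \<phi>\<close> by auto
      then show ?thesis
        unfolding other[OF \<open>y \<noteq> x\<close> \<open>y \<noteq> h\<close> \<open>y \<noteq> h'\<close>] using that S(1) by (auto simp: bads_def card_1_singleton_iff)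
    qed
    show "pure ?\<psi>"
      using optimal_pure[OF opt] u hD hD' by (intro pure_upd) auto
    show "E v t" if "v \<in> {z, z'}" for v
      using that t by auto
  qed (use bads_X S hD hD' ne t in auto)
qed

lemma halves_card: "x \<in> bads \<phi> \<Longrightarrow> card (halves \<phi> x) + card (bads \<phi>) \<le> card X"
proof -
  have "card (halves \<phi> x) \<le> card (X - bads \<phi>)"
    using halves_subset[of \<phi> x] finite_X by (intro card_mono) auto
  also have "\<dots> = card X - card (bads \<phi>)"
    using bads_X finite_bads by (simp add: card_Diff_subset)
  finally show ?thesis
    using card_mono[OF finite_X bads_X, of \<phi>] by linarith
qed

lemma halvesE:
  assumes "h \<in> halves \<phi> x"
  obtains c z where "half \<phi> x h c z"
  using assms by (auto simp: halves_def)

text \<open>If no two of \<open>z1\<close>, \<open>z2\<close>, \<open>z3\<close> have a common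
  neighbour in \<open>W\<close>, then \<open>half_children_close\<close> makes them pairwise
  adjacent, and \<open>z1\<close> is a common neighbour of the other two after all.\<close>

lemma has_hist_three_halves:
  assumes opt: "optimal \<phi>" and x: "bads \<phi> = {x}" and "card (halves \<phi> x) \<ge> 3" "card X \<noteq> 2"
  shows "has_hist V E"
proof (rule ccontr)
  assume no: "\<not> has_hist V E"
  have xb: "x \<in> bads \<phi>"
    using x by simp
  obtain H where "H \<subseteq> halves \<phi> x" "card H = 3"
    using assms(3) obtain_subset_with_card_n by metis
  then obtain h1 h2 h3 where sub: "{h1, h2, h3} \<subseteq> halves \<phi> x" and ne: "h1 \<noteq> h2" "h1 \<noteq> h3" "h2 \<noteq> h3"
    by (auto simp: card_3_iff)
  have "h1 \<in> halves \<phi> x" "h2 \<in> halves \<phi> x" "h3 \<in> halves \<phi> x"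
    using sub by auto
  then obtain c1 z1 c2 z2 c3 z3 where h: "half \<phi> x h1 c1 z1" "half \<phi> x h2 c2 z2" "half \<phi> x h3 c3 z3"
    by (metis halvesE)
  have no_common: False if "half \<phi> x h c z" "half \<phi> x h' c' z'" "h \<noteq> h'" "t \<in> W" "E z t" "E z' t" for h c z h' c' z' t
    using resolve_halves[OF opt xb that(1-6), of "{}"] x no assms(4) by simp
  have "E z1 z2"
    using half_children_close[OF opt xb h(1,2) ne(1)] no_common[OF h(1,2) ne(1)] by blast
  moreover have "E z1 z3"
    using half_children_close[OF opt xb h(1,3) ne(2)] no_common[OF h(1,3) ne(2)] by blast
  ultimately show False
    using no_common[OF h(2,3) ne(3), of z1] halfD(8)[OF h(1)] sym by blast
qed

lemma card_W_le: "card W \<le> (\<Sum>x\<in>X. card (fib \<phi> x))" if "pure \<phi>"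
proof -
  have "W = (\<Union>x\<in>X. fib \<phi> x)"
    using that by (auto simp: fib_def pure_def)
  then show ?thesis
    using card_UN_le[OF finite_X, of "fib \<phi>"] by simp
qed

lemma W_members: "w \<in> W \<Longrightarrow> pure \<phi> \<Longrightarrow> w \<in> fib \<phi> (\<phi> w) \<and> \<phi> w \<in> X"
  by (auto simp: fib_def pure_def)

text \<open>If two of three children of bad vertices have a common neighbour in \<open>W\<close>,
  \<open>resolve_pair\<close> applies; otherwise they are pairwise adjacent and the first is a
  common neighbour of the others. This leaves two children at the root only if every vertex of
  \<open>X\<close> is bad. In that case \<open>W\<close> is so small that the degree of
  \<open>w1\<close> makes it adjacent to all other vertices of \<open>W\<close>, and
  \<open>w1\<close> adopts them.\<close>

lemma has_hist_three_bads:
  assumes opt: "optimal \<phi>" and "card (bads \<phi>) \<ge> 3" and deg: "\<And>v. v \<in> V \<Longrightarrow> card X \<le> card (nbrs v)" and "card X \<ge> 4"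
  shows "has_hist V E"
proof -
  have deg': "card X \<le> 2 + card (nbrs x \<inter> X) + card (halves \<phi> x)" if "x \<in> bads \<phi>" for x
  proof -
    have "x \<in> V"
      using that bads_X V_iff by blast
    then show ?thesis
      using deg bad_degree[OF opt that] order_trans by blast
  qed
  show ?thesis
  proof (cases "bads \<phi> = X")
    case True
    obtain x1 where x1: "x1 \<in> bads \<phi>"
      using assms(2) by (metis card.empty equals0I not_numeral_le_zero)
    obtain w1 where w1: "x1 \<in> X" "fib \<phi> x1 = {w1}" "w1 \<in> W" "\<phi> w1 = x1"
      using x1 by (rule badsE)
    have one: "card (fib \<phi> x) = 1" if "x \<in> X" for x
      using that True by (auto simp: bads_def)
    then have "card W \<le> card X"
      using card_W_le[OF optimal_pure[OF opt]] by simp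
    have "nbrs w1 \<subseteq> insert x1 (W - {w1})"
    proof
      fix v assume "v \<in> nbrs w1"
      then have v: "E w1 v"
        by simp
      have "v \<noteq> d" "v \<noteq> w1"
        using v W_not_adj w1 irrefl by auto
      moreover have "v = x1" if vX: "v \<in> X"
      proof (rule ccontr)
        assume "v \<noteq> x1"
        then have "fib \<phi> v = {}"
          using bad_child_nbr[OF opt x1 w1(2) vX _ v] by blast
        then show False
          using one[OF vX] by simp
      qed
      ultimately show "v \<in> insert x1 (W - {w1})"
        using nbr_cases[OF v] by blast
    qed
    moreover have fin: "finite (insert x1 (W - {w1}))"
      using finite_W by simp
    moreover have "x1 \<notin> W - {w1}"
      using w1 X_W by blast
    then have "card (insert x1 (W - {w1})) = card W"
      using finite_W w1(3) by (simp add: card_Suc_Diff1 del: card_Diff_insert)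
    then have "card (insert x1 (W - {w1})) \<le> card (nbrs w1)"
      using \<open>card W \<le> card X\<close> deg[of w1] w1(3) V_iff by auto
    ultimately have nb: "nbrs w1 = insert x1 (W - {w1})"
      using card_seteq by blast
    have "card W \<ge> card X"
      using deg[of w1] w1(3) V_iff nb \<open>card (insert x1 (W - {w1})) = card W\<close> by auto
    show ?thesis
    proof (rule has_hist_hub[of \<phi> "{x1}" "W - {w1}" w1])
      show "E z w1" if "z \<in> W - {w1}" for z
        using that nb sym by blast
      show "card (W - {w1}) \<noteq> 1"
        using \<open>card W \<ge> card X\<close> assms(4) w1(3) by simp
      \<comment> \<open>No fibre has two members here, so the degree of \<open>x1\<close> must come
        from neighbours in \<open>X\<close>; one of them becomes its second child.\<close>
      have "halves \<phi> x1 = {}"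
        using halves_subset[of \<phi> x1] True by auto
      then show "card {x1} \<le> card (nbrs x \<inter> X)" if "x \<in> {x1}" for x
        using that deg'[OF x1] assms(4) by simp
      show "card (fib \<phi> y - (W - {w1})) \<noteq> 1" if "y \<in> X - {x1}" for y
      proof -
        have "fib \<phi> y - (W - {w1}) = {}"
          using that w1 by (auto simp: fib_W)
        then show ?thesis
          by (metis card.empty zero_neq_one)
      qed
    qed (use opt optimal_pure w1 assms(4) in auto)
  next
    case False
    obtain B where "B \<subseteq> bads \<phi>" "card B = 3"
      using assms(2) obtain_subset_with_card_n by metis
    then obtain x1 x2 x3 where x: "x1 \<in> bads \<phi>" "x2 \<in> bads \<phi>" "x3 \<in> bads \<phi>" and ne: "x1 \<noteq> x2" "x1 \<noteq> x3" "x2 \<noteq> x3"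
      by (auto simp: card_3_iff)
    obtain w1 where w1: "fib \<phi> x1 = {w1}" "w1 \<in> W"
      using x(1) by (rule badsE)
    obtain w2 where w2: "fib \<phi> x2 = {w2}"
      using x(2) by (rule badsE)
    obtain w3 where w3: "fib \<phi> x3 = {w3}"
      using x(3) by (rule badsE)
    have resolve: "has_hist V E"
      if ab: "a \<in> bads \<phi>" "b \<in> bads \<phi>" "a \<noteq> b" "fib \<phi> a = {u}" "fib \<phi> b = {v}" "t \<in> W" "E u t" "E v t" for a b u v t
    proof (rule resolve_pair[OF opt ab(1,4,2,5,3,6-8) refl])
      have S: "card (bads \<phi> - {a, b}) = card (bads \<phi>) - 2"
        using ab(1-3) finite_bads by (simp add: card_Diff_subset)
      show "card (bads \<phi> - {a, b}) \<le> card (nbrs y \<inter> X)" if "y \<in> bads \<phi> - {a, b}" for y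
        using S deg'[of y] halves_card[of y \<phi>] that by simp
      \<comment> \<open>The links leave \<open>card X - (card (bads \<phi>) - 2)\<close> children at
        the root, which is 2 exactly if all of \<open>X\<close> is bad.\<close>
      have "card (bads \<phi>) < card X"
        using False bads_X finite_X by (intro psubset_card_mono) auto
      then show "card X \<noteq> card (bads \<phi> - {a, b}) + 2"
        using S assms(2) by simp
    qed
    show ?thesis
    proof (cases "E w1 w2 \<and> E w1 w3")
      case True
      then show ?thesis
        using resolve[OF x(2,3) ne(3) w2 w3 w1(2)] sym by blast
    next
      case False
      then show ?thesis
        using bad_children_close[OF opt x(1) w1(1) x(2) w2 ne(1)] resolve[OF x(1,2) ne(1) w1(1) w2]
          bad_children_close[OF opt x(1) w1(1) x(3) w3 ne(2)] resolve[OF x(1,3) ne(2) w1(1) w3] by blast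
    qed
  qed
qed

text \<open>Shifting along a half of \<open>x1\<close> makes \<open>h\<close> bad with child
  \<open>z\<close>, next to \<open>x2\<close> with child \<open>w2\<close>. As this pair cannot be
  resolved, \<open>z\<close> is adjacent to \<open>w2\<close>, and so is \<open>z'\<close>. Hence
  \<open>z\<close> and \<open>z'\<close> can go below \<open>w2\<close>, provided that
  \<open>x2\<close> finds a link. If not, the degree of \<open>x2\<close> makes all of
  \<open>X\<close> except \<open>x1\<close> and \<open>x2\<close> halves of \<open>x2\<close>, and
  \<open>x2\<close> takes a child from \<open>h'\<close> instead.\<close>

lemma has_hist_two_bads_two_halves:
  assumes opt: "optimal \<phi>" and bads: "bads \<phi> = {x1, x2}" "x1 \<noteq> x2" and two: "card (halves \<phi> x1) \<ge> 2"
    and deg: "\<And>v. v \<in> V \<Longrightarrow> card X \<le> card (nbrs v)" and X4: "card X \<ge> 4"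
  shows "has_hist V E"
proof (rule ccontr)
  assume no: "\<not> has_hist V E"
  have x: "x1 \<in> bads \<phi>" "x2 \<in> bads \<phi>"
    using bads by auto
  obtain w1 where w1: "x1 \<in> X" "fib \<phi> x1 = {w1}" "w1 \<in> W" "\<phi> w1 = x1"
    using x(1) by (rule badsE)
  obtain w2 where w2: "x2 \<in> X" "fib \<phi> x2 = {w2}" "w2 \<in> W" "\<phi> w2 = x2"
    using x(2) by (rule badsE)
  obtain H where "H \<subseteq> halves \<phi> x1" "card H = 2"
    using two obtain_subset_with_card_n by metis
  then obtain h h' where hh: "h \<in> halves \<phi> x1" "h' \<in> halves \<phi> x1" "h \<noteq> h'"
    by (auto simp: card_2_iff)
  then obtain c z c' z' where h: "half \<phi> x1 h c z" and h': "half \<phi> x1 h' c' z'"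
    by (metis halvesE)
  note hD = halfD[OF h] and hD' = halfD[OF h']
  have adj: "E z w2" if hf: "half \<phi> x1 h c z" for h c z
  proof -
    note sh = shift[OF opt x(1) hf] and hfD = halfD[OF hf]
    have "h \<noteq> x2"
      using hfD(3,4) x(2) by (auto simp: bads_def)
    have b: "bads (\<phi>(c := x1)) = {h, x2}"
      unfolding sh(2) using bads by auto
    have f2: "fib (\<phi>(c := x1)) x2 = {w2}"
      using sh(5)[of x2] bads(2) \<open>h \<noteq> x2\<close> w2(2) by simp
    have "E z w2 \<or> (\<exists>t\<in>W. E z t \<and> E w2 t)"
      using bad_children_close[OF sh(1) _ sh(3) _ f2 \<open>h \<noteq> x2\<close>] b by simp
    moreover have False if "t \<in> W" "E z t" "E w2 t" for t
      using resolve_pair[OF sh(1) _ sh(3) _ f2 \<open>h \<noteq> x2\<close> that, of "{}"] b no X4 by simp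
    ultimately show ?thesis
      by blast
  qed
  have zw: "E z w2" "E z' w2"
    using adj h h' by auto
  have S: "bads \<phi> - {x1} = {x2}"
    using bads by auto
  have none: "nbrs x2 \<inter> X = {}"
  proof (rule ccontr)
    assume "nbrs x2 \<inter> X \<noteq> {}"
    then have "card {x2} \<le> card (nbrs x2 \<inter> X)"
      using finite_X by (simp add: Suc_le_eq card_gt_0_iff)
    then show False
      using resolve_halves[OF opt x(1) h h' hh(3) w2(3) zw S[symmetric]] no X4 by simp
  qed
  have "x2 \<in> V"
    using w2(1) V_iff by blast
  then have "card X \<le> 2 + card (halves \<phi> x2)"
    using deg[of x2] bad_degree[OF opt x(2)] none by simp
  then have "card (X - {x1, x2}) \<le> card (halves \<phi> x2)"
    using w1(1) w2(1) bads(2) finite_X by (simp add: card_Diff_subset)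
  moreover have "halves \<phi> x2 \<subseteq> X - {x1, x2}"
    using halves_subset[of \<phi> x2] bads by auto
  ultimately have "halves \<phi> x2 = X - {x1, x2}"
    using finite_X card_seteq by (metis finite_Diff)
  moreover have "h' \<noteq> x1" "h' \<noteq> x2"
    using hD'(2,3,4) x(2) by (auto simp: bads_def)
  ultimately have "h' \<in> halves \<phi> x2"
    using hD'(1) by simp
  then obtain a b where ab: "half \<phi> x2 h' a b"
    by (rule halvesE)
  have ne: "c \<noteq> c'" "c \<noteq> z'" "z \<noteq> c'" "z \<noteq> z'" "h \<noteq> x1" "h \<noteq> x2"
    using hD hD' hh(3) x(2) by (auto simp: bads_def)
  have wne: "w1 \<noteq> w2" "w1 \<noteq> c" "w1 \<noteq> c'" "w1 \<noteq> z" "w1 \<noteq> z'" "w2 \<noteq> c" "w2 \<noteq> c'" "w2 \<noteq> z" "w2 \<noteq> z'"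
    using w1 w2 hD hD' bads(2) ne \<open>h' \<noteq> x1\<close> \<open>h' \<noteq> x2\<close> by auto
  have "{a, b} = {c', z'}"
    using halfD(3)[OF ab] hD'(3) by simp
  then have "a = c' \<or> a = z'"
    by auto
  \<comment> \<open>If \<open>x2\<close> were adjacent to \<open>z'\<close>, giving
    \<open>c'\<close> to \<open>x1\<close> and \<open>z'\<close> to \<open>x2\<close> would repair
    both bad vertices.\<close>
  moreover have "a \<noteq> z'"
  proof
    assume "a = z'"
    then have Ez: "E x2 z'" "E z' x2"
      using halfD(5,6)[OF ab] by auto
    let ?\<psi> = "\<phi>(c' := x1, z' := x2)"
    show False
    proof (rule no_improvement[OF opt _ x(1)])
      show "pure ?\<psi>"
        using optimal_pure[OF opt] w1 w2 hD' Ez by (intro pure_upd) auto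
      have "fib ?\<psi> x1 = {c', w1}" "fib ?\<psi> x2 = {z', w2}" "fib ?\<psi> h' = {}"
        "v \<noteq> x1 \<Longrightarrow> v \<noteq> x2 \<Longrightarrow> v \<noteq> h' \<Longrightarrow> fib ?\<psi> v = fib \<phi> v" for v
        using w1 w2 hD' bads(2) \<open>h' \<noteq> x2\<close> by (auto simp: fib_upd fib_W)
      then show "v \<noteq> x1 \<and> card (fib \<phi> v) = 1" if "v \<in> X" "card (fib ?\<psi> v) = 1" for v
        using that wne by (cases "v = x1"; cases "v = x2"; cases "v = h'") auto
    qed
  qed
  ultimately have Ec: "E x2 c'" "E c' x2"
    using halfD(5,6)[OF ab] by auto
  let ?\<psi> = "\<phi>(c := x1, c' := x2)"
  have "has_hist V E"
  proof (rule has_hist_hub[of ?\<psi> "{}" "{z, z'}" w2])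
    show "pure ?\<psi>"
      using optimal_pure[OF opt] w1 w2 hD hD' Ec by (intro pure_upd) auto
    have f: "fib ?\<psi> x1 - {z, z'} = {c, w1}" "fib ?\<psi> x2 - {z, z'} = {c', w2}" "fib ?\<psi> h - {z, z'} = {}"
        "fib ?\<psi> h' - {z, z'} = {}"
      using w1 w2 hD hD' bads(2) ne wne \<open>h' \<noteq> x1\<close> \<open>h' \<noteq> x2\<close> by (auto simp: fib_upd)
    have f': "fib ?\<psi> v - {z, z'} = fib \<phi> v" if "v \<noteq> x1" "v \<noteq> x2" "v \<noteq> h" "v \<noteq> h'" for v
      using that hD hD' by (auto simp: fib_upd fib_W)
    show "card (fib ?\<psi> v - {z, z'}) \<noteq> 1" if v: "v \<in> X - {}" for v
    proof -
      consider "v = x1" | "v = x2" | "v = h" | "v = h'" | "v \<noteq> x1" "v \<noteq> x2" "v \<noteq> h" "v \<noteq> h'"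
        by blast
      then show ?thesis
      proof cases
        case 1
        then show ?thesis
          unfolding 1 f using wne by simp
      next
        case 2
        then show ?thesis
          unfolding 2 f using wne by simp
      next
        case 3
        then show ?thesis
          unfolding 3 f by simp
      next
        case 4
        then show ?thesis
          unfolding 4 f by simp
      next
        case 5
        then have "v \<notin> bads \<phi>"
          using bads by simp
        then show ?thesis
          unfolding f'[OF 5] using v by (simp add: bads_def)
      qed
    qed
    show "E v w2" if "v \<in> {z, z'}" for v
      using that zw by auto
  qed (use X4 hD hD' ne w2 in auto)
  then show False
    using no by blast
qed

text \<open>By \<open>bad_degree\<close> every bad vertex has at least three neighbours in
  \<open>X\<close> and halves together. A single bad vertex has a link or three halves; of two bad
  vertices one has two halves, or each has two possible links, and linking both leaves at least
  three children at the root.\<close>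

lemma has_hist_degree_ge_5:
  assumes deg: "\<And>v. v \<in> V \<Longrightarrow> card X \<le> card (nbrs v)" and X5: "card X \<ge> 5"
  shows "has_hist V E"
proof -
  obtain \<phi> where opt: "optimal \<phi>"
    using optimal_exists by blast
  have deg': "card X \<le> 2 + card (nbrs x \<inter> X) + card (halves \<phi> x)" if "x \<in> bads \<phi>" for x
  proof -
    have "x \<in> V"
      using that bads_X V_iff by blast
    then show ?thesis
      using deg bad_degree[OF opt that] order_trans by blast
  qed
  consider "card (bads \<phi>) = 0" | "card (bads \<phi>) = 1" | "card (bads \<phi>) = 2" | "card (bads \<phi>) \<ge> 3"
    by linarith
  then show ?thesis
  proof cases
    case 1
    then show ?thesis
      using has_hist_links[OF opt] X5 by simp
  next
    case 2
    then obtain x where x: "bads \<phi> = {x}"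
      by (auto simp: card_1_singleton_iff)
    show ?thesis
    proof (cases "card (nbrs x \<inter> X) = 0")
      case True
      then show ?thesis
        using has_hist_three_halves[OF opt x] deg'[of x] x X5 by simp
    next
      case False
      then show ?thesis
        using has_hist_links[OF opt] x X5 by simp
    qed
  next
    case 3
    then obtain x1 x2 where x: "bads \<phi> = {x1, x2}" "x1 \<noteq> x2"
      by (auto simp: card_2_iff)
    show ?thesis
    proof (cases "card (halves \<phi> x1) \<ge> 2 \<or> card (halves \<phi> x2) \<ge> 2")
      case True
      then show ?thesis
        using has_hist_two_bads_two_halves[OF opt x _ deg] has_hist_two_bads_two_halves[OF opt _ _ _ deg, of x2 x1] x X5
        by (auto simp: insert_commute)
    next
      case False
      have "card (bads \<phi>) \<le> card (nbrs y \<inter> X)" if "y \<in> bads \<phi>" for y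
        using False deg'[OF that] that x 3 X5 by auto
      then show ?thesis
        using has_hist_links[OF opt] 3 X5 by simp
    qed
  next
    case 4
    then show ?thesis
      using has_hist_three_bads[OF opt _ deg] X5 by simp
  qed
qed

section \<open>Minimum degree three or four\<close>

lemma big_fiber:
  assumes "pure \<phi>" "card W > 2 * card X"
  shows "\<exists>\<alpha>\<in>X. card (fib \<phi> \<alpha>) \<ge> 3"
proof (rule ccontr)
  assume "\<not> ?thesis"
  then have "card (fib \<phi> x) \<le> 2" if "x \<in> X" for x
    using that by (simp add: not_le less_Suc_eq_le numeral_3_eq_3 numeral_2_eq_2)
  then have "(\<Sum>x\<in>X. card (fib \<phi> x)) \<le> card X * 2"
    using sum_bounded_above[of X "\<lambda>x. card (fib \<phi> x)" 2] by simp
  then show False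
    using card_W_le[OF assms(1)] assms(2) by simp
qed

lemma card_W: "card W = card V - Suc (card X)"
proof -
  have "W = V - insert d X" "insert d X \<subseteq> V"
    using V_iff by (auto simp: W_def)
  then show ?thesis
    using finite_X d_X by (simp add: card_Diff_subset)
qed

text \<open>A fibre with at least three members can spare \<open>y\<close>, so \<open>w\<close> and
  \<open>y\<close> become the two children of \<open>t\<close>, and \<open>x\<close> is left
  childless.\<close>

lemma resolve_with_free:
  assumes opt: "optimal \<phi>" and x: "bads \<phi> = {x}" "fib \<phi> x = {w}" and t: "t \<in> W" "E w t" "E y t"
    and y: "y \<in> W" "y \<noteq> w" "card (fib \<phi> (\<phi> y)) \<ge> 3" and "card X \<noteq> 2"
  shows "has_hist V E"
proof (rule has_hist_hub[of \<phi> "{}" "{w, y}" t])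
  have w: "w \<in> W" "\<phi> w = x"
    using fib_singletonD[OF x(2)] by auto
  show "{w, y} \<subseteq> W"
    using w y by simp
  show "E z t" if "z \<in> {w, y}" for z
    using that t by auto
  show "card (fib \<phi> v - {w, y}) \<noteq> 1" if v: "v \<in> X - {}" for v
  proof -
    consider "v = x" | "v \<noteq> x" "v = \<phi> y" | "v \<noteq> x" "v \<noteq> \<phi> y"
      by blast
    then show ?thesis
    proof cases
      case 1
      then show ?thesis
        using x(2) by simp
    next
      case 2
      then have "fib \<phi> v - {w, y} = fib \<phi> v - {y}"
        using w by (auto simp: fib_W)
      moreover have "card (fib \<phi> v - {y}) \<ge> 2"
        using 2 y(3) finite_fib diff_card_le_card_Diff[of "{y}" "fib \<phi> v"] by simp
      ultimately show ?thesis
        by simp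
    next
      case 3
      then have "fib \<phi> v - {w, y} = fib \<phi> v"
        using w by (intro fib_Diff_other) auto
      moreover have "v \<notin> bads \<phi>"
        using 3 x(1) by simp
      ultimately show ?thesis
        using v by (simp add: bads_def)
    qed
  qed
qed (use assms optimal_pure in auto)

text \<open>A member \<open>y\<close> of a large fibre may leave it, so \<open>w\<close> and \<open>y\<close> could move together below a common
  neighbour, or \<open>y\<close> could join \<open>x\<close>.\<close>

lemma free_adjacent:
  assumes opt: "optimal \<phi>" and x: "bads \<phi> = {x}" "fib \<phi> x = {w}"
    and y: "y \<in> W" "y \<noteq> w" "card (fib \<phi> (\<phi> y)) \<ge> 3" and X2: "card X \<noteq> 2" and no: "\<not> has_hist V E"
  shows "E w y" "\<And>t. t \<in> W \<Longrightarrow> E w t \<Longrightarrow> \<not> E y t" "\<not> E y x"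
proof -
  have xb: "x \<in> bads \<phi>"
    using x by simp
  have w: "w \<in> W" "\<phi> w = x" "x \<in> X"
    using fib_singletonD[OF x(2)] xb bads_X by auto
  show common: "\<not> E y t" if "t \<in> W" "E w t" for t
    using resolve_with_free[OF opt x that _ y X2] no by blast
  have "\<phi> y \<noteq> x"
    using y(3) x(2) by auto
  show yx: "\<not> E y x"
    using bad_nbr_fiber[OF opt xb y(1) _ \<open>\<phi> y \<noteq> x\<close>] y(3) sym by fastforce
  show "E w y"
  proof (rule ccontr)
    assume "\<not> E w y"
    moreover have "w \<in> V" "y \<in> V"
      using w y V_iff by auto
    ultimately obtain s where s: "E w s" "E s y"
      using diam y(2) by blast
    have "E y s"
      using s(2) by (rule sym)
    \<comment> \<open>By \<open>common\<close> the middle vertex is not in \<open>W\<close>. In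
      \<open>X\<close> it has an empty fibre by \<open>bad_child_nbr\<close>, and could adopt both
      \<open>w\<close> and \<open>y\<close>.\<close>
    have "s \<in> X"
      using nbr_cases[OF s(1)] common[of s] s(1) \<open>E y s\<close> W_not_adj w(1) by blast
    moreover have "s \<noteq> x"
      using yx \<open>E y s\<close> by blast
    ultimately have e: "fib \<phi> s = {}"
      using bad_child_nbr[OF opt xb x(2) _ _ s(1)] by blast
    then have "s \<noteq> \<phi> y"
      using y(3) by auto
    let ?\<psi> = "\<phi>(w := s, y := s)"
    show False
    proof (rule no_improvement[OF opt _ xb])
      show "pure ?\<psi>"
        using optimal_pure[OF opt] \<open>s \<in> X\<close> s(1) \<open>E y s\<close> by (intro pure_upd)
      have "fib ?\<psi> x = {}" "fib ?\<psi> s = {y, w}" "fib ?\<psi> (\<phi> y) = fib \<phi> (\<phi> y) - {y}"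
        using w y e x(2) \<open>s \<noteq> x\<close> \<open>s \<noteq> \<phi> y\<close> \<open>\<phi> y \<noteq> x\<close> by (auto simp: fib_upd fib_W)
      moreover have "fib ?\<psi> v = fib \<phi> v" if "v \<noteq> x" "v \<noteq> s" "v \<noteq> \<phi> y" for v
        using that w y by (auto simp: fib_upd fib_W)
      moreover have "card (fib \<phi> (\<phi> y) - {y}) \<ge> 2"
        using y(3) finite_fib diff_card_le_card_Diff[of "{y}" "fib \<phi> (\<phi> y)"] by simp
      ultimately show "v \<noteq> x \<and> card (fib \<phi> v) = 1" if "v \<in> X" "card (fib ?\<psi> v) = 1" for v
        using that y(2) by (cases "v = x"; cases "v = s"; cases "v = \<phi> y") auto
    qed
  qed
qed


text \<open>If \<open>y\<close> could move to \<open>h\<close>, the assignment would stay optimal,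
  but \<open>x\<close> would then be adjacent to \<open>c\<close> in a fibre of three, against
  \<open>bad_nbr_fiber\<close>.\<close>

lemma free_not_half:
  assumes opt: "optimal \<phi>" and x: "bads \<phi> = {x}" and h: "half \<phi> x h c z"
    and y: "y \<in> W" "card (fib \<phi> (\<phi> y)) \<ge> 3"
  shows "\<not> E y h"
proof
  assume "E y h"
  note hD = halfD[OF h]
  have ne: "h \<noteq> \<phi> y" "y \<noteq> c" "y \<noteq> z"
    using hD y by auto
  let ?\<psi> = "\<phi>(y := h)"
  have f: "fib ?\<psi> h = {y, c, z}" "fib ?\<psi> (\<phi> y) = fib \<phi> (\<phi> y) - {y}"
    using hD y ne by (auto simp: fib_upd)
  have f': "fib ?\<psi> v = fib \<phi> v" if "v \<noteq> h" "v \<noteq> \<phi> y" for v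
    using that y by (auto simp: fib_upd fib_W)
  have three: "card (fib ?\<psi> h) = 3"
    unfolding f using ne hD(4) by simp
  have two: "card (fib ?\<psi> (\<phi> y)) \<ge> 2"
    unfolding f using y(2) finite_fib diff_card_le_card_Diff[of "{y}" "fib \<phi> (\<phi> y)"] by simp
  have "x \<in> bads \<phi>"
    using x by simp
  then have "card (fib \<phi> x) = 1"
    by (simp add: bads_def)
  then have "\<phi> y \<noteq> x"
    using y(2) by auto
  have bads: "bads ?\<psi> = {x}"
  proof -
    have "v \<in> bads ?\<psi> \<longleftrightarrow> v \<in> bads \<phi>" for v
      using three two f' hD(3,4) y(2) unfolding bads_def by (cases "v = h"; cases "v = \<phi> y") auto
    then show ?thesis
      using x by blast
  qed
  have "pure ?\<psi>"
    using optimal_pure[OF opt] hD(1) \<open>E y h\<close> by (rule pure_upd)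
  then have "optimal ?\<psi>"
    using opt bads x by (simp add: optimal_def)
  then have "card (fib ?\<psi> (?\<psi> c)) = 2"
    using bads hD ne by (intro bad_nbr_fiber[of ?\<psi> x c]) auto
  then show False
    using three hD(9) ne(2) by simp
qed

section \<open>Minimum degree four\<close>

text \<open>Linking both bad vertices would leave the root with two children. Instead only
  \<open>x1\<close> is linked, and \<open>w1\<close> becomes a branch vertex that adopts
  \<open>w2\<close> and further neighbours in \<open>W\<close>. If this always fails,
  \<open>w1\<close> has at most three neighbours, fewer than the minimum degree.\<close>

lemma has_hist_degree_4_two_bads:
  assumes opt: "optimal \<phi>" and bads: "bads \<phi> = {x1, x2}" "x1 \<noteq> x2" and X4: "card X = 4"
    and deg: "\<And>v. v \<in> V \<Longrightarrow> card X \<le> card (nbrs v)" and \<alpha>: "\<alpha> \<in> X" "card (fib \<phi> \<alpha>) \<ge> 3"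
  shows "has_hist V E"
proof (rule ccontr)
  assume no: "\<not> has_hist V E"
  have x: "x1 \<in> bads \<phi>" "x2 \<in> bads \<phi>"
    using bads by auto
  obtain w1 where w1: "x1 \<in> X" "fib \<phi> x1 = {w1}" "w1 \<in> W" "\<phi> w1 = x1"
    using x(1) by (rule badsE)
  obtain w2 where w2: "x2 \<in> X" "fib \<phi> x2 = {w2}" "w2 \<in> W" "\<phi> w2 = x2"
    using x(2) by (rule badsE)
  have "w1 \<noteq> w2"
    using w1 w2 bads by auto
  have \<alpha>x: "\<alpha> \<noteq> x1" "\<alpha> \<noteq> x2"
    using \<alpha> w1 w2 by auto
  have "card (X - {x1, x2, \<alpha>}) = 1"
    using X4 w1(1) w2(1) \<alpha>(1) \<alpha>x bads(2) finite_X by (simp add: card_Diff_subset)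
  then obtain \<eta> where "X - {x1, x2, \<alpha>} = {\<eta>}"
    by (auto simp: card_1_singleton_iff)
  then have X: "v \<in> X \<longleftrightarrow> v = x1 \<or> v = x2 \<or> v = \<alpha> \<or> v = \<eta>" for v
    using w1(1) w2(1) \<alpha>(1) by blast
  have "halves \<phi> x1 \<subseteq> {\<eta>}"
  proof
    fix h assume "h \<in> halves \<phi> x1"
    then obtain c z where h: "half \<phi> x1 h c z"
      by (rule halvesE)
    then have "card (fib \<phi> h) = 2"
      using halfD(3,4)[OF h] by simp
    then show "h \<in> {\<eta>}"
      using X[of h] halfD(1)[OF h] w1(2) w2(2) \<alpha>(2) by auto
  qed
  then have "card (halves \<phi> x1) \<le> 1"
    using card_mono[of "{\<eta>}" "halves \<phi> x1"] by simp
  moreover have "w1 \<in> V" "x1 \<in> V"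
    using w1 V_iff by auto
  ultimately have link: "card (nbrs x1 \<inter> X) \<ge> 1"
    using bad_degree[OF opt x(1)] deg[of x1] X4 by simp
  have hub: False if T: "T \<subseteq> W - {w1, w2}" "T \<noteq> {}" "\<And>t. t \<in> T \<Longrightarrow> E w1 t" "E w1 w2"
      "\<And>y. y \<in> X - {x1, x2} \<Longrightarrow> card (fib \<phi> y - T) \<noteq> 1" for T
  proof -
    have "finite T"
      using T(1) finite_W finite_subset by blast
    have "has_hist V E"
    proof (rule has_hist_hub[of \<phi> "{x1}" "insert w2 T" w1])
      obtain t where "t \<in> T"
        using T(2) by blast
      then show "card (insert w2 T) \<noteq> 1"
        using T(1) \<open>finite T\<close> by (intro card_ge2[of _ w2 t]) auto
      show "E z w1" if "z \<in> insert w2 T" for z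
        using that T(3,4) sym by blast
      show "card (fib \<phi> y - insert w2 T) \<noteq> 1" if "y \<in> X - {x1}" for y
      proof (cases "y = x2")
        case True
        then show ?thesis
          using w2(2) by simp
      next
        case False
        then have "fib \<phi> y - insert w2 T = fib \<phi> y - T"
          using w2 by (auto simp: fib_W)
        then show ?thesis
          using T(5) False that by simp
      qed
      show "fib \<phi> y - insert w2 T \<noteq> {}" if "y \<in> {x1}" for y
        using that w1(2) T(1) \<open>w1 \<noteq> w2\<close> by auto
    qed (use opt optimal_pure w1 w2 link X4 T in auto)
    then show False
      using no by blast
  qed
  have nonbad: "card (fib \<phi> y) \<noteq> 1" if "y \<in> X - {x1, x2}" for y
    using that bads by (auto simp: bads_def)
  have ww: "E w1 w2"
    using bad_children_close[OF opt x(1) w1(2) x(2) w2(2) bads(2)]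
      resolve_pair[OF opt x(1) w1(2) x(2) w2(2) bads(2), of _ "{}"] bads no X4 by auto
  \<comment> \<open>A fibre of at least three members could spare \<open>t\<close>, and
    \<open>w1\<close> would adopt \<open>t\<close> together with \<open>w2\<close>. As no bad fibre
    is left for \<open>t\<close>, its fibre has exactly two members, and \<open>\<eta>\<close> is
    the only possible parent.\<close>
  have small: "\<phi> t = \<eta> \<and> card (fib \<phi> \<eta>) = 2" if t: "t \<in> W" "E w1 t" "t \<noteq> w2" for t
  proof -
    have "t \<noteq> w1"
      using t irrefl by blast
    have t_fib: "t \<in> fib \<phi> (\<phi> t)" "\<phi> t \<in> X"
      using W_members[OF t(1) optimal_pure[OF opt]] by auto
    then have ty: "\<phi> t \<in> X - {x1, x2}"
      using w1(2) w2(2) t(3) \<open>t \<noteq> w1\<close> by auto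
    have "\<not> card (fib \<phi> (\<phi> t)) \<ge> 3"
    proof
      assume three: "card (fib \<phi> (\<phi> t)) \<ge> 3"
      show False
      proof (rule hub[of "{t}"])
        show "card (fib \<phi> y - {t}) \<noteq> 1" if "y \<in> X - {x1, x2}" for y
        proof (cases "y = \<phi> t")
          case True
          then show ?thesis
            using three t_fib finite_fib by simp
        next
          case False
          then have "fib \<phi> y - {t} = fib \<phi> y"
            by (intro fib_Diff_other) auto
          then show ?thesis
            using nonbad that by simp
        qed
      qed (use t ww \<open>t \<noteq> w1\<close> in auto)
    qed
    moreover have "card (fib \<phi> (\<phi> t)) \<noteq> 1" "card (fib \<phi> (\<phi> t)) \<noteq> 0"
      using nonbad[OF ty] t_fib finite_fib by auto
    ultimately have "card (fib \<phi> (\<phi> t)) = 2"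
      by linarith
    moreover have "\<phi> t \<noteq> \<alpha>"
      using \<alpha>(2) calculation by auto
    ultimately show ?thesis
      using ty X[of "\<phi> t"] by auto
  qed
  have "\<exists>s. nbrs w1 \<subseteq> {x1, w2, s}"
  proof -
    have inX: "v = x1 \<or> v = \<eta> \<and> fib \<phi> \<eta> = {}" if "E w1 v" "v \<in> X" for v
      using bad_child_nbr[OF opt x(1) w1(2) that(2) _ that(1)] X[of v] that(2) w2(2) \<alpha>(2) by auto
    show ?thesis
    proof (cases "fib \<phi> \<eta> = {}")
      case True
      have "nbrs w1 \<subseteq> {x1, w2, \<eta>}"
      proof
        fix v assume "v \<in> nbrs w1"
        then have v: "E w1 v"
          by simp
        then show "v \<in> {x1, w2, \<eta>}"
          using nbr_cases[OF v] inX[OF v] small[of v] True W_not_adj(1)[OF w1(3)] by auto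
      qed
      then show ?thesis ..
    next
      case False
      show ?thesis
      proof (cases "\<exists>t. t \<in> W \<and> E w1 t \<and> t \<noteq> w2")
        case False
        then have "nbrs w1 \<subseteq> {x1, w2, x1}"
          using nbr_cases inX W_not_adj(1)[OF w1(3)] \<open>fib \<phi> \<eta> \<noteq> {}\<close> by blast
        then show ?thesis ..
      next
        case True
        then obtain t where t: "t \<in> W" "E w1 t" "t \<noteq> w2"
          by blast
        \<comment> \<open>Two such vertices exhaust the fibre of \<open>\<eta>\<close>, so
          \<open>w1\<close> could adopt both and leave \<open>\<eta>\<close> childless.\<close>
        have "v = t" if v: "v \<in> W" "E w1 v" "v \<noteq> w2" for v
        proof (rule ccontr)
          assume "v \<noteq> t"
          have "{t, v} \<subseteq> fib \<phi> \<eta>" "card (fib \<phi> \<eta>) = card {t, v}"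
            using small[OF t] small[OF v] t v \<open>v \<noteq> t\<close> by (auto simp: fib_W)
          then have "{t, v} = fib \<phi> \<eta>"
            using finite_fib card_subset_eq by metis
          then have fe: "fib \<phi> \<eta> = {t, v}"
            by simp
          show False
          proof (rule hub[of "{t, v}"])
            show "{t, v} \<subseteq> W - {w1, w2}"
              using t v irrefl by auto
            show "card (fib \<phi> y - {t, v}) \<noteq> 1" if "y \<in> X - {x1, x2}" for y
            proof (cases "y = \<eta>")
              case True
              then show ?thesis
                by (simp add: fe)
            next
              case False
              then have "fib \<phi> y - {t, v} = fib \<phi> y"
                using small[OF t] small[OF v] by (intro fib_Diff_other) auto
              then show ?thesis
                using nonbad that by simp
            qed
          qed (use t v ww in auto)
        qed
        then have "nbrs w1 \<subseteq> {x1, w2, t}"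
          using nbr_cases inX W_not_adj(1)[OF w1(3)] \<open>fib \<phi> \<eta> \<noteq> {}\<close> by blast
        then show ?thesis ..
      qed
    qed
  qed
  then obtain s where "nbrs w1 \<subseteq> {x1, w2, s}"
    by blast
  then have "card (nbrs w1) \<le> card {x1, w2, s}"
    by (intro card_mono) auto
  also have "\<dots> \<le> 3"
    by (simp add: card_insert_if)
  finally show False
    using deg[OF \<open>w1 \<in> V\<close>] X4 by simp
qed

text \<open>Otherwise \<open>z\<close> could move to \<open>k\<close>, which has a child already,
  and \<open>c\<close> to \<open>x\<close>: then \<open>h\<close> is childless and \<open>x\<close>
  is repaired.\<close>

lemma half_far_child:
  assumes opt: "optimal \<phi>" and x: "x \<in> bads \<phi>" and h: "half \<phi> x h c z"
    and k: "k \<in> X" "k \<noteq> x" "k \<noteq> h" "fib \<phi> k \<noteq> {}"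
  shows "\<not> E z k"
proof
  assume Ez: "E z k"
  note hD = halfD[OF h]
  obtain w where w: "x \<in> X" "fib \<phi> x = {w}" "w \<in> W" "\<phi> w = x"
    using x by (rule badsE)
  obtain u where u: "u \<in> fib \<phi> k"
    using k(4) by blast
  have ne: "c \<noteq> w" "z \<noteq> w" "z \<noteq> u" "x \<noteq> h" "x \<noteq> k"
    using hD w u k by (auto simp: fib_W)
  let ?\<psi> = "\<phi>(z := k, c := x)"
  show False
  proof (rule no_improvement[OF opt _ x])
    show "pure ?\<psi>"
      by (intro pure_upd optimal_pure[OF opt] k(1) Ez w(1) hD(6))
    have f: "fib ?\<psi> v = (if v = x then insert c else (\<lambda>A. A - {c})) ((if v = k then insert z else (\<lambda>A. A - {z})) (fib \<phi> v))" for v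
      unfolding fib_upd[OF hD(7)] fib_upd[OF hD(8)] by simp
    show "v \<noteq> x \<and> card (fib \<phi> v) = 1" if v: "v \<in> X" "card (fib ?\<psi> v) = 1" for v
    proof -
      consider "v = x" | "v = h" | "v = k" | "v \<noteq> x" "v \<noteq> h" "v \<noteq> k"
        by blast
      then show ?thesis
      proof cases
        case 1
        have "fib ?\<psi> x = {c, w}"
          unfolding f using ne w(2) by auto
        then show ?thesis
          using v ne unfolding 1 by simp
      next
        case 2
        have "fib ?\<psi> h = {}"
          unfolding f using ne k(3) hD(3) by auto
        then show ?thesis
          using v unfolding 2 by simp
      next
        case 3
        have "u \<noteq> c"
          using u hD(9) k(3) by (auto simp: fib_W)
        then have "z \<in> fib ?\<psi> k" "u \<in> fib ?\<psi> k"
          unfolding f using ne u hD(4) by auto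
        then show ?thesis
          using v(2) ne(3) finite_fib card_ge2[of "fib ?\<psi> k" z u] unfolding 3 by blast
      next
        case 4
        then have "z \<notin> fib \<phi> v" "c \<notin> fib \<phi> v"
          using hD(9,10) by (auto simp: fib_W)
        then have "fib ?\<psi> v = fib \<phi> v"
          unfolding f using 4 by simp
        then show ?thesis
          using v(2) 4(1) by simp
      qed
    qed
  qed
qed

text \<open>After the shift that makes \<open>k\<close> bad, \<open>k\<close> has no neighbour in
  \<open>X\<close>, since linking one vertex out of four keeps three children at the root. Its
  degree then requires two halves, which can only be \<open>x\<close> and \<open>h\<close> because
  the fibre of \<open>\<alpha>\<close> is too large. The child of \<open>h\<close> adjacent to
  \<open>k\<close> is \<open>c\<close>, as \<open>half_far_child\<close> excludes
  \<open>z\<close>.\<close>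

lemma degree_4_half_swap:
  assumes opt: "optimal \<phi>" and x: "bads \<phi> = {x}" "fib \<phi> x = {w}" and no: "\<not> has_hist V E"
    and deg: "\<And>v. v \<in> V \<Longrightarrow> card X \<le> card (nbrs v)" and X: "X = {x, h, k, \<alpha>}" "card X = 4"
    and \<alpha>: "card (fib \<phi> \<alpha>) \<ge> 3" and h: "half \<phi> x h c z" and k: "half \<phi> x k c' z'"
  shows "E k c"
proof -
  have xb: "x \<in> bads \<phi>"
    using x by simp
  have ne: "h \<noteq> k" "x \<noteq> h" "x \<noteq> k" "\<alpha> \<noteq> x" "\<alpha> \<noteq> h" "\<alpha> \<noteq> k"
    using X by (auto simp: card_insert_if split: if_splits)
  note hD = halfD[OF h] and kD = halfD[OF k] and sh = shift[OF opt xb k]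
  have b: "bads (\<phi>(c' := x)) = {k}"
    using sh(2) x by simp
  have "k \<in> V"
    using kD(1) V_iff by blast
  have "card (nbrs k \<inter> X) = 0"
    using has_hist_links[OF sh(1)] b X(2) no by (cases "card (nbrs k \<inter> X)") auto
  then have two: "card (halves (\<phi>(c' := x)) k) \<ge> 2"
    using bad_degree[OF sh(1), of k] b deg[OF \<open>k \<in> V\<close>] X(2) by simp
  have "\<alpha> \<notin> halves (\<phi>(c' := x)) k"
  proof
    assume "\<alpha> \<in> halves (\<phi>(c' := x)) k"
    then obtain a b where "half (\<phi>(c' := x)) k \<alpha> a b"
      by (rule halvesE)
    then have "card (fib (\<phi>(c' := x)) \<alpha>) = 2"
      using halfD(3,4)[of "\<phi>(c' := x)" k \<alpha> a b] by simp
    then show False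
      using sh(5)[of \<alpha>] ne \<alpha> by simp
  qed
  then have "halves (\<phi>(c' := x)) k \<subseteq> {x, h}"
    using halves_subset[of "\<phi>(c' := x)" k] X(1) by auto
  then have "halves (\<phi>(c' := x)) k = {x, h}"
    using two ne card_seteq[of "{x, h}"] by auto
  then have "h \<in> halves (\<phi>(c' := x)) k"
    by simp
  then obtain a b where ab: "half (\<phi>(c' := x)) k h a b"
    by (rule halvesE)
  have "{a, b} = {c, z}"
    using halfD(3)[OF ab] sh(5)[of h] ne hD(3) by simp
  then have "a = c \<or> a = z"
    by auto
  moreover have False if "a = z"
  proof -
    have Ez: "E z k"
      using halfD(6)[OF ab] that by simp
    then show False
      using half_far_child[OF opt xb h kD(1)] ne kD(3) by simp
  qed
  ultimately show ?thesis
    using halfD(5)[OF ab] by blast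
qed

text \<open>Without a link, \<open>x\<close> has exactly two halves \<open>h\<close> and
  \<open>k\<close>, so apart from \<open>w\<close> and the four children of the halves all of
  \<open>W\<close> lies in the fibre of \<open>\<alpha>\<close>. A member \<open>f\<close> of this
  fibre has so few possible neighbours that the minimum degree makes it adjacent to \<open>c\<close>
  and \<open>c'\<close>. Hence \<open>w\<close> is adjacent to neither, and its only routes to
  \<open>h\<close> and \<open>k\<close> lead through \<open>z\<close> and \<open>z'\<close>, so
  \<open>w\<close> is a common neighbour below which the halves are resolved.\<close>

lemma has_hist_degree_4_one_bad:
  assumes opt: "optimal \<phi>" and x: "bads \<phi> = {x}" and X4: "card X = 4"
    and deg: "\<And>v. v \<in> V \<Longrightarrow> card X \<le> card (nbrs v)" and \<alpha>: "\<alpha> \<in> X" "card (fib \<phi> \<alpha>) \<ge> 3"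
  shows "has_hist V E"
proof (rule ccontr)
  assume no: "\<not> has_hist V E"
  have xb: "x \<in> bads \<phi>"
    using x by simp
  obtain w where w: "x \<in> X" "fib \<phi> x = {w}" "w \<in> W" "\<phi> w = x"
    using xb by (rule badsE)
  have V: "x \<in> V" "w \<in> V"
    using w V_iff by auto
  have "card (nbrs x \<inter> X) = 0"
    using has_hist_links[OF opt] x X4 no by (cases "card (nbrs x \<inter> X)") auto
  then have xX: "nbrs x \<inter> X = {}"
    using finite_X by simp
  then have two: "card (halves \<phi> x) \<ge> 2"
    using bad_degree[OF opt xb] deg[OF V(1)] X4 by simp
  moreover have "card (halves \<phi> x) < 3"
  proof (rule ccontr)
    assume "\<not> card (halves \<phi> x) < 3"
    then show False
      using has_hist_three_halves[OF opt x] X4 no by simp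
  qed
  ultimately have "card (halves \<phi> x) = 2"
    by simp
  then obtain h k where hk: "halves \<phi> x = {h, k}" "h \<noteq> k"
    by (auto simp: card_2_iff)
  have "h \<in> halves \<phi> x" "k \<in> halves \<phi> x"
    using hk by auto
  then obtain c z c' z' where h: "half \<phi> x h c z" and k: "half \<phi> x k c' z'"
    by (metis halvesE)
  note hD = halfD[OF h] and kD = halfD[OF k]
  have \<alpha>ne: "\<alpha> \<noteq> x" "\<alpha> \<noteq> h" "\<alpha> \<noteq> k"
    using \<alpha>(2) w(2) hD(3,4) kD(3,4) by auto
  then have "card {x, h, k, \<alpha>} = card X"
    using X4 hk(2) hD(2) kD(2) by simp
  then have X: "X = {x, h, k, \<alpha>}"
    using card_subset_eq[OF finite_X, of "{x, h, k, \<alpha>}"] w(1) hD(1) kD(1) \<alpha>(1) by auto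
  have X': "X = {x, k, h, \<alpha>}"
    using X by auto
  have ne: "w \<noteq> c" "w \<noteq> z" "w \<noteq> c'" "w \<noteq> z'" "c \<noteq> c'" "c \<noteq> z'" "z \<noteq> c'" "z \<noteq> z'"
    using w hD kD hk(2) by auto
  have W_cases: "v = w \<or> v = c \<or> v = z \<or> v = c' \<or> v = z' \<or> v \<in> fib \<phi> \<alpha>" if "v \<in> W" for v
  proof -
    have "v \<in> fib \<phi> (\<phi> v)" "\<phi> v = x \<or> \<phi> v = h \<or> \<phi> v = k \<or> \<phi> v = \<alpha>"
      using W_members[OF that optimal_pure[OF opt]] X by auto
    then show ?thesis
      using w(2) hD(3) kD(3) by auto
  qed
  have F: "f \<in> W" "\<phi> f = \<alpha>" "f \<noteq> w" "E w f" "\<not> E f x" "\<not> E f h" "\<not> E f k"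
    "\<And>t. t \<in> W \<Longrightarrow> E w t \<Longrightarrow> \<not> E f t" if f: "f \<in> fib \<phi> \<alpha>" for f
  proof -
    show fW: "f \<in> W" "\<phi> f = \<alpha>"
      using f by (auto simp: fib_W)
    then show fw: "f \<noteq> w"
      using w \<alpha>ne by auto
    have three: "card (fib \<phi> (\<phi> f)) \<ge> 3" and "card X \<noteq> 2"
      using fW \<alpha>(2) X4 by auto
    show "E w f" "\<And>t. t \<in> W \<Longrightarrow> E w t \<Longrightarrow> \<not> E f t" "\<not> E f x"
      using free_adjacent[OF opt x w(2) fW(1) fw three \<open>card X \<noteq> 2\<close> no] by blast+
    show "\<not> E f h" "\<not> E f k"
      using free_not_half[OF opt x _ fW(1) three] h k by blast+
  qed
  have hub: False if f: "f \<in> W" "Z \<subseteq> W" "card Z \<noteq> 1" "\<And>v. v \<in> Z \<Longrightarrow> E v f" "pure \<psi>"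
      "\<And>v. v \<in> X \<Longrightarrow> card (fib \<psi> v - Z) \<noteq> 1" for f Z \<psi>
    using has_hist_hub[of \<psi> "{}" Z f] f no X4 by auto
  have not_both: False if f: "f \<in> fib \<phi> \<alpha>" and cz: "E f c1" "E f z1" and half: "half \<phi> x h1 c1 z1" for f c1 z1 h1
  proof (rule hub[of f "{w, c1, z1}" \<phi>])
    note D = halfD[OF half]
    show "E v f" if "v \<in> {w, c1, z1}" for v
      using that cz F(4)[OF f] sym by blast
    have "fib \<phi> v - {w, c1, z1} = (if v = x \<or> v = h1 then {} else fib \<phi> v)" for v
      using w D by (auto simp: fib_W)
    then show "card (fib \<phi> v - {w, c1, z1}) \<noteq> 1" if "v \<in> X" for v
      using that x by (auto simp: bads_def)
    show "card {w, c1, z1} \<noteq> 1"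
      using D(4) by (intro card_ge2[of _ c1 z1]) auto
  qed (use F(1)[OF f] w halfD[OF half] optimal_pure[OF opt] in auto)
  \<comment> \<open>\<open>degree_4_half_swap\<close> lets \<open>c1\<close> move to
    \<open>k1\<close>, which then has three children; \<open>w\<close> and \<open>z1\<close> go
    below \<open>f\<close>, and neither \<open>x\<close> nor \<open>h1\<close> keeps a
    child.\<close>
  have not_z: False if f: "f \<in> fib \<phi> \<alpha>" and fz: "E f z1" and h1: "half \<phi> x h1 c1 z1" and k1: "half \<phi> x k1 c2 z2"
      and X1: "X = {x, h1, k1, \<alpha>}" for f c1 z1 h1 c2 z2 k1
  proof (rule hub[of f "{w, z1}" "\<phi>(c1 := k1)"])
    note D = halfD[OF h1] and D' = halfD[OF k1]
    have "h1 \<noteq> k1"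
      using X4 X1 by (auto simp: card_insert_if split: if_splits)
    have "E c1 k1"
      using degree_4_half_swap[OF opt x w(2) no deg X1 X4 \<alpha>(2) h1 k1] sym by blast
    then show "pure (\<phi>(c1 := k1))"
      using optimal_pure[OF opt] D'(1) by (intro pure_upd)
    show "E v f" if "v \<in> {w, z1}" for v
      using that fz F(4)[OF f] sym by blast
    have nn: "w \<noteq> z1" "w \<noteq> c1" "w \<noteq> c2" "w \<noteq> z2" "c1 \<noteq> c2" "z1 \<noteq> c2" "z1 \<noteq> z2" "c1 \<noteq> z2"
      using w(4) D(2,9,10) D'(2,9,10) \<open>h1 \<noteq> k1\<close> by auto
    note upd = fib_upd[OF D(7), of \<phi> k1]
    have f: "fib (\<phi>(c1 := k1)) x - {w, z1} = {}" "fib (\<phi>(c1 := k1)) h1 - {w, z1} = {}"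
        "fib (\<phi>(c1 := k1)) k1 - {w, z1} = {c1, c2, z2}"
      unfolding upd using w(2) D(2,3,4) D'(2,3) \<open>h1 \<noteq> k1\<close> nn by auto
    have "c1 \<notin> fib \<phi> \<alpha>" "z1 \<notin> fib \<phi> \<alpha>" "w \<notin> fib \<phi> \<alpha>" "\<alpha> \<noteq> k1"
      using D(9,10) w(4) \<alpha>ne(1) X4 X1 by (auto simp: fib_W card_insert_if split: if_splits)
    then have f': "fib (\<phi>(c1 := k1)) \<alpha> - {w, z1} = fib \<phi> \<alpha>"
      unfolding upd by simp
    show "card (fib (\<phi>(c1 := k1)) v - {w, z1}) \<noteq> 1" if "v \<in> X" for v
    proof -
      have "v = x \<or> v = h1 \<or> v = k1 \<or> v = \<alpha>"
        using that unfolding X1 by simp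
      then consider "v = x" | "v = h1" | "v = k1" | "v = \<alpha>"
        by metis
      then show ?thesis
      proof cases
        case 1
        show ?thesis
          unfolding 1 f by simp
      next
        case 2
        show ?thesis
          unfolding 2 f by simp
      next
        case 3
        show ?thesis
          unfolding 3 f using D'(4) \<open>c1 \<noteq> c2\<close> by (intro card_ge2[of _ c1 c2]) auto
      next
        case 4
        show ?thesis
          unfolding 4 f' using \<alpha>(2) by simp
      qed
    qed
    show "card {w, z1} \<noteq> 1"
      using nn(1) by simp
  qed (use F(1)[OF f] w halfD[OF h1] in auto)
  obtain f where f: "f \<in> fib \<phi> \<alpha>"
    using \<alpha>(2) by (metis card.empty equals0I not_numeral_le_zero)
  have fz: "\<not> E f z" "\<not> E f z'"
    using not_z[OF f _ h k X] not_z[OF f _ k h X'] by blast+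
  have fN: "nbrs f \<subseteq> {\<alpha>, w, c, c'}"
  proof
    fix v assume "v \<in> nbrs f"
    then have v: "E f v"
      by simp
    have "v \<notin> fib \<phi> \<alpha>"
      using F(1,4)[of v] F(8)[OF f, of v] v by blast
    then show "v \<in> {\<alpha>, w, c, c'}"
      using nbr_cases[OF v] W_cases[of v] X v F(5-7)[OF f] fz W_not_adj(1)[OF F(1)[OF f]] by auto
  qed
  moreover have "card {\<alpha>, w, c, c'} \<le> card (nbrs f)"
  proof -
    have "f \<in> V"
      using F(1)[OF f] V_iff by blast
    then show ?thesis
      using deg[of f] X4 by (simp add: card_insert_if)
  qed
  ultimately have "nbrs f = {\<alpha>, w, c, c'}"
    using card_seteq[of "{\<alpha>, w, c, c'}" "nbrs f"] by simp
  then have fc: "E f c" "E f c'"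
    by auto
  have wc: "\<not> E w c" "\<not> E w c'"
    using F(8)[OF f] fc hD(7) kD(7) by blast+
  \<comment> \<open>The diameter condition gives a middle vertex between \<open>w\<close> and
    \<open>h1\<close>, and every candidate except \<open>z1\<close> is ruled out.\<close>
  have wz: "E w z1" if h1: "half \<phi> x h1 c1 z1" and k1: "half \<phi> x k1 c2 z2" and X1: "X = {x, h1, k1, \<alpha>}"
      and wc1: "\<not> E w c1" "\<not> E w c2" and W1: "\<And>v. v \<in> W \<Longrightarrow> v = w \<or> v = c1 \<or> v = z1 \<or> v = c2 \<or> v = z2 \<or> v \<in> fib \<phi> \<alpha>"
      and F1: "\<And>f. f \<in> fib \<phi> \<alpha> \<Longrightarrow> \<not> E f h1" for c1 z1 h1 c2 z2 k1
  proof -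
    note D = halfD[OF h1] and D' = halfD[OF k1]
    have "h1 \<noteq> k1"
      using X4 X1 by (auto simp: card_insert_if split: if_splits)
    have wX: "v = x" if "E w v" "v \<in> X" for v
      using bad_child_nbr[OF opt xb w(2) that(2) _ that(1)] that(2) D(3) D'(3) \<alpha>(2) \<alpha>ne(1) X1 by auto
    have "\<not> E w h1"
      using wX[of h1] D(1,2) by blast
    moreover have "h1 \<in> V" "w \<noteq> h1"
      using D(1) V_iff w(3) X_W by auto
    ultimately obtain s where s: "E w s" "E s h1"
      using diam[OF V(2)] by blast
    have "s \<noteq> x"
      using s(2) xX D(1) by auto
    then have "s \<in> W"
      using nbr_cases[OF s(1)] wX[OF s(1)] s(1) W_not_adj(1)[OF w(3)] by blast
    moreover have "s \<noteq> w" "s \<noteq> c1" "s \<noteq> c2" "s \<notin> fib \<phi> \<alpha>"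
      using s wc1 irrefl F1 by auto
    moreover have "s \<noteq> z2"
    proof
      assume "s = z2"
      then show False
        using half_far_child[OF opt xb k1 D(1,2)] \<open>h1 \<noteq> k1\<close> D(3) s(2) by simp
    qed
    ultimately show ?thesis
      using W1[of s] s(1) by blast
  qed
  have "E z w"
    by (rule sym[OF wz[OF h k X wc W_cases F(6)]])
  moreover have "E z' w"
    by (rule sym[OF wz[OF k h X' wc(2,1) _ F(7)]]) (use W_cases in blast)+
  ultimately show False
    using resolve_halves[OF opt xb h k hk(2) w(3), of "{}"] x X4 no by simp
qed

lemma has_hist_degree_4:
  assumes "\<And>v. v \<in> V \<Longrightarrow> card X \<le> card (nbrs v)" "card X = 4" "card V \<ge> 20"
  shows "has_hist V E"
proof -
  obtain \<phi> where opt: "optimal \<phi>"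
    using optimal_exists by blast
  obtain \<alpha> where \<alpha>: "\<alpha> \<in> X" "card (fib \<phi> \<alpha>) \<ge> 3"
  proof -
    have "card W > 2 * card X"
      using card_W assms(2,3) by simp
    then show thesis
      using big_fiber[OF optimal_pure[OF opt]] that by blast
  qed
  consider "card (bads \<phi>) = 0" | "card (bads \<phi>) = 1" | "card (bads \<phi>) = 2" | "card (bads \<phi>) \<ge> 3"
    by linarith
  then show ?thesis
  proof cases
    case 1
    then show ?thesis
      using has_hist_links[OF opt] assms(2) finite_bads by simp
  next
    case 2
    then obtain x where "bads \<phi> = {x}"
      by (auto simp: card_1_singleton_iff)
    then show ?thesis
      using has_hist_degree_4_one_bad[OF opt _ assms(2,1) \<alpha>] by blast
  next
    case 3
    then obtain x1 x2 where "bads \<phi> = {x1, x2}" "x1 \<noteq> x2"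
      by (auto simp: card_2_iff)
    then show ?thesis
      using has_hist_degree_4_two_bads[OF opt _ _ assms(2,1) \<alpha>] by blast
  next
    case 4
    then show ?thesis
      using has_hist_three_bads[OF opt _ assms(1)] assms(2) by simp
  qed
qed


section \<open>Minimum degree three\<close>

text \<open>No link is used, so the root keeps its three children. Each of \<open>w1\<close> and
  \<open>w2\<close> moves away with a companion from the fibre of \<open>\<alpha>\<close>, which
  retains at least two members.\<close>

lemma has_hist_hub_pair:
  assumes "pure \<phi>" and X: "X = {x1, x2, \<alpha>}" "card X = 3" and w: "fib \<phi> x1 = {w1}" "fib \<phi> x2 = {w2}"
    and F: "card (fib \<phi> \<alpha>) \<ge> 4" and ab: "a \<in> fib \<phi> \<alpha>" "b \<in> fib \<phi> \<alpha>" "a \<noteq> b"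
    and p: "E w1 p" "E a p" "p \<in> W - {w1, a, w2, b}" and q: "E w2 q" "E b q" "q \<in> W - {w2, b}"
  shows "has_hist V E"
proof -
  have ne: "x1 \<noteq> x2" "x1 \<noteq> \<alpha>" "x2 \<noteq> \<alpha>"
    using X by (auto simp: card_insert_if split: if_splits)
  have wW: "w1 \<in> W" "\<phi> w1 = x1" "w2 \<in> W" "\<phi> w2 = x2"
    using fib_singletonD[OF w(1)] fib_singletonD[OF w(2)] by auto
  have abW: "a \<in> W" "\<phi> a = \<alpha>" "b \<in> W" "\<phi> b = \<alpha>"
    using ab by (auto simp: fib_W)
  have dist: "w1 \<noteq> w2" "w1 \<noteq> a" "w1 \<noteq> b" "w2 \<noteq> a" "w2 \<noteq> b"
    using ne wW abW by auto
  show ?thesis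
  proof (rule has_hist_hubs[OF assms(1) linkage_empty, of "{w1, a}" "{w2, b}" p q])
    show "card {x \<in> X. d = d} \<noteq> 2"
      using X(2) by simp
    show "card (fib \<phi> v - {w1, a} - {w2, b}) \<noteq> 1" if "v \<in> X - {}" for v
    proof -
      have "v = x1 \<or> v = x2 \<or> v = \<alpha>"
        using that unfolding X(1) by simp
      moreover have "w1 \<notin> fib \<phi> \<alpha>" "w2 \<notin> fib \<phi> \<alpha>"
        using wW ne by (auto simp: fib_W)
      then have "fib \<phi> \<alpha> - {w1, a} - {w2, b} = fib \<phi> \<alpha> - {a, b}"
        by auto
      then have "card (fib \<phi> \<alpha> - {w1, a} - {w2, b}) \<ge> 2"
        using F ab(3) diff_card_le_card_Diff[of "{a, b}" "fib \<phi> \<alpha>"] by simp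
      moreover have "fib \<phi> x1 - {w1, a} - {w2, b} = {}" "fib \<phi> x2 - {w1, a} - {w2, b} = {}"
        unfolding w by auto
      ultimately show ?thesis
        by (elim disjE) (simp_all only: card.empty)
    qed
  qed (use dist wW abW p q ab(3) in auto)
qed

text \<open>All of \<open>W\<close> except \<open>w1\<close> and \<open>w2\<close> lies in one fibre
  \<open>F\<close>, and \<open>w1\<close> and \<open>w2\<close> are adjacent without a common
  neighbour in \<open>W\<close>. If some vertex of \<open>F\<close> sees neither of them, the
  diameter condition produces the branch vertices \<open>g1\<close> and \<open>g2\<close>. Otherwise
  one of them has three neighbours in \<open>F\<close>, and the minimum degree supplies the edge
  inside \<open>F\<close> that \<open>m1\<close> or \<open>m1'\<close> needs.\<close>

lemma has_hist_degree_3_two_bads: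
  assumes opt: "optimal \<phi>" and bads: "bads \<phi> = {x1, x2}" "x1 \<noteq> x2" and X3: "card X = 3"
    and deg: "\<And>v. v \<in> V \<Longrightarrow> card X \<le> card (nbrs v)" and \<alpha>: "\<alpha> \<in> X" "card (fib \<phi> \<alpha>) \<ge> 3" and n: "card W \<ge> 16"
  shows "has_hist V E"
proof (rule ccontr)
  assume no: "\<not> has_hist V E"
  have x: "x1 \<in> bads \<phi>" "x2 \<in> bads \<phi>"
    using bads by auto
  obtain w1 where w1: "x1 \<in> X" "fib \<phi> x1 = {w1}" "w1 \<in> W" "\<phi> w1 = x1"
    using x(1) by (rule badsE)
  obtain w2 where w2: "x2 \<in> X" "fib \<phi> x2 = {w2}" "w2 \<in> W" "\<phi> w2 = x2"
    using x(2) by (rule badsE)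
  have ne: "\<alpha> \<noteq> x1" "\<alpha> \<noteq> x2"
    using \<alpha> w1 w2 by auto
  then have "card {x1, x2, \<alpha>} = card X"
    using X3 bads(2) by simp
  then have X: "X = {x1, x2, \<alpha>}"
    using card_subset_eq[OF finite_X, of "{x1, x2, \<alpha>}"] w1(1) w2(1) \<alpha>(1) by auto
  have X': "X = {x2, x1, \<alpha>}"
    using X by auto
  define F where "F = fib \<phi> \<alpha>"
  have W_cases: "v = w1 \<or> v = w2 \<or> v \<in> F" if "v \<in> W" for v
  proof -
    have "v \<in> fib \<phi> (\<phi> v)" "\<phi> v = x1 \<or> \<phi> v = x2 \<or> \<phi> v = \<alpha>"
      using W_members[OF that optimal_pure[OF opt]] X by auto
    then show ?thesis
      using w1(2) w2(2) F_def by auto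
  qed
  have finF: "finite F"
    unfolding F_def by (rule finite_fib)
  have cF: "card F \<ge> 14"
  proof -
    have "card W \<le> card ({w1, w2} \<union> F)"
      using W_cases finF by (intro card_mono) auto
    also have "\<dots> \<le> 2 + card F"
      using card_Un_le[of "{w1, w2}" F] by (simp add: card_insert_if split: if_splits)
    finally show ?thesis
      using n by simp
  qed
  have FD: "f \<in> W" "\<phi> f = \<alpha>" "f \<noteq> w1" "f \<noteq> w2" if "f \<in> F" for f
    using that w1(4) w2(4) ne by (auto simp: F_def fib_W)
  have nocommon: "\<not> E w2 t" if "t \<in> W" "E w1 t" for t
    using resolve_pair[OF opt x(1) w1(2) x(2) w2(2) bads(2) that, of "{}"] bads no X3 by auto
  have ww: "E w1 w2" "E w2 w1"
    using bad_children_close[OF opt x(1) w1(2) x(2) w2(2) bads(2)] nocommon sym by blast+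
  have Fx: "\<not> E f x1" "\<not> E f x2" if f: "f \<in> F" for f
  proof -
    have c: "card (fib \<phi> (\<phi> f)) \<noteq> 2"
      using FD(2)[OF f] \<alpha>(2) by simp
    show "\<not> E f x1"
      using bad_nbr_fiber[OF opt x(1) FD(1)[OF f]] c FD(2)[OF f] ne(1) sym by blast
    show "\<not> E f x2"
      using bad_nbr_fiber[OF opt x(2) FD(1)[OF f]] c FD(2)[OF f] ne(2) sym by blast
  qed
  have \<alpha>_fib: "fib \<phi> \<alpha> \<noteq> {}"
    using \<alpha>(2) by auto
  have w_X: "v = x1" if "E w1 v" "v \<in> X" for v
    using bad_child_nbr[OF opt x(1) w1(2) that(2) _ that(1)] \<alpha>_fib w2(2) that(2) X by auto
  have w_X': "v = x2" if "E w2 v" "v \<in> X" for v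
    using bad_child_nbr[OF opt x(2) w2(2) that(2) _ that(1)] \<alpha>_fib w1(2) that(2) X by auto
  have w_nbr: "v = x1 \<or> v = w2 \<or> v \<in> F" if "E w1 v" for v
    using nbr_cases[OF that] w_X[OF that] W_cases[of v] that W_not_adj(1)[OF w1(3)] irrefl by blast
  have w_nbr': "v = x2 \<or> v = w1 \<or> v \<in> F" if "E w2 v" for v
    using nbr_cases[OF that] w_X'[OF that] W_cases[of v] that W_not_adj(1)[OF w2(3)] irrefl by blast
  have F4: "card (fib \<phi> \<alpha>) \<ge> 4"
    using cF F_def by simp
  \<comment> \<open>\<open>y\<close> accompanies \<open>w1\<close> below \<open>f\<close>, and
    \<open>f'\<close> accompanies \<open>w2\<close> below \<open>w1\<close>. Here the second group
    hangs below a member of the first.\<close>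
  have m1: False if f: "f \<in> F" "E w1 f" "f' \<in> F" "E w1 f'" "f \<noteq> f'" "y \<in> F" "E f y" "y \<noteq> f'" for f f' y
  proof -
    have "f \<noteq> y"
      using f(7) irrefl by blast
    then have "has_hist V E"
      using has_hist_hub_pair[OF optimal_pure[OF opt] X X3 w1(2) w2(2) F4, of y f' f w1] f sym[OF f(7)] sym[OF f(4)] ww
        FD[OF f(1)] FD[OF f(3)] w1 \<open>f \<noteq> y\<close> F_def ww irrefl by auto
    then show False
      using no by blast
  qed
  have m1': False if f: "f \<in> F" "E w2 f" "f' \<in> F" "E w2 f'" "f \<noteq> f'" "y \<in> F" "E f y" "y \<noteq> f'" for f f' y
  proof -
    have "f \<noteq> y"
      using f(7) irrefl by blast
    then have "has_hist V E"
      using has_hist_hub_pair[OF optimal_pure[OF opt] X' X3 w2(2) w1(2) F4, of y f' f w2] f sym[OF f(7)] sym[OF f(4)] ww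
        FD[OF f(1)] FD[OF f(3)] w2 \<open>f \<noteq> y\<close> F_def ww irrefl by auto
    then show False
      using no by blast
  qed
  have toF1: "\<exists>g\<in>F. E w1 g \<and> E g f" if f: "f \<in> F" "\<not> E w1 f" "\<not> E w2 f" for f
  proof -
    have "w1 \<in> V" "f \<in> V"
      using w1(3) FD(1)[OF f(1)] V_iff by blast+
    then obtain g where g: "E w1 g" "E g f"
      using diam[of w1 f] f(2) FD(3)[OF f(1)] by metis
    have "g \<noteq> x1" "g \<noteq> w2"
      using g(2) f(3) Fx(1)[OF f(1)] sym by blast+
    then show ?thesis
      using w_nbr[OF g(1)] g by blast
  qed
  have toF2: "\<exists>g\<in>F. E w2 g \<and> E g f" if f: "f \<in> F" "\<not> E w1 f" "\<not> E w2 f" for f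
  proof -
    have "w2 \<in> V" "f \<in> V"
      using w2(3) FD(1)[OF f(1)] V_iff by blast+
    then obtain g where g: "E w2 g" "E g f"
      using diam[of w2 f] f(3) FD(4)[OF f(1)] by metis
    have "g \<noteq> x2" "g \<noteq> w1"
      using g(2) f(2) Fx(2)[OF f(1)] sym by blast+
    then show ?thesis
      using w_nbr'[OF g(1)] g by blast
  qed
  show False
  proof (cases "\<exists>f\<in>F. \<not> E w1 f \<and> \<not> E w2 f")
    case True
    then obtain f0 where f0: "f0 \<in> F" "\<not> E w1 f0" "\<not> E w2 f0"
      by blast
    obtain g1 where g1: "g1 \<in> F" "E w1 g1" "E g1 f0"
      using toF1[OF f0] by blast
    obtain g2 where g2: "g2 \<in> F" "E w2 g2" "E g2 f0"
      using toF2[OF f0] by blast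
    have F1: "f = g1" if "f \<in> F" "E w1 f" for f
    proof (rule ccontr)
      assume "f \<noteq> g1"
      then show False
        using m1[OF g1(1,2) that _ f0(1) g1(3)] that(2) f0(2) by blast
    qed
    have F2: "f = g2" if "f \<in> F" "E w2 f" for f
    proof (rule ccontr)
      assume "f \<noteq> g2"
      then show False
        using m1'[OF g2(1,2) that _ f0(1) g2(3)] that(2) f0(3) by blast
    qed
    \<comment> \<open>Any further member of \<open>F\<close> sees neither \<open>w1\<close> nor
      \<open>w2\<close>, hence is adjacent to \<open>g2\<close>, the only neighbour of
      \<open>w2\<close> in \<open>F\<close>. It accompanies \<open>w2\<close> below
      \<open>g2\<close>, and \<open>f0\<close> accompanies \<open>w1\<close> below
      \<open>g1\<close>.\<close>
    have "\<not> F \<subseteq> {g1, g2, f0}"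
    proof
      assume "F \<subseteq> {g1, g2, f0}"
      then have "card F \<le> card {g1, g2, f0}"
        by (intro card_mono) auto
      also have "\<dots> \<le> 3"
        by (simp add: card_insert_if)
      finally show False
        using cF by simp
    qed
    then obtain f1 where f1: "f1 \<in> F" "f1 \<noteq> g1" "f1 \<noteq> g2" "f1 \<noteq> f0"
      by blast
    then have f1w: "\<not> E w1 f1" "\<not> E w2 f1"
      using F1 F2 by blast+
    have "E g2 f1"
      using toF2[OF f1(1) f1w] F2 by blast
    moreover have "g1 \<noteq> f0" "g2 \<noteq> f0"
      using g1 g2 f0 by blast+
    ultimately have "has_hist V E"
      using has_hist_hub_pair[OF optimal_pure[OF opt] X X3 w1(2) w2(2) F4, of f0 f1 g1 g2] f0 f1 g1 g2
        FD[OF g1(1)] FD[OF g2(1)] F_def sym[OF g1(3)] sym[of g2 f1] by auto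
    then show False
      using no by blast
  next
    case False
    define F1 where "F1 = {f \<in> F. E w1 f}"
    define F2 where "F2 = {f \<in> F. E w2 f}"
    have "F = F1 \<union> F2"
      using False by (auto simp: F1_def F2_def)
    then have "card F \<le> card F1 + card F2"
      using card_Un_le[of F1 F2] by simp
    then consider "card F1 \<ge> 3" | "card F2 \<ge> 3"
      using cF by linarith
    then show False
    proof cases
      case 1
      obtain f where f: "f \<in> F" "E w1 f"
        using 1 F1_def by (metis (no_types, lifting) card.empty equals0I mem_Collect_eq not_numeral_le_zero)
      have "\<not> nbrs f \<subseteq> {\<alpha>, w1}"
      proof
        assume "nbrs f \<subseteq> {\<alpha>, w1}"
        then have "card (nbrs f) \<le> card {\<alpha>, w1}"
          by (intro card_mono) auto
        also have "\<dots> \<le> 2"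
          by (simp add: card_insert_if)
        finally show False
          using deg[of f] X3 FD(1)[OF f(1)] V_iff by simp
      qed
      then obtain y where y: "E f y" "y \<noteq> \<alpha>" "y \<noteq> w1"
        by blast
      have "y \<noteq> w2"
        using nocommon[OF FD(1)[OF f(1)] f(2)] y(1) sym by blast
      moreover have "y \<notin> X"
        using Fx[OF f(1)] y(1,2) unfolding X by blast
      ultimately have yF: "y \<in> F"
        using nbr_cases[OF y(1)] W_cases[of y] y W_not_adj(1)[OF FD(1)[OF f(1)]] by blast
      have "\<not> F1 \<subseteq> {f, y}"
        using card_mono[of "{f, y}" F1] 1 by (auto simp: card_insert_if split: if_splits)
      then obtain f' where "f' \<in> F" "E w1 f'" "f \<noteq> f'" "y \<noteq> f'"
        using F1_def by blast
      then show False
        using m1[OF f _ _ _ yF y(1)] by blast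
    next
      case 2
      obtain f where f: "f \<in> F" "E w2 f"
        using 2 F2_def by (metis (no_types, lifting) card.empty equals0I mem_Collect_eq not_numeral_le_zero)
      have "\<not> nbrs f \<subseteq> {\<alpha>, w2}"
      proof
        assume "nbrs f \<subseteq> {\<alpha>, w2}"
        then have "card (nbrs f) \<le> card {\<alpha>, w2}"
          by (intro card_mono) auto
        also have "\<dots> \<le> 2"
          by (simp add: card_insert_if)
        finally show False
          using deg[of f] X3 FD(1)[OF f(1)] V_iff by simp
      qed
      then obtain y where y: "E f y" "y \<noteq> \<alpha>" "y \<noteq> w2"
        by blast
      have "y \<noteq> w1"
        using nocommon[OF FD(1)[OF f(1)]] f(2) y(1) sym by blast
      moreover have "y \<notin> X"
        using Fx[OF f(1)] y(1,2) unfolding X by blast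
      ultimately have yF: "y \<in> F"
        using nbr_cases[OF y(1)] W_cases[of y] y W_not_adj(1)[OF FD(1)[OF f(1)]] by blast
      have "\<not> F2 \<subseteq> {f, y}"
        using card_mono[of "{f, y}" F2] 2 by (auto simp: card_insert_if split: if_splits)
      then obtain f' where "f' \<in> F" "E w2 f'" "f \<noteq> f'" "y \<noteq> f'"
        using F2_def by blast
      then show False
        using m1'[OF f _ _ _ yF y(1)] by blast
    qed
  qed
qed

lemma nbrs_three:
  assumes "v \<in> V" "nbrs v \<subseteq> {a, b, c}" "card (nbrs v) \<ge> 3"
  shows "E v a \<and> E v b \<and> E v c"
proof -
  have "card {a, b, c} \<le> 3"
    by (simp add: card_insert_if)
  then have "nbrs v = {a, b, c}"
    using assms(2,3) card_seteq[of "{a, b, c}" "nbrs v"] by simp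
  then show ?thesis
    by blast
qed

text \<open>As \<open>x\<close> is the only bad vertex, the fibre of \<open>\<eta>\<close> is empty
  or has at least three members, so every vertex of \<open>W\<close> other than \<open>w\<close>
  lies in a large fibre. By \<open>free_adjacent\<close> its neighbours are among
  \<open>\<alpha>\<close>, \<open>\<eta>\<close>, \<open>w\<close>, and the minimum degree makes it
  adjacent to all three. These become hubs, and only \<open>d\<close> and \<open>x\<close> remain to
  be hung on them.\<close>

lemma has_hist_degree_3_hub:
  assumes opt: "optimal \<phi>" and x: "bads \<phi> = {x}" and X: "X = {x, \<alpha>, \<eta>}" "card X = 3"
    and deg: "\<And>v. v \<in> V \<Longrightarrow> card X \<le> card (nbrs v)" and \<alpha>: "card (fib \<phi> \<alpha>) \<ge> 3" and \<eta>: "card (fib \<phi> \<eta>) \<noteq> 2"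
    and n: "card W \<ge> 16"
  shows "has_hist V E"
proof (rule ccontr)
  assume no: "\<not> has_hist V E"
  have xb: "x \<in> bads \<phi>"
    using x by simp
  obtain w where w: "x \<in> X" "fib \<phi> x = {w}" "w \<in> W" "\<phi> w = x"
    using xb by (rule badsE)
  have ne: "x \<noteq> \<alpha>" "x \<noteq> \<eta>" "\<alpha> \<noteq> \<eta>"
    using X by (auto simp: card_insert_if split: if_splits)
  have inX: "\<alpha> \<in> X" "\<eta> \<in> X"
    using X(1) by auto
  have "\<eta> \<notin> bads \<phi>"
    using x ne by simp
  then have \<eta>1: "card (fib \<phi> \<eta>) \<noteq> 1"
    using inX(2) by (simp add: bads_def)
  have y: "E y \<alpha> \<and> E y \<eta> \<and> E y w" if y: "y \<in> W - {w}" for y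
  proof -
    have yw: "y \<in> W" "y \<noteq> w"
      using y by auto
    have big: "card (fib \<phi> (\<phi> v)) \<ge> 3" if v: "v \<in> W" "v \<noteq> w" for v
    proof -
      have vf: "v \<in> fib \<phi> (\<phi> v)" "\<phi> v \<in> X"
        using W_members[OF v(1) optimal_pure[OF opt]] by auto
      then have "card (fib \<phi> (\<phi> v)) \<noteq> 0"
        using finite_fib by auto
      moreover have "\<phi> v \<noteq> x"
        using vf(1) w(2) v(2) by auto
      then have "\<phi> v = \<alpha> \<or> \<phi> v = \<eta>"
        using vf(2) X(1) by auto
      ultimately show ?thesis
        using \<alpha> \<eta> \<eta>1 by auto
    qed
    have "card X \<noteq> 2"
      using X(2) by simp
    note free = free_adjacent[OF opt x w(2) _ _ big \<open>card X \<noteq> 2\<close> no]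
    have "nbrs y \<subseteq> {\<alpha>, \<eta>, w}"
    proof
      fix v assume "v \<in> nbrs y"
      then have v: "E y v"
        by simp
      have "v \<noteq> d" "v \<noteq> x"
        using v W_not_adj(1)[OF yw(1)] free(3)[OF yw yw] by blast+
      moreover have "v = w" if "v \<in> W"
        using free(2)[OF yw yw that] free(1)[of v] that v by blast
      ultimately show "v \<in> {\<alpha>, \<eta>, w}"
        using nbr_cases[OF v] X(1) by blast
    qed
    moreover have "y \<in> V"
      using yw(1) V_iff by blast
    ultimately show ?thesis
      using deg[of y] X(2) by (intro nbrs_three) auto
  qed
  have inV: "\<alpha> \<in> V" "\<eta> \<in> V" "w \<in> V" "x \<in> V"
    using inX w V_iff by blast+
  have wne: "w \<noteq> \<alpha>" "w \<noteq> \<eta>" "w \<noteq> x" "d \<noteq> x" "d \<noteq> \<alpha>" "d \<noteq> \<eta>" "d \<noteq> w"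
    using inX w X_W d_X d_W by blast+
  have L: "v \<in> V - {\<alpha>, \<eta>, w} - (W - {w}) \<longleftrightarrow> v = d \<or> v = x" for v
    using V_iff[of v] X(1) w(3) wne ne inV d_W X_W by auto
  have "has_hist V E"
  proof (rule has_hist_three_hubs[of \<alpha> \<eta> w "W - {w}" _ "\<lambda>v. if v = d then \<alpha> else w", OF inV(1-3) ne(3) _ _ _ _ _ refl])
    show "W - {w} \<subseteq> V - {\<alpha>, \<eta>, w}"
      using inX X_W V_iff by auto
    show "card (W - {w}) \<ge> 7"
      using n w(3) finite_W by simp
    show "E v \<alpha> \<and> E v \<eta> \<and> E v w" if "v \<in> W - {w}" for v
      using y[OF that] .
    have "E x w"
      using optimal_pure[OF opt] w sym by (auto simp: pure_def)
    then show "E v (if v = d then \<alpha> else w) \<and> ((if v = d then \<alpha> else w) \<in> {\<alpha>, \<eta>, w} \<or>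
        (if v = d then \<alpha> else w) \<in> V - {\<alpha>, \<eta>, w} - (W - {w}) \<and>
        (if (if v = d then \<alpha> else w) = d then \<alpha> else w) \<in> {\<alpha>, \<eta>, w})" if "v \<in> V - {\<alpha>, \<eta>, w} - (W - {w})" for v
      using that[unfolded L] inX(1) X_adj by auto
    show "card {v \<in> V - {\<alpha>, \<eta>, w} - (W - {w}). (if v = d then \<alpha> else w) = u} \<noteq> 1"
      if "u \<in> V - {\<alpha>, \<eta>, w} - (W - {w})" for u
    proof -
      have "(if v = d then \<alpha> else w) \<noteq> u" for v
        using that by auto
      then show ?thesis
        by (intro card_fiber_none)
    qed
  qed (use wne in simp_all)
  then show False
    using no by contradiction
qed

text \<open>The hubs are \<open>\<alpha>\<close>, \<open>w\<close> and \<open>c\<close>. The rest is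
  placed by \<open>g\<close>: \<open>d\<close> and \<open>z\<close> go below \<open>\<eta>\<close>,
  which thus has two children, \<open>\<eta>\<close> below \<open>c\<close>, \<open>x\<close> below
  \<open>w\<close>, and the remaining members of the fibre below \<open>\<alpha>\<close>. The vertex
  \<open>d\<close>, otherwise the root, is a leaf in this tree.\<close>

lemma has_hist_degree_3_fan:
  assumes X: "X = {x, \<alpha>, \<eta>}" "card X = 3" and \<phi>: "pure \<phi>" "fib \<phi> x = {w}" "fib \<phi> \<eta> = {c, z}" "c \<noteq> z"
    and c: "card {y \<in> fib \<phi> \<alpha>. E y c} \<ge> 7" and w: "\<And>y. y \<in> fib \<phi> \<alpha> \<Longrightarrow> E w y"
  shows "has_hist V E"
proof -
  have ne: "x \<noteq> \<alpha>" "x \<noteq> \<eta>" "\<alpha> \<noteq> \<eta>"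
    using X by (auto simp: card_insert_if split: if_splits)
  have inX: "\<alpha> \<in> X" "\<eta> \<in> X" "x \<in> X"
    using X(1) by auto
  have inW: "w \<in> W" "\<phi> w = x" "c \<in> W" "\<phi> c = \<eta>" "z \<in> W" "\<phi> z = \<eta>"
    using \<phi>(2,3) fib_W[of _ \<phi> x] fib_W[of _ \<phi> \<eta>] by auto
  have inV: "\<alpha> \<in> V" "w \<in> V" "c \<in> V"
    using inX inW V_iff by blast+
  have d: "d \<noteq> \<alpha>" "d \<noteq> \<eta>" "d \<noteq> x" "d \<noteq> w" "d \<noteq> c" "d \<noteq> z"
    using inX inW d_X d_W by blast+
  have XW: "\<alpha> \<noteq> w" "\<alpha> \<noteq> c" "\<alpha> \<noteq> z" "\<eta> \<noteq> w" "\<eta> \<noteq> c" "\<eta> \<noteq> z" "x \<noteq> w" "x \<noteq> c" "x \<noteq> z" "w \<noteq> c" "w \<noteq> z"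
    using inX inW X_W ne by auto
  have adj: "E v (\<phi> v)" if "v \<in> W" for v
    using \<phi>(1) that by (simp add: pure_def)
  define M where "M = {y \<in> fib \<phi> \<alpha>. E y c}"
  define g where "g v = (if v = d \<or> v = z then \<eta> else if v = \<eta> then c else if v = x then w else \<alpha>)" for v
  define L where "L = V - {\<alpha>, w, c} - M"
  have M: "v \<in> W \<and> \<phi> v = \<alpha>" if "v \<in> M" for v
    using that by (auto simp: M_def fib_W)
  have notM: "w \<notin> M" "c \<notin> M" "z \<notin> M" "d \<notin> M" "x \<notin> M" "\<alpha> \<notin> M" "\<eta> \<notin> M"
    using M inW ne d_W X_W inX by auto
  have \<eta>L: "\<eta> \<in> L" "d \<in> L" "z \<in> L"
    using notM inX inW V_iff d ne XW \<phi>(4) by (auto simp: L_def)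
  have gL: "g v = \<eta> \<or> g v \<in> {\<alpha>, w, c}" for v
    by (auto simp: g_def)
  show ?thesis
  proof (rule has_hist_three_hubs[of \<alpha> w c M L g, OF inV XW(1,2,10) _ _ _ L_def])
    show "M \<subseteq> V - {\<alpha>, w, c}"
      using M notM V_iff by auto
    show "card M \<ge> 7"
      using c by (simp add: M_def)
    show "E v \<alpha> \<and> E v w \<and> E v c" if "v \<in> M" for v
      using that adj[of v] M[OF that] w sym by (auto simp: M_def)
    show "E v (g v) \<and> (g v \<in> {\<alpha>, w, c} \<or> g v \<in> L \<and> g (g v) \<in> {\<alpha>, w, c})" if v: "v \<in> L" for v
    proof -
      have "g \<eta> = c"
        using ne d XW by (simp add: g_def)
      then have 2: "g v \<in> {\<alpha>, w, c} \<or> g v \<in> L \<and> g (g v) \<in> {\<alpha>, w, c}"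
        using gL[of v] \<eta>L(1) by auto
      have "E v (g v)"
      proof -
        have "v \<in> V" "v \<noteq> \<alpha>" "v \<noteq> w" "v \<noteq> c"
          using v by (auto simp: L_def)
        then consider "v = d" | "v = z" | "v = \<eta>" | "v = x" | "v \<in> W" "v \<noteq> w" "v \<noteq> c" "v \<noteq> z"
          using V_iff[of v] X(1) by auto
        then show ?thesis
        proof cases
          case 1
          then show ?thesis
            using inX(2) X_adj by (simp add: g_def)
        next
          case 2
          then show ?thesis
            using adj[OF inW(5)] inW(6) by (simp add: g_def)
        next
          case 3
          then show ?thesis
            using \<open>g \<eta> = c\<close> sym[OF adj[OF inW(3)]] inW(4) by simp
        next
          case 4
          then show ?thesis
            using sym[OF adj[OF inW(1)]] inW(2) ne d XW by (simp add: g_def)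
        next
          case 5
          have "v \<in> fib \<phi> (\<phi> v)" "\<phi> v \<in> X"
            using W_members[OF 5(1) \<phi>(1)] by auto
          then have "\<phi> v = \<alpha>"
            using X(1) \<phi>(2,3) 5 by auto
          moreover have "v \<noteq> d" "v \<noteq> \<eta>" "v \<noteq> x"
            using 5(1) d_W X_W inX by blast+
          ultimately show ?thesis
            using adj[OF 5(1)] 5(4) by (simp add: g_def)
        qed
      qed
      then show ?thesis
        using 2 by blast
    qed
    show "card {v \<in> L. g v = u} \<noteq> 1" if u: "u \<in> L" for u
    proof (cases "u = \<eta>")
      case True
      have "finite {v \<in> L. g v = u}"
        using finite_V by (simp add: L_def)
      moreover have "d \<in> {v \<in> L. g v = u}" "z \<in> {v \<in> L. g v = u}"
        using True \<eta>L by (auto simp: g_def)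
      ultimately show ?thesis
        using d(6) by (intro card_ge2)
    next
      case False
      have "g v \<noteq> u" for v
        using gL[of v] False u by (auto simp: L_def)
      then show ?thesis
        by (intro card_fiber_none)
    qed
  qed
qed

text \<open>Unless \<open>has_hist_degree_3_hub\<close> applies, the fibre of \<open>\<eta>\<close>
  is a pair \<open>c\<close>, \<open>z\<close>, and every member of the large fibre \<open>F\<close>
  has its neighbours among \<open>\<alpha>\<close>, \<open>w\<close>, \<open>c\<close>,
  \<open>z\<close>. The minimum degree makes it adjacent to \<open>c\<close> or \<open>z\<close>,
  and as \<open>F\<close> has at least 13 members, 7 of them share one of the two, as the fan
  requires.\<close>

lemma has_hist_degree_3_one_bad:
  assumes opt: "optimal \<phi>" and x: "bads \<phi> = {x}" and X3: "card X = 3"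
    and deg: "\<And>v. v \<in> V \<Longrightarrow> card X \<le> card (nbrs v)" and \<alpha>: "\<alpha> \<in> X" "card (fib \<phi> \<alpha>) \<ge> 3" and n: "card W \<ge> 16"
  shows "has_hist V E"
proof (rule ccontr)
  assume no: "\<not> has_hist V E"
  have xb: "x \<in> bads \<phi>"
    using x by simp
  obtain w where w: "x \<in> X" "fib \<phi> x = {w}" "w \<in> W" "\<phi> w = x"
    using xb by (rule badsE)
  have "\<alpha> \<noteq> x"
    using \<alpha>(2) w(2) by auto
  then have "card (X - {x, \<alpha>}) = 1"
    using X3 w(1) \<alpha>(1) finite_X by (simp add: card_Diff_subset)
  then obtain \<eta> where \<eta>: "X - {x, \<alpha>} = {\<eta>}"
    by (auto simp: card_1_singleton_iff)
  then have X: "X = {x, \<alpha>, \<eta>}"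
    using w(1) \<alpha>(1) by blast
  have ne: "x \<noteq> \<alpha>" "x \<noteq> \<eta>" "\<alpha> \<noteq> \<eta>" "\<eta> \<in> X"
    using \<eta> \<open>\<alpha> \<noteq> x\<close> by blast+
  have "card (fib \<phi> \<eta>) = 2"
    using has_hist_degree_3_hub[OF opt x X X3 deg \<alpha>(2) _ n] no by blast
  then obtain c z where cz: "fib \<phi> \<eta> = {c, z}" "c \<noteq> z"
    by (auto simp: card_2_iff)
  have czW: "c \<in> W" "\<phi> c = \<eta>" "z \<in> W" "\<phi> z = \<eta>"
    using cz(1) fib_W[of _ \<phi> \<eta>] by auto
  define F where "F = fib \<phi> \<alpha>"
  have W_cases: "v = w \<or> v = c \<or> v = z \<or> v \<in> F" if "v \<in> W" for v
  proof -
    have "v \<in> fib \<phi> (\<phi> v)" "\<phi> v = x \<or> \<phi> v = \<alpha> \<or> \<phi> v = \<eta>"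
      using W_members[OF that optimal_pure[OF opt]] X by auto
    then show ?thesis
      using w(2) cz(1) F_def by auto
  qed
  have finF: "finite F"
    unfolding F_def by (rule finite_fib)
  have cF: "card F \<ge> 13"
  proof -
    have "card W \<le> card ({w, c, z} \<union> F)"
      using W_cases finF by (intro card_mono) auto
    also have "\<dots> \<le> card {w, c, z} + card F"
      by (rule card_Un_le)
    also have "card {w, c, z} \<le> 3"
      by (simp add: card_insert_if)
    finally show ?thesis
      using n by simp
  qed
  have F: "f \<in> W" "\<phi> f = \<alpha>" "f \<noteq> w" "E w f" "\<not> E f x" "\<And>t. t \<in> W \<Longrightarrow> E w t \<Longrightarrow> \<not> E f t" if f: "f \<in> F" for f
  proof -
    show fW: "f \<in> W" "\<phi> f = \<alpha>"
      using f by (auto simp: F_def fib_W)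
    then show fw: "f \<noteq> w"
      using w ne by auto
    have three: "card (fib \<phi> (\<phi> f)) \<ge> 3" and "card X \<noteq> 2"
      using fW \<alpha>(2) X3 by auto
    note free = free_adjacent[OF opt x w(2) fW(1) fw three \<open>card X \<noteq> 2\<close> no]
    show "E w f" "\<not> E f x" "\<And>t. t \<in> W \<Longrightarrow> E w t \<Longrightarrow> \<not> E f t"
      using free by blast+
  qed
  \<comment> \<open>Moving \<open>f\<close> to \<open>\<eta>\<close> would keep the assignment
    optimal and give \<open>\<eta>\<close> three children, so that
    \<open>has_hist_degree_3_hub\<close> applies to the new assignment.\<close>
  have F\<eta>: "\<not> E f \<eta>" if f: "f \<in> F" for f
  proof
    assume fe: "E f \<eta>"
    let ?\<psi> = "\<phi>(f := \<eta>)"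
    note upd = fib_upd[OF F(1)[OF f], of \<phi> \<eta>]
    have nf: "f \<noteq> c" "f \<noteq> z" "f \<noteq> w"
      using F(2,3)[OF f] czW ne by auto
    have fs: "fib ?\<psi> x = {w}" "fib ?\<psi> \<eta> = {f, c, z}" "fib ?\<psi> \<alpha> = F - {f}"
      unfolding upd using ne w(2) cz(1) nf F_def by auto
    have c3: "card (fib ?\<psi> \<eta>) = 3" "card (fib ?\<psi> \<alpha>) \<ge> 3"
      unfolding fs using nf cz(2) cF f finF by simp_all
    have "v \<in> bads ?\<psi> \<longleftrightarrow> v = x" for v
    proof -
      have "v \<in> X \<longleftrightarrow> v = x \<or> v = \<alpha> \<or> v = \<eta>"
        unfolding X by simp
      then show ?thesis
        using c3 fs(1) ne by (auto simp: bads_def)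
    qed
    then have b: "bads ?\<psi> = {x}"
      by blast
    have "pure ?\<psi>"
      by (rule pure_upd[OF optimal_pure[OF opt] ne(4) fe])
    then have "optimal ?\<psi>"
      using opt b x by (simp add: optimal_def)
    then show False
      using has_hist_degree_3_hub[OF _ b X X3 deg c3(2) _ n] c3(1) no by simp
  qed
  have F_nbrs: "nbrs f \<subseteq> {\<alpha>, w, c, z}" if f: "f \<in> F" for f
  proof
    fix v assume "v \<in> nbrs f"
    then have v: "E f v"
      by simp
    have "v \<notin> F"
      using F(6)[OF f, of v] F(1,4)[of v] v by blast
    moreover have "v \<noteq> d" "v \<noteq> x" "v \<noteq> \<eta>"
      using v W_not_adj(1)[OF F(1)[OF f]] F(5)[OF f] F\<eta>[OF f] by blast+
    ultimately show "v \<in> {\<alpha>, w, c, z}"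
      using nbr_cases[OF v] W_cases[of v] X by blast
  qed
  have one: "E f c \<or> E f z" if f: "f \<in> F" for f
  proof (rule ccontr)
    assume "\<not> ?thesis"
    then have "nbrs f \<subseteq> {\<alpha>, w}"
      using F_nbrs[OF f] by blast
    then have "card (nbrs f) \<le> card {\<alpha>, w}"
      by (intro card_mono) auto
    also have "\<dots> \<le> 2"
      by (simp add: card_insert_if)
    finally show False
      using deg[of f] X3 F(1)[OF f] V_iff by simp
  qed
  define Fc where "Fc = {y \<in> F. E y c}"
  define Fz where "Fz = {y \<in> F. E y z}"
  have "F = Fc \<union> Fz"
    using one by (auto simp: Fc_def Fz_def)
  then have "card F \<le> card Fc + card Fz"
    using card_Un_le[of Fc Fz] by simp
  then have "card Fc \<ge> 7 \<or> card Fz \<ge> 7"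
    using cF by linarith
  moreover have "fib \<phi> \<eta> = {z, c}"
    using cz(1) by auto
  ultimately have "has_hist V E"
    using has_hist_degree_3_fan[OF X X3 optimal_pure[OF opt] w(2) cz]
      has_hist_degree_3_fan[OF X X3 optimal_pure[OF opt] w(2) _ cz(2)[symmetric]] F(4)
    unfolding Fc_def Fz_def F_def by blast
  then show False
    using no by blast
qed

lemma has_hist_degree_3:
  assumes "\<And>v. v \<in> V \<Longrightarrow> card X \<le> card (nbrs v)" "card X = 3" "card V \<ge> 20"
  shows "has_hist V E"
proof -
  obtain \<phi> where opt: "optimal \<phi>"
    using optimal_exists by blast
  have n: "card W \<ge> 16"
    using card_W assms(2,3) by simp
  obtain \<alpha> where \<alpha>: "\<alpha> \<in> X" "card (fib \<phi> \<alpha>) \<ge> 3"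
  proof -
    have "card W > 2 * card X"
      using n assms(2) by simp
    then show thesis
      using big_fiber[OF optimal_pure[OF opt]] that by blast
  qed
  have "\<alpha> \<notin> bads \<phi>"
    using \<alpha>(2) by (simp add: bads_def)
  then have "bads \<phi> \<subseteq> X - {\<alpha>}"
    using bads_X by blast
  then have "card (bads \<phi>) \<le> 2"
    using card_mono[of "X - {\<alpha>}" "bads \<phi>"] finite_X \<alpha>(1) assms(2) by simp
  then consider "card (bads \<phi>) = 0" | "card (bads \<phi>) = 1" | "card (bads \<phi>) = 2"
    by linarith
  then show ?thesis
  proof cases
    case 1
    then show ?thesis
      using has_hist_links[OF opt] assms(2) finite_bads by simp
  next
    case 2
    then obtain x where "bads \<phi> = {x}"
      by (auto simp: card_1_singleton_iff)
    then show ?thesis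
      using has_hist_degree_3_one_bad[OF opt _ assms(2,1) \<alpha> n] by blast
  next
    case 3
    then obtain x1 x2 where "bads \<phi> = {x1, x2}" "x1 \<noteq> x2"
      by (auto simp: card_2_iff)
    then show ?thesis
      using has_hist_degree_3_two_bads[OF opt _ _ assms(2,1) \<alpha> n] by blast
  qed
qed

end

section \<open>The cases of the minimum degree\<close>

theorem (in diam2_graph) has_hist_large:
  assumes n: "card V \<ge> 20" and "\<not> starved V E" "\<not> triangled V E"
  shows "has_hist V E"
proof -
  have "V \<noteq> {}"
    using n by auto
  then obtain d where d: "d \<in> V" "\<And>v. v \<in> V \<Longrightarrow> card (nbrs d) \<le> card (nbrs v)"
    using ex_has_least_nat[of "\<lambda>v. v \<in> V" _ "\<lambda>v. card (nbrs v)"] by blast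
  interpret rooted_graph V E d
    by unfold_locales (rule d(1))
  have X: "X = nbrs d"
    by (rule X_def)
  consider "card X = 0" | "card X = 1" | "card X = 2" | "card X = 3" | "card X = 4" | "card X \<ge> 5"
    by linarith
  then show ?thesis
  proof cases
    case 1
    then have "nbrs d = {}"
      using finite_X X by simp
    then have "V \<subseteq> {d}"
      using diam[OF d(1)] by blast
    then have "card V \<le> card {d}"
      by (intro card_mono) auto
    then show ?thesis
      using n by simp
  next
    case 2
    then obtain v where v: "nbrs d = {v}"
      using X by (auto simp: card_1_singleton_iff)
    then have dv: "E d v"
      by blast
    \<comment> \<open>Every path from \<open>d\<close> starts with the only neighbour
      \<open>v\<close>, so by the diameter condition \<open>v\<close> is adjacent to all other
      vertices.\<close>
    show ?thesis
    proof (rule has_hist_dominating)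
      show "v \<in> V"
        using dv wf' by blast
      show "E u v" if "u \<in> V" "u \<noteq> v" for u
      proof (cases "u = d")
        case False
        have only: "x = v" if "E d x" for x
          using that v by blast
        then show ?thesis
          using diam[OF d(1) that(1)] False that(2) sym by metis
      qed (use dv in simp)
    qed (use n in simp)
  next
    case 3
    then obtain x y where "nbrs d = {x, y}" "x \<noteq> y"
      using X by (auto simp: card_2_iff)
    then show ?thesis
      using has_hist_degree_two[OF d(1)] n assms(2,3) by simp
  next
    case 4
    then show ?thesis
      using has_hist_degree_3 d(2) n X by simp
  next
    case 5
    then show ?thesis
      using has_hist_degree_4 d(2) n X by simp
  next
    case 6
    then show ?thesis
      using has_hist_degree_ge_5 d(2) X by simp
  qed
qed

section \<open>Spanning trees as parent functions\<close>

lemma pair_graph_sym: "pair_graph G \<Longrightarrow> (u, v) \<in> parcs G \<Longrightarrow> (v, u) \<in> parcs G"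
  by (metis pair_graph.axioms(2) pair_pseudo_graph.axioms(2) pair_sym_digraph.arcs_symmetric)

lemma pair_graph_wf: "pair_graph G \<Longrightarrow> (u, v) \<in> parcs G \<Longrightarrow> u \<in> pverts G \<and> v \<in> pverts G"
  by (meson pair_fin_digraph.axioms(1) pair_graph.axioms(2) pair_pseudo_graph.axioms(1)
      pair_wf_digraph.in_arcsD1 pair_wf_digraph.in_arcsD2)

lemma pair_graph_irrefl: "pair_graph G \<Longrightarrow> (u, u) \<notin> parcs G"
  by (metis fst_conv snd_conv pair_digraph.axioms(2) pair_graph.axioms(1) pair_loopfree_digraph.pair_no_loops)

lemma pair_graph_finite: "pair_graph G \<Longrightarrow> finite (pverts G)"
  by (meson pair_graph.axioms(2) pair_pseudo_graph.axioms(1) pair_fin_digraph.pair_finite_verts)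

lemma pair_graphI:
  assumes "finite (pverts G)" "\<And>u v. (u, v) \<in> parcs G \<Longrightarrow> u \<in> pverts G \<and> v \<in> pverts G \<and> u \<noteq> v \<and> (v, u) \<in> parcs G"
  shows "pair_graph G"
proof -
  have "parcs G \<subseteq> pverts G \<times> pverts G"
    using assms(2) by auto
  then have "finite (parcs G)"
    using assms(1) finite_subset by blast
  then show ?thesis
    using assms by unfold_locales (auto simp: symmetric_def intro: symI)
qed

lemma with_proj_wf: "pair_graph G \<Longrightarrow> wf_digraph (with_proj G)"
  by (meson pair_graph.axioms(2) pair_pseudo_graph.axioms(1) pair_fin_digraph.axioms(1) wf_digraph_wp_iff)

text \<open>Connectedness is defined as strong connectedness of the symmetric closure, and a pair
  graph is its own symmetric closure.\<close>

lemma connected_pair_graph_iff: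
  assumes "pair_graph G"
  shows "Digraph_Component.connected (with_proj G) \<longleftrightarrow>
    pverts G \<noteq> {} \<and> (\<forall>u\<in>pverts G. \<forall>v\<in>pverts G. (u, v) \<in> (parcs G)\<^sup>*)"
proof -
  have "mk_symmetric (with_proj G) = G"
    using pair_graph_sym[OF assms] unfolding mk_symmetric_def by (intro pair_pre_digraph.equality) force+
  moreover have "u \<rightarrow>\<^sup>*\<^bsub>with_proj G\<^esub> v \<longleftrightarrow> (u, v) \<in> (parcs G)\<^sup>*" if "u \<in> pverts G" "v \<in> pverts G" for u v
  proof -
    interpret wf_digraph "with_proj G"
      using assms by (rule with_proj_wf)
    show ?thesis
      using that by (auto simp: reachable_conv)
  qed
  ultimately show ?thesis
    unfolding Digraph_Component.connected_def strongly_connected_def by auto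
qed

lemma out_degree_with_proj: "out_degree (with_proj G) v = card {w. (v, w) \<in> parcs G}"
proof -
  have "{e \<in> parcs G. fst e = v} = Pair v ` {w. (v, w) \<in> parcs G}"
    by force
  moreover have "card (Pair v ` {w. (v, w) \<in> parcs G}) = card {w. (v, w) \<in> parcs G}"
    by (rule card_image) (auto simp: inj_on_def)
  ultimately show ?thesis
    by (simp add: out_degree_def out_arcs_def)
qed

text \<open>Depends on the arc set alone, with the start vertex explicit, so that cycles can be
  carried along vertex maps. The length bound excludes running back and forth on one edge.\<close>

definition graph_cycle :: "'a rel \<Rightarrow> 'a \<Rightarrow> ('a \<times> 'a) list \<Rightarrow> bool" where
  "graph_cycle R u p \<longleftrightarrow> set p \<subseteq> R \<and> pcas u p u \<and> distinct (tl (pawalk_verts u p)) \<and> length p \<ge> 3"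

lemma HIST_iff:
  assumes "pair_graph G"
  shows "HIST T G \<longleftrightarrow> pair_graph T \<and> pverts T = pverts G \<and> parcs T \<subseteq> parcs G \<and> pverts T \<noteq> {} \<and>
    (\<forall>u\<in>pverts T. \<forall>v\<in>pverts T. (u, v) \<in> (parcs T)\<^sup>*) \<and> (\<nexists>u p. graph_cycle (parcs T) u p) \<and>
    (\<forall>v\<in>pverts T. card {w. (v, w) \<in> parcs T} \<noteq> 2)"
proof (cases "pair_graph T")
  case True
  have "pre_digraph.cycle (with_proj T) p \<and> length p \<ge> 3 \<longleftrightarrow> (\<exists>u. graph_cycle (parcs T) u p)" for p
  proof -
    have "u \<in> pverts T" if "set p \<subseteq> parcs T" "pcas u p u" "length p \<ge> 3" for u
      using that pair_graph_wf[OF True] by (cases p) auto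
    then have "(\<exists>u. (u \<in> pverts T \<and> set p \<subseteq> parcs T \<and> pcas u p u) \<and> distinct (tl (pawalk_verts u p)) \<and> p \<noteq> []) \<and>
        length p \<ge> 3 \<longleftrightarrow> (\<exists>u. graph_cycle (parcs T) u p)"
      unfolding graph_cycle_def by (cases p) (simp_all, blast)
    then show ?thesis
      unfolding pre_digraph.cycle_def pre_digraph.awalk_def cas_with_proj_eq awalk_verts_with_proj_eq by simp
  qed
  moreover have "spanning (with_proj T) (with_proj G) \<longleftrightarrow> pverts T = pverts G \<and> parcs T \<subseteq> parcs G"
    using with_proj_wf[OF True] with_proj_wf[OF assms]
    by (auto simp: spanning_def subgraph_def compatible_def)
  ultimately show ?thesis
    using True connected_pair_graph_iff[OF True]
    unfolding HIST_def undirected_tree_def out_degree_with_proj by blast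
qed (simp add: HIST_def undirected_tree_def)

lemma
  assumes "pair_graph G" "HIST T G"
  shows HIST_pair_graph: "pair_graph T" and HIST_pverts: "pverts T = pverts G"
    and HIST_parcs: "parcs T \<subseteq> parcs G" and HIST_nonempty: "pverts G \<noteq> {}"
    and HIST_connected: "u \<in> pverts G \<Longrightarrow> v \<in> pverts G \<Longrightarrow> (u, v) \<in> (parcs T)\<^sup>*"
    and HIST_acyclic: "\<not> graph_cycle (parcs T) w p"
    and HIST_degree: "v \<in> pverts G \<Longrightarrow> card {w. (v, w) \<in> parcs T} \<noteq> 2"
  using assms(2) unfolding HIST_iff[OF assms(1)] by (elim conjE; (simp | blast))+

lemma length_pawalk_verts: "length (pawalk_verts u p) = Suc (length p)"
  by (induction p arbitrary: u) auto

lemma pcas_nth: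
  "pcas u p v \<Longrightarrow> i < length p \<Longrightarrow> p ! i = (pawalk_verts u p ! i, pawalk_verts u p ! Suc i)"
proof (induction p arbitrary: u i)
  case (Cons e p)
  have "pawalk_verts w p ! 0 = w" if "pcas w p v" for w
    using that by (cases p) auto
  then show ?case
    using Cons by (cases i) auto
qed simp

lemma pcas_ends: "pcas u p v \<Longrightarrow> pawalk_verts u p ! 0 = u \<and> pawalk_verts u p ! length p = v"
  by (induction p arbitrary: u) auto

text \<open>\<open>rank\<close> is the number of parent steps to the root. On a cycle, a vertex of
  maximal rank has its parent as cyclic neighbour on both sides, although these two neighbours are
  distinct. The degree conditions agree because every vertex except the root has its parent as one
  more neighbour.\<close>

lemma has_hist_imp_HIST:
  assumes G: "pair_graph G" and "has_hist (pverts G) (\<lambda>u v. (u, v) \<in> parcs G)"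
  shows "\<exists>T. HIST T G"
proof -
  let ?V = "pverts G"
  obtain r par where r: "r \<in> ?V" "par r = r" and par: "\<And>v. v \<in> ?V \<Longrightarrow> v \<noteq> r \<Longrightarrow> par v \<in> ?V \<and> (v, par v) \<in> parcs G"
    and reach: "\<And>v. v \<in> ?V \<Longrightarrow> \<exists>k. (par ^^ k) v = r"
    and deg_r: "card {v \<in> ?V - {r}. par v = r} \<noteq> 2"
    and deg: "\<And>u. u \<in> ?V \<Longrightarrow> u \<noteq> r \<Longrightarrow> card {v \<in> ?V - {r}. par v = u} \<noteq> 1"
    using assms(2) unfolding has_hist_def by (elim exE conjE) blast
  define rank where "rank v = (LEAST k. (par ^^ k) v = r)" for v
  have rank: "rank (par v) < rank v" if v: "v \<in> ?V" "v \<noteq> r" for v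
  proof -
    have 1: "(par ^^ rank v) v = r"
      unfolding rank_def using reach[OF v(1)] by (rule LeastI_ex)
    then obtain k where k: "rank v = Suc k"
      using v(2) by (cases "rank v") auto
    then have "(par ^^ k) (par v) = r"
      using 1 by (simp add: funpow_swap1)
    then have "rank (par v) \<le> k"
      unfolding rank_def by (rule Least_le)
    then show ?thesis
      using k by simp
  qed
  define C where "C = {(v, par v) |v. v \<in> ?V - {r}}"
  define T where "T = \<lparr>pverts = ?V, parcs = C \<union> C\<inverse>\<rparr>"
  have T: "pverts T = ?V" "parcs T = C \<union> C\<inverse>"
    by (auto simp: T_def)
  have CG: "C \<subseteq> parcs G"
    using par by (auto simp: C_def)
  have TG: "parcs T \<subseteq> parcs G"
    using CG pair_graph_sym[OF G] by (auto simp: T)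
  have pgT: "pair_graph T"
  proof (rule pair_graphI)
    show "finite (pverts T)"
      using pair_graph_finite[OF G] by (simp add: T)
    fix u v assume uv: "(u, v) \<in> parcs T"
    then have "(u, v) \<in> parcs G"
      using TG by blast
    then show "u \<in> pverts T \<and> v \<in> pverts T \<and> u \<noteq> v \<and> (v, u) \<in> parcs T"
      using uv pair_graph_wf[OF G] pair_graph_irrefl[OF G] by (auto simp: T)
  qed
  have to_r: "(v, r) \<in> (parcs T)\<^sup>* \<and> (r, v) \<in> (parcs T)\<^sup>*" if "v \<in> ?V" for v
    using that
  proof (induction "rank v" arbitrary: v rule: less_induct)
    case less
    show ?case
    proof (cases "v = r")
      case False
      then have "(par v, r) \<in> (parcs T)\<^sup>* \<and> (r, par v) \<in> (parcs T)\<^sup>*"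
        using less par rank by blast
      moreover have "(v, par v) \<in> parcs T" "(par v, v) \<in> parcs T"
        using less.prems False by (auto simp: T C_def)
      ultimately show ?thesis
        by (meson converse_rtrancl_into_rtrancl rtrancl_into_rtrancl)
    qed simp
  qed
  have up: "w = par v \<and> v \<noteq> r" if "(v, w) \<in> parcs T" "rank w \<le> rank v" for v w
    using that rank[of w] by (auto simp: T C_def)
  have "\<not> graph_cycle (parcs T) u p" for u p
  proof
    assume "graph_cycle (parcs T) u p"
    then have p: "set p \<subseteq> parcs T" "pcas u p u" "distinct (tl (pawalk_verts u p))" "length p \<ge> 3"
      by (auto simp: graph_cycle_def)
    define m where "m = length p"
    define vs where "vs = pawalk_verts u p"
    have vs: "vs ! 0 = u" "vs ! m = u" "length vs = Suc m"
      using pcas_ends[OF p(2)] length_pawalk_verts[of u p] by (auto simp: vs_def m_def)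
    have arc: "(vs ! i, vs ! Suc i) \<in> parcs T" if "i < m" for i
      using pcas_nth[OF p(2), of i] that p(1) nth_mem[of i p] by (auto simp: vs_def m_def)
    have inj: "i = j" if "vs ! i = vs ! j" "1 \<le> i" "1 \<le> j" "i \<le> m" "j \<le> m" for i j
    proof -
      have "tl vs ! (i - 1) = tl vs ! (j - 1)"
        using that vs(3) by (simp add: nth_tl)
      then have "i - 1 = j - 1"
        using p(3) that vs(3) by (subst (asm) nth_eq_iff_index_eq) (auto simp: vs_def)
      then show ?thesis
        using that by simp
    qed
    obtain i where i: "i \<in> {1..m}" "\<And>j. j \<in> {1..m} \<Longrightarrow> rank (vs ! j) \<le> rank (vs ! i)"
    proof -
      have "finite ((\<lambda>j. rank (vs ! j)) ` {1..m})" "(\<lambda>j. rank (vs ! j)) ` {1..m} \<noteq> {}"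
        using p(4) by (auto simp: m_def)
      note fin = this
      obtain i where i: "i \<in> {1..m}" "Max ((\<lambda>j. rank (vs ! j)) ` {1..m}) = rank (vs ! i)"
        using Max_in[OF fin] by (elim imageE)
      show ?thesis
        by (rule that[OF i(1)]) (unfold i(2)[symmetric], intro Max_ge[OF fin(1)] imageI)
    qed
    \<comment> \<open>Indices run from 1 to \<open>m\<close>, since position 0 repeats position
      \<open>m\<close>; \<open>a\<close> and \<open>b\<close> are the cyclic predecessor and
      successor of \<open>i\<close>.\<close>
    define a where "a = (if i = 1 then m else i - 1)"
    define b where "b = (if i = m then 1 else i + 1)"
    have ab: "a \<in> {1..m}" "b \<in> {1..m}" "a \<noteq> b"
      using i(1) p(4) by (auto simp: a_def b_def m_def split: if_splits)
    have "(vs ! a, vs ! i) \<in> parcs T"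
      using arc[of "i - 1"] i(1) vs by (auto simp: a_def)
    moreover have "(vs ! i, vs ! b) \<in> parcs T"
      using arc[of i] arc[of 0] i(1) vs by (auto simp: b_def)
    ultimately have "vs ! a = par (vs ! i)" "vs ! b = par (vs ! i)"
      using up i(2) ab pair_graph_sym[OF pgT] by blast+
    then show False
      using inj[of a b] ab by auto
  qed
  moreover have "card {w. (v, w) \<in> parcs T} \<noteq> 2" if v: "v \<in> ?V" for v
  proof (cases "v = r")
    case True
    then have "{w. (v, w) \<in> parcs T} = {v \<in> ?V - {r}. par v = r}"
      by (auto simp: T C_def)
    then show ?thesis
      using deg_r by simp
  next
    case False
    have "par v \<notin> {w \<in> ?V - {r}. par w = v}"
      using rank[of v] rank[of "par v"] v False by auto
    moreover have "{w. (v, w) \<in> parcs T} = insert (par v) {w \<in> ?V - {r}. par w = v}"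
      using v False by (auto simp: T C_def)
    ultimately have "card {w. (v, w) \<in> parcs T} = Suc (card {w \<in> ?V - {r}. par w = v})"
      using pair_graph_finite[OF G] by simp
    then show ?thesis
      using deg[OF v False] by simp
  qed
  moreover have "\<forall>u\<in>pverts T. \<forall>v\<in>pverts T. (u, v) \<in> (parcs T)\<^sup>*"
    using to_r unfolding T(1) by (meson rtrancl_trans)
  ultimately have "HIST T G"
    using pgT TG T(1) r(1) unfolding HIST_iff[OF G] by blast
  then show ?thesis ..
qed

section \<open>Graphs of diameter at most two\<close>

lemma diameter_le_2D:
  assumes G: "pair_graph G" and "graph_diameter G \<le> 2" and uv: "u \<in> pverts G" "v \<in> pverts G"
  shows "u = v \<or> (u, v) \<in> parcs G \<or> (\<exists>w. (u, w) \<in> parcs G \<and> (w, v) \<in> parcs G)"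
proof -
  interpret wf_digraph "with_proj G"
    using G by (rule with_proj_wf)
  have "distance G u v \<le> graph_diameter G"
    unfolding graph_diameter_def using uv by (meson SUP_upper SUP_upper2)
  \<comment> \<open>The distance is an infimum over walks. The strict bound 3 yields an actual walk,
    whose length is at most 2 because it is an integer.\<close>
  then have "\<mu> (\<lambda>_. 1) u v < 3"
    using assms(2) by (auto simp: distance_def intro: le_less_trans[of _ 2])
  then obtain p where p: "awalk u p v" "ereal (awalk_cost (\<lambda>_. 1) p) < 3"
    unfolding \<mu>_def INF_less_iff by auto
  have "awalk_cost (\<lambda>_. 1) p = length p"
    by (induction p) auto
  then have "length p < 3"
    using p(2) by simp
  then consider "p = []" | e where "p = [e]" | e e' where "p = [e, e']"
    by (cases p; cases "tl p"; cases "tl (tl p)"; fastforce)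
  then show ?thesis
    using p(1) by cases (auto simp: awalk_def cas_with_proj_eq)
qed

text \<open>If all tree neighbours of \<open>v\<close> are leaves, no tree path from
  \<open>v\<close> gets further than one step, so the tree is a star.\<close>

lemma HIST_closed_star:
  assumes G: "pair_graph G" and T: "HIST T G" and "v \<in> pverts G" "u \<in> pverts G" "u \<noteq> v"
    and leaf: "\<And>w x. (v, w) \<in> parcs T \<Longrightarrow> (w, x) \<in> parcs T \<Longrightarrow> x = v"
  shows "(v, u) \<in> parcs T"
proof -
  have "(v, u) \<in> (parcs T)\<^sup>*"
    using HIST_connected[OF G T] assms(3,4) by blast
  then have "u = v \<or> (v, u) \<in> parcs T"
    by induction (use leaf in blast)+
  then show ?thesis
    using \<open>u \<noteq> v\<close> by simp
qed

lemma finite_nbrs: "pair_graph G \<Longrightarrow> finite {x. (w, x) \<in> parcs G}"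
  by (rule finite_subset[of _ "pverts G"]) (auto dest: pair_graph_wf pair_graph_finite)

text \<open>The tree degree of \<open>w\<close> is at most 2 and differs from 2, so its known tree
  neighbour is the only one.\<close>

lemma HIST_low_degree_leaf:
  assumes G: "pair_graph G" and T: "HIST T G" and "(w, v) \<in> parcs T" "card {x. (w, x) \<in> parcs G} \<le> 2" "(w, x) \<in> parcs T"
  shows "x = v"
proof (rule ccontr)
  assume "x \<noteq> v"
  have "{x. (w, x) \<in> parcs T} \<subseteq> {x. (w, x) \<in> parcs G}"
    using HIST_parcs[OF G T] by blast
  note sub = this
  have "card {x. (w, x) \<in> parcs T} \<le> 2"
    using assms(4) card_mono[OF finite_nbrs[OF G] sub] by (rule order_trans[rotated])
  moreover have "finite {x. (w, x) \<in> parcs T}"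
    using sub finite_nbrs[OF G] by (rule finite_subset)
  moreover have "card {x. (w, x) \<in> parcs T} \<noteq> 2"
    using HIST_degree[OF G T] HIST_parcs[OF G T] pair_graph_wf[OF G] assms(3) by blast
  moreover have "{v, x} \<subseteq> {x. (w, x) \<in> parcs T}"
    using assms(3,5) by simp
  ultimately have "card {v, x} < 2"
    using card_mono[of "{x. (w, x) \<in> parcs T}" "{v, x}"] by simp
  then show False
    using \<open>x \<noteq> v\<close> by simp
qed

lemma starvedE:
  assumes "starved V E"
  obtains v u where "v \<in> V" "u \<in> V" "u \<noteq> v" "\<not> E v u" "\<forall>w. E v w \<longrightarrow> card {x. E w x} \<le> 2"
  using assms unfolding starved_def by meson

lemma triangledE:
  assumes "triangled V E"
  obtains x y a t b where "x \<in> V" "y \<in> V" "a \<in> V" "t \<in> V" "b \<in> V" "x \<noteq> y" "\<not> E x y"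
    "{z. E a z} = {x, t, b}" "{z. E t z} = {x, a, b}" "{z. E b z} = {y, a, t}"
    "\<forall>u\<in>V - {x, y, a, t, b}. {z. E u z} = {x, y}"
  using assms unfolding triangled_def by meson

section \<open>Obstructed graphs have no HIST\<close>

text \<open>The tree neighbours of \<open>v\<close> have degree at most 2 in the graph and are
  therefore leaves, so the tree would be a star at \<open>v\<close>, which misses
  \<open>u\<close>.\<close>

lemma starved_no_HIST:
  assumes G: "pair_graph G" and "starved (pverts G) (\<lambda>u v. (u, v) \<in> parcs G)"
  shows "\<not> HIST T G"
proof
  assume T: "HIST T G"
  obtain v u where vu: "v \<in> pverts G" "u \<in> pverts G" "u \<noteq> v" "(v, u) \<notin> parcs G"
    and low: "\<forall>w. (v, w) \<in> parcs G \<longrightarrow> card {x. (w, x) \<in> parcs G} \<le> 2"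
    using assms(2) by (rule starvedE)
  note TG = HIST_parcs[OF G T] HIST_pair_graph[OF G T]
  have "(v, u) \<in> parcs T"
  proof (rule HIST_closed_star[OF G T vu(1-3)])
    fix w x assume w: "(v, w) \<in> parcs T" "(w, x) \<in> parcs T"
    show "x = v"
    proof (rule HIST_low_degree_leaf[OF G T _ _ w(2)])
      show "(w, v) \<in> parcs T"
        using TG(2) w(1) by (rule pair_graph_sym)
      show "card {x. (w, x) \<in> parcs G} \<le> 2"
        using low w(1) TG(1) by blast
    qed
  qed
  then show False
    using vu(4) TG by blast
qed

text \<open>The vertices outside the five named ones have degree 2 and are leaves of any HIST. If
  neither \<open>a\<close> nor \<open>t\<close> branches, the tree is a star at \<open>x\<close>,
  which misses \<open>y\<close>. If one of them branches, it uses all three of its edges; the other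
  is then a leaf, as a triangle with \<open>x\<close> would arise otherwise. Now \<open>b\<close>
  cannot have \<open>y\<close> as a tree neighbour, since its tree degree would be 2, so the tree is
  a star at \<open>y\<close>, which misses \<open>x\<close>.\<close>

lemma triangled_no_HIST:
  assumes G: "pair_graph G" and "triangled (pverts G) (\<lambda>u v. (u, v) \<in> parcs G)"
  shows "\<not> HIST T G"
proof
  assume T: "HIST T G"
  obtain x y a t b where V: "x \<in> pverts G" "y \<in> pverts G" "a \<in> pverts G" "t \<in> pverts G" "b \<in> pverts G"
    and xy: "x \<noteq> y" "(x, y) \<notin> parcs G"
    and a: "{z. (a, z) \<in> parcs G} = {x, t, b}" and t: "{z. (t, z) \<in> parcs G} = {x, a, b}"
    and b: "{z. (b, z) \<in> parcs G} = {y, a, t}"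
    and other: "\<forall>u\<in>pverts G - {x, y, a, t, b}. {z. (u, z) \<in> parcs G} = {x, y}"
    using assms(2) by (rule triangledE)
  note TG = HIST_parcs[OF G T] HIST_pair_graph[OF G T] HIST_pverts[OF G T]
  note deg = HIST_degree[OF G T] and acyclic = HIST_acyclic[OF G T]
  note sym = pair_graph_sym[OF TG(2)] pair_graph_sym[OF G]
  have irr: "(v, v) \<notin> parcs G" for v
    using G by (rule pair_graph_irrefl)
  have adj: "(a, z) \<in> parcs G \<longleftrightarrow> z = x \<or> z = t \<or> z = b" "(t, z) \<in> parcs G \<longleftrightarrow> z = x \<or> z = a \<or> z = b"
      "(b, z) \<in> parcs G \<longleftrightarrow> z = y \<or> z = a \<or> z = t" for z
    using arg_cong[OF a, of "\<lambda>S. z \<in> S"] arg_cong[OF t, of "\<lambda>S. z \<in> S"] arg_cong[OF b, of "\<lambda>S. z \<in> S"]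
    by simp_all
  have distinct: "a \<noteq> x" "a \<noteq> t" "a \<noteq> b" "t \<noteq> x" "t \<noteq> b" "b \<noteq> y"
    using adj(1)[of a] adj(2)[of t] adj(3)[of b] irr[of a] irr[of t] irr[of b] by simp_all
  have bx: "b \<noteq> x" "a \<noteq> y" "t \<noteq> y"
    using adj(3)[of y] adj(1)[of x] adj(2)[of x] xy sym(2)[of y x] by auto
  have aN: "{z. (a, z) \<in> parcs T} \<subseteq> {x, t, b}" and tN: "{z. (t, z) \<in> parcs T} \<subseteq> {x, a, b}"
    and bN: "{z. (b, z) \<in> parcs T} \<subseteq> {y, a, t}"
    using TG(1) unfolding a[symmetric] t[symmetric] b[symmetric] by blast+
  have leaf: "z' = z" if "u \<in> pverts G - {x, y, a, t, b}" "(u, z) \<in> parcs T" "(u, z') \<in> parcs T" for u z z'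
    using HIST_low_degree_leaf[OF G T that(2) _ that(3)] bspec[OF other that(1)] xy by simp
  have all_three: "{x, c, b} \<subseteq> {z. (d, z) \<in> parcs T}"
    if d: "d \<in> pverts G" "{z. (d, z) \<in> parcs T} \<subseteq> {x, c, b}" "(d, z) \<in> parcs T" "(d, z') \<in> parcs T" "z \<noteq> z'" for c d z z'
  proof (rule ccontr)
    assume "\<not> ?thesis"
    then have "{z. (d, z) \<in> parcs T} \<subset> {x, c, b}"
      using d(2) by blast
    then have "card {z. (d, z) \<in> parcs T} < card {x, c, b}"
      by (intro psubset_card_mono) auto
    also have "\<dots> \<le> 3"
      by (simp add: card_insert_if)
    finally have "card {z. (d, z) \<in> parcs T} \<le> 2"
      by simp
    moreover have "card {z, z'} \<le> card {z. (d, z) \<in> parcs T}"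
      using d finite_subset[OF d(2)] by (intro card_mono) auto
    ultimately show False
      using deg[OF d(1)] d(5) by simp
  qed
  have not_both: False
    if "(a, x) \<in> parcs T" "(a, t) \<in> parcs T" "(a, b) \<in> parcs T" "(t, x) \<in> parcs T" "(t, a) \<in> parcs T" "(t, b) \<in> parcs T"
  proof -
    have "graph_cycle (parcs T) x [(x, a), (a, t), (t, x)]"
      using that sym distinct by (auto simp: graph_cycle_def)
    then show False
      using acyclic by blast
  qed
  \<comment> \<open>\<open>d\<close> is the branching vertex and \<open>c\<close> the other one of
    \<open>a\<close> and \<open>t\<close>. Apart from each other they have the same neighbours in
    the graph, so one argument serves both.\<close>
  have no_hub: "(d, z') \<notin> parcs T"
    if d: "{c, d} = {a, t}" and z: "(d, z) \<in> parcs T" "z \<noteq> z'" for c d z z'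
  proof
    assume z': "(d, z') \<in> parcs T"
    have dV: "d \<in> pverts G" "c \<in> pverts G" "c \<noteq> d"
      using d V distinct by (auto simp: doubleton_eq_iff)
    have dN: "{z. (d, z) \<in> parcs T} \<subseteq> {x, c, b}" and cN: "{z. (c, z) \<in> parcs T} \<subseteq> {x, d, b}"
      using d aN tN by (auto simp: doubleton_eq_iff)
    have d3: "(d, x) \<in> parcs T" "(d, c) \<in> parcs T" "(d, b) \<in> parcs T"
      using all_three[OF dV(1) dN z(1) z' z(2)] by auto
    have cd: "(c, d) \<in> parcs T"
      using d3 sym by blast
    have c1: "w = d" if "(c, w) \<in> parcs T" for w
    proof (rule ccontr)
      assume "w \<noteq> d"
      then have "(c, x) \<in> parcs T" "(c, b) \<in> parcs T"
        using all_three[OF dV(2) cN that cd] by auto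
      then show False
        using not_both d3 cd d by (auto simp: doubleton_eq_iff)
    qed
    have "c \<noteq> b" "d \<noteq> b" "y \<noteq> d"
      using d distinct bx by (auto simp: doubleton_eq_iff)
    then have "{w. (b, w) \<in> parcs T} \<subseteq> {y, d}"
      using bN c1 sym d by (auto simp: doubleton_eq_iff)
    moreover have "{w. (b, w) \<in> parcs T} \<noteq> {y, d}"
      using deg[OF V(5)] \<open>y \<noteq> d\<close> by auto
    ultimately have yb: "(b, y) \<notin> parcs T"
      using d3(3) sym by blast
    have "(y, x) \<in> parcs T"
    proof (rule HIST_closed_star[OF G T V(2,1) xy(1)])
      fix w z assume w: "(y, w) \<in> parcs T" "(w, z) \<in> parcs T"
      have "w \<in> pverts G"
        using w(1) TG pair_graph_wf by metis
      moreover have "w \<noteq> x" "w \<noteq> a" "w \<noteq> t" "w \<noteq> b" "w \<noteq> y"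
        using w(1) yb xy aN tN TG(1) sym irr distinct bx by blast+
      ultimately show "z = y"
        using leaf[of w y z] w sym by blast
    qed
    then show False
      using xy TG(1) sym by blast
  qed
  have "(x, y) \<in> parcs T"
  proof (rule HIST_closed_star[OF G T V(1,2)])
    fix w z assume w: "(x, w) \<in> parcs T" "(w, z) \<in> parcs T"
    have wG: "(x, w) \<in> parcs G" "(w, x) \<in> parcs G" and wT: "(w, x) \<in> parcs T"
      using w(1) TG(1) sym by blast+
    have "w \<in> pverts G" "w \<noteq> x" "w \<noteq> y" "w \<noteq> b"
      using pair_graph_wf[OF G wG(1)] wG irr[of x] xy adj(3)[of x] distinct by auto
    moreover have "z = x" if "w = a \<or> w = t"
      using that no_hub[of t a x z] no_hub[of a t x z] w(2) wT by auto
    ultimately show "z = x"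
      using leaf[of w x z] w(2) wT by blast
  qed (use xy in simp)
  then show False
    using xy TG(1) by blast
qed

section \<open>The encoding determines the answer\<close>

lemma nth_concat_uniform:
  "(\<And>l. l \<in> set ls \<Longrightarrow> length l = n) \<Longrightarrow> i < length ls \<Longrightarrow> j < n \<Longrightarrow> concat ls ! (i * n + j) = ls ! i ! j"
proof (induction ls arbitrary: i)
  case (Cons l ls)
  then show ?case
    by (cases i) (auto simp: nth_append)
qed simp

lemma encode_graph_matrix:
  fixes vs :: "'a list"
  defines "n \<equiv> length vs"
  shows "\<exists>l. encode_graph vs G = n # l \<and> length l = n * n \<and>
    (\<forall>i<n. \<forall>j<n. l ! (i * n + j) = of_bool ((vs ! i, vs ! j) \<in> parcs G))"
proof -
  let ?ls = "map (\<lambda>u. map (\<lambda>v. of_bool ((u, v) \<in> parcs G) :: nat) vs) vs"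
  have "length (concat ?ls) = n * n"
    by (simp add: length_concat n_def o_def sum_list_triv)
  moreover have "concat ?ls ! (i * n + j) = of_bool ((vs ! i, vs ! j) \<in> parcs G)" if "i < n" "j < n" for i j
    using that by (subst nth_concat_uniform) (auto simp: n_def)
  ultimately show ?thesis
    by (intro exI[of _ "concat ?ls"]) (simp add: encode_graph_def n_def)
qed

lemma pcas_map: "pcas u p v \<Longrightarrow> pcas (g u) (map (map_prod g g) p) (g v)"
  by (induction p arbitrary: u) auto

lemma pawalk_verts_map: "pawalk_verts (g u) (map (map_prod g g) p) = map g (pawalk_verts u p)"
  by (induction p arbitrary: u) auto

text \<open>The tree is pushed forward along \<open>f\<close>, and a cycle in the image would be
  pulled back along the inverse \<open>g\<close>.\<close>

lemma HIST_transfer: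
  assumes G: "pair_graph G" and H: "pair_graph H" and f: "bij_betw f (pverts G) (pverts H)"
    and arcs: "\<And>u v. u \<in> pverts G \<Longrightarrow> v \<in> pverts G \<Longrightarrow> (u, v) \<in> parcs G \<longleftrightarrow> (f u, f v) \<in> parcs H"
    and T: "HIST T G"
  shows "\<exists>T'. HIST T' H"
proof -
  let ?V = "pverts G"
  define g where "g = inv_into ?V f"
  have gf: "g (f u) = u" if "u \<in> ?V" for u
    using f that by (simp add: g_def bij_betw_inv_into_left)
  have fV: "f ` ?V = pverts H" and inj: "inj_on f ?V"
    using f by (auto simp: bij_betw_def)
  note T' = HIST_pair_graph[OF G T] HIST_pverts[OF G T] HIST_parcs[OF G T] HIST_nonempty[OF G T]
  note conn = HIST_connected[OF G T] and acyclic = HIST_acyclic[OF G T] and deg = HIST_degree[OF G T]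
  have wf: "u \<in> ?V \<and> v \<in> ?V \<and> u \<noteq> v \<and> (v, u) \<in> parcs T" if "(u, v) \<in> parcs T" for u v
    using that T' pair_graph_wf pair_graph_irrefl pair_graph_sym by metis
  define S where "S = \<lparr>pverts = pverts H, parcs = map_prod f f ` parcs T\<rparr>"
  have S: "pverts S = pverts H" "parcs S = map_prod f f ` parcs T"
    by (auto simp: S_def)
  have pgS: "pair_graph S"
  proof (rule pair_graphI)
    show "finite (pverts S)"
      using pair_graph_finite[OF H] by (simp add: S)
    fix u v assume "(u, v) \<in> parcs S"
    then obtain a b where ab: "u = f a" "v = f b" "(a, b) \<in> parcs T"
      by (auto simp: S)
    then show "u \<in> pverts S \<and> v \<in> pverts S \<and> u \<noteq> v \<and> (v, u) \<in> parcs S"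
      using wf[OF ab(3)] fV inj by (force simp: S inj_on_def)
  qed
  have "parcs S \<subseteq> parcs H"
    using arcs T'(3) wf by (fastforce simp: S)
  moreover have "(f u, f v) \<in> (parcs S)\<^sup>*" if "(u, v) \<in> (parcs T)\<^sup>*" for u v
    using that by induction (auto simp: S intro: rtrancl_into_rtrancl)
  then have "(u, v) \<in> (parcs S)\<^sup>*" if "u \<in> pverts S" "v \<in> pverts S" for u v
    using that conn unfolding S(1) fV[symmetric] by auto
  moreover have "\<not> graph_cycle (parcs S) u p" for u p
  proof
    assume "graph_cycle (parcs S) u p"
    then have p: "set p \<subseteq> parcs S" "pcas u p u" "distinct (tl (pawalk_verts u p))" "length p \<ge> 3"
      by (auto simp: graph_cycle_def)
    let ?q = "map (map_prod g g) p"
    have "map_prod g g e \<in> parcs T" if "e \<in> parcs S" for e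
      using that wf gf by (auto simp: S)
    then have "set ?q \<subseteq> parcs T"
      using p(1) by auto
    moreover have "pcas (g u) ?q (g u)"
      using p(2) by (rule pcas_map)
    moreover have "set (tl (pawalk_verts u p)) \<subseteq> pverts H"
    proof
      fix w assume "w \<in> set (tl (pawalk_verts u p))"
      then obtain i where "i < length p" "w = pawalk_verts u p ! Suc i"
        by (auto simp: in_set_conv_nth nth_tl length_pawalk_verts)
      then show "w \<in> pverts H"
        using pcas_nth[OF p(2)] p(1) nth_mem pair_graph_wf[OF pgS] S(1) by (metis subsetD)
    qed
    then have "inj_on g (set (tl (pawalk_verts u p)))"
      unfolding g_def fV[symmetric] by (rule inj_on_inv_into)
    then have "distinct (tl (pawalk_verts (g u) ?q))"
      using p(3) by (simp add: pawalk_verts_map map_tl[symmetric] distinct_map)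
    ultimately have "graph_cycle (parcs T) (g u) ?q"
      using p(4) unfolding graph_cycle_def length_map by blast
    then show False
      using acyclic by blast
  qed
  moreover have "card {w. (v, w) \<in> parcs S} \<noteq> 2" if "v \<in> pverts S" for v
  proof -
    have "v \<in> f ` ?V"
      using \<open>v \<in> pverts S\<close> by (simp only: fV S(1))
    then obtain a where a: "v = f a" "a \<in> ?V"
      by (rule imageE)
    have "{w. (v, w) \<in> parcs S} = f ` {w. (a, w) \<in> parcs T}"
    proof (intro set_eqI iffI)
      fix w assume "w \<in> {w. (v, w) \<in> parcs S}"
      then obtain b c where bc: "(b, c) \<in> parcs T" "f a = f b" "w = f c"
        unfolding S(2) a(1) mem_Collect_eq by (elim imageE) (metis map_prod_simp prod.collapse prod.inject)
      then have "a = b"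
        using inj_onD[OF inj bc(2) a(2)] wf by blast
      then show "w \<in> f ` {w. (a, w) \<in> parcs T}"
        using bc by blast
    next
      fix w assume "w \<in> f ` {w. (a, w) \<in> parcs T}"
      then show "w \<in> {w. (v, w) \<in> parcs S}"
        unfolding S(2) a(1) by force
    qed
    moreover have "inj_on f {w. (a, w) \<in> parcs T}"
      using inj by (rule inj_on_subset) (use wf in blast)
    ultimately show ?thesis
      using deg[OF a(2)] by (simp add: card_image)
  qed
  moreover have "pverts S \<noteq> {}"
    using fV T'(4) S(1) by auto
  ultimately have "HIST S H"
    using pgS S(1) unfolding HIST_iff[OF H] by blast
  then show ?thesis ..
qed

text \<open>If the encodings agree, matching the vertices by their positions in \<open>vs\<close>
  and \<open>ws\<close> is an isomorphism.\<close>

lemma HIST_encode_graph: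
  assumes G: "pair_graph G" "distinct vs" "set vs = pverts G"
    and H: "pair_graph H" "distinct ws" "set ws = pverts H"
    and enc: "encode_graph vs G = encode_graph ws H" and T: "HIST T G"
  shows "\<exists>T'. HIST T' H"
proof -
  obtain l where l: "encode_graph vs G = length vs # l"
    "\<forall>i<length vs. \<forall>j<length vs. l ! (i * length vs + j) = of_bool ((vs ! i, vs ! j) \<in> parcs G)"
    using encode_graph_matrix by blast
  obtain l' where l': "encode_graph ws H = length ws # l'"
    "\<forall>i<length ws. \<forall>j<length ws. l' ! (i * length ws + j) = of_bool ((ws ! i, ws ! j) \<in> parcs H)"
    using encode_graph_matrix by blast
  have eq: "length ws = length vs" "l' = l"
    using enc l l' by auto
  have arcs: "(vs ! i, vs ! j) \<in> parcs G \<longleftrightarrow> (ws ! i, ws ! j) \<in> parcs H" if "i < length vs" "j < length vs" for i j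
    using l(2) l'(2) that eq by (metis of_bool_eq_iff)
  define f where "f = (\<lambda>v. ws ! (the_inv_into {..<length vs} ((!) vs) v))"
  have vs: "bij_betw ((!) vs) {..<length vs} (pverts G)" and ws: "bij_betw ((!) ws) {..<length vs} (pverts H)"
    using G H eq bij_betw_nth by metis+
  have f: "f (vs ! i) = ws ! i" if "i < length vs" for i
    using that vs by (simp add: f_def bij_betw_def the_inv_into_f_f)
  have "bij_betw f (pverts G) (pverts H)"
    using bij_betw_trans[OF bij_betw_the_inv_into[OF vs] ws] by (simp add: f_def o_def)
  moreover have "(u, v) \<in> parcs G \<longleftrightarrow> (f u, f v) \<in> parcs H" if "u \<in> pverts G" "v \<in> pverts G" for u v
    using that arcs f vs unfolding bij_betw_def by (metis G(3) in_set_conv_nth)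
  ultimately show ?thesis
    using HIST_transfer[OF G(1) H(1)] T by blast
qed

section \<open>The obstructions as first-order sentences\<close>

text \<open>The program evaluates sentences on positions in the list of vertices, whereas the
  obstructions speak of the vertices themselves; this passes from one to the other.\<close>

lemma sat_bij:
  assumes "scoped K k \<phi>" "bij_betw f D D'" "\<And>i. i < k \<Longrightarrow> \<rho> i \<in> D"
    and "\<And>a b. a \<in> D \<Longrightarrow> b \<in> D \<Longrightarrow> A a b \<longleftrightarrow> A' (f a) (f b)"
  shows "sat D A k \<rho> \<phi> \<longleftrightarrow> sat D' A' k (f \<circ> \<rho>) \<phi>"
  using assms(1,3)
proof (induction \<phi> arbitrary: k \<rho>)
  case (Adj i j)
  then show ?case
    using assms(4) by simp
next
  case (Same i j)
  then show ?case
    using inj_on_eq_iff[OF bij_betw_imp_inj_on[OF assms(2)]] by simp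
next
  case (Neg \<phi>)
  then show ?case
    by simp
next
  case (Conj \<phi> \<psi>)
  then show ?case
    by simp
next
  case (Exi \<phi>)
  have *: "sat D A (Suc k) (\<rho>(k := a)) \<phi> \<longleftrightarrow> sat D' A' (Suc k) ((f \<circ> \<rho>)(k := f a)) \<phi>" if "a \<in> D" for a
  proof -
    have "(\<rho>(k := a)) i \<in> D" if "i < Suc k" for i
      using Exi.prems(2)[of i] \<open>a \<in> D\<close> that by (cases "i = k") auto
    then have "sat D A (Suc k) (\<rho>(k := a)) \<phi> \<longleftrightarrow> sat D' A' (Suc k) (f \<circ> \<rho>(k := a)) \<phi>"
      using Exi.prems(1) by (intro Exi.IH) auto
    then show ?thesis
      by (simp only: fun_upd_comp)
  qed
  have image: "(\<exists>b\<in>D'. P b) \<longleftrightarrow> (\<exists>a\<in>D. P (f a))" for P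
    using bij_betw_imp_surj_on[OF assms(2)] by blast
  show ?case
    unfolding sat.simps image by (rule bex_cong[OF refl *])
qed

definition Impl :: "fo \<Rightarrow> fo \<Rightarrow> fo" where "Impl \<phi> \<psi> = Neg (Conj \<phi> (Neg \<psi>))"
definition Disj :: "fo \<Rightarrow> fo \<Rightarrow> fo" where "Disj \<phi> \<psi> = Impl (Neg \<phi>) \<psi>"
definition Iff :: "fo \<Rightarrow> fo \<Rightarrow> fo" where "Iff \<phi> \<psi> = Conj (Impl \<phi> \<psi>) (Impl \<psi> \<phi>)"
definition All :: "fo \<Rightarrow> fo" where "All \<phi> = Neg (Exi (Neg \<phi>))"

lemma sat_derived [simp]:
  "sat D A k \<rho> (Impl \<phi> \<psi>) \<longleftrightarrow> (sat D A k \<rho> \<phi> \<longrightarrow> sat D A k \<rho> \<psi>)"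
  "sat D A k \<rho> (Disj \<phi> \<psi>) \<longleftrightarrow> sat D A k \<rho> \<phi> \<or> sat D A k \<rho> \<psi>"
  "sat D A k \<rho> (Iff \<phi> \<psi>) \<longleftrightarrow> (sat D A k \<rho> \<phi> \<longleftrightarrow> sat D A k \<rho> \<psi>)"
  "sat D A k \<rho> (All \<phi>) \<longleftrightarrow> (\<forall>a\<in>D. sat D A (Suc k) (\<rho>(k := a)) \<phi>)"
  by (auto simp: Impl_def Disj_def Iff_def All_def)

lemma scoped_derived [simp]:
  "scoped K k (Impl \<phi> \<psi>) \<longleftrightarrow> scoped K k \<phi> \<and> scoped K k \<psi>"
  "scoped K k (Disj \<phi> \<psi>) \<longleftrightarrow> scoped K k \<phi> \<and> scoped K k \<psi>"
  "scoped K k (Iff \<phi> \<psi>) \<longleftrightarrow> scoped K k \<phi> \<and> scoped K k \<psi>"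
  "scoped K k (All \<phi>) \<longleftrightarrow> scoped K (Suc k) \<phi>"
  by (auto simp: Impl_def Disj_def Iff_def All_def)

text \<open>Degree at most 2 is expressed as the absence of three distinct neighbours. Variable 0 is
  the starved vertex; variable 1 is the non-neighbour in the first conjunct and a neighbour in the
  second.\<close>

definition starved_fo :: fo where
  "starved_fo = Exi (Conj (Exi (Conj (Neg (Same 1 0)) (Neg (Adj 0 1))))
    (All (Impl (Adj 0 1) (Neg (Exi (Exi (Exi (Conj (Conj (Adj 1 2) (Conj (Adj 1 3) (Adj 1 4)))
      (Conj (Neg (Same 2 3)) (Conj (Neg (Same 2 4)) (Neg (Same 3 4))))))))))))"

text \<open>Variables 0 to 4 stand for \<open>x\<close>, \<open>y\<close>, \<open>a\<close>,
  \<open>t\<close>, \<open>b\<close>. The last conjunct nests seven quantifiers, which is the origin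
  of the register bound 7 in the final program.\<close>

definition triangled_fo :: fo where
  "triangled_fo = Exi (Exi (Exi (Exi (Exi (Conj (Conj (Neg (Same 0 1)) (Neg (Adj 0 1)))
    (Conj (All (Iff (Adj 2 5) (Disj (Same 5 0) (Disj (Same 5 3) (Same 5 4)))))
    (Conj (All (Iff (Adj 3 5) (Disj (Same 5 0) (Disj (Same 5 2) (Same 5 4)))))
    (Conj (All (Iff (Adj 4 5) (Disj (Same 5 1) (Disj (Same 5 2) (Same 5 3)))))
      (All (Disj (Disj (Same 5 0) (Disj (Same 5 1) (Disj (Same 5 2) (Disj (Same 5 3) (Same 5 4)))))
        (All (Iff (Adj 5 6) (Disj (Same 6 0) (Same 6 1))))))))))))))"

lemma card_le_2_iff:
  assumes "finite A"
  shows "card A \<le> 2 \<longleftrightarrow> \<not> (\<exists>a\<in>A. \<exists>b\<in>A. \<exists>c\<in>A. a \<noteq> b \<and> a \<noteq> c \<and> b \<noteq> c)"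
proof
  assume le: "card A \<le> 2"
  have False if "a \<in> A" "b \<in> A" "c \<in> A" "a \<noteq> b" "a \<noteq> c" "b \<noteq> c" for a b c
    using card_mono[OF assms, of "{a, b, c}"] that le by simp
  then show "\<not> (\<exists>a\<in>A. \<exists>b\<in>A. \<exists>c\<in>A. a \<noteq> b \<and> a \<noteq> c \<and> b \<noteq> c)"
    by blast
next
  assume no: "\<not> (\<exists>a\<in>A. \<exists>b\<in>A. \<exists>c\<in>A. a \<noteq> b \<and> a \<noteq> c \<and> b \<noteq> c)"
  show "card A \<le> 2"
  proof (rule ccontr)
    assume "\<not> card A \<le> 2"
    then obtain B where "B \<subseteq> A" "card B = 3"
      using obtain_subset_with_card_n[of 3 A] by auto
    then show False
      using no by (auto simp: card_3_iff)
  qed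
qed

lemma sat_starved_fo:
  assumes "finite V" "\<And>u v. E u v \<Longrightarrow> u \<in> V \<and> v \<in> V"
  shows "sat V E 0 \<rho> starved_fo \<longleftrightarrow> starved V E"
proof -
  have low: "card {x. E w x} \<le> 2 \<longleftrightarrow>
      \<not> (\<exists>a\<in>V. \<exists>b\<in>V. \<exists>c\<in>V. (E w a \<and> E w b \<and> E w c) \<and> a \<noteq> b \<and> a \<noteq> c \<and> b \<noteq> c)" for w
  proof -
    have "finite {x. E w x}"
      by (rule finite_subset[OF _ assms(1)]) (use assms(2) in blast)
    then show ?thesis
      using assms(2) by (subst card_le_2_iff) blast+
  qed
  have "sat V E 0 \<rho> starved_fo \<longleftrightarrow> (\<exists>v\<in>V. (\<exists>u\<in>V. u \<noteq> v \<and> \<not> E v u) \<and> (\<forall>w\<in>V. E v w \<longrightarrow>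
      \<not> (\<exists>a\<in>V. \<exists>b\<in>V. \<exists>c\<in>V. (E w a \<and> E w b \<and> E w c) \<and> a \<noteq> b \<and> a \<noteq> c \<and> b \<noteq> c)))"
    by (simp add: starved_fo_def numeral_eq_Suc)
  also have "\<dots> \<longleftrightarrow> starved V E"
    unfolding starved_def low[symmetric] using assms(2) by blast
  finally show ?thesis .
qed

lemma sat_triangled_fo:
  assumes "\<And>u v. E u v \<Longrightarrow> u \<in> V \<and> v \<in> V"
  shows "sat V E 0 \<rho> triangled_fo \<longleftrightarrow> triangled V E"
proof -
  have nb3: "{z. E a z} = {x, t, b} \<longleftrightarrow> (\<forall>z\<in>V. E a z \<longleftrightarrow> z = x \<or> z = t \<or> z = b)" if "x \<in> V" "t \<in> V" "b \<in> V" for a x t b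
    using assms that by blast
  have nb2: "{z. E a z} = {x, t} \<longleftrightarrow> (\<forall>z\<in>V. E a z \<longleftrightarrow> z = x \<or> z = t)" if "x \<in> V" "t \<in> V" for a x t
    using assms that by blast
  have "sat V E 0 \<rho> triangled_fo \<longleftrightarrow> (\<exists>x\<in>V. \<exists>y\<in>V. \<exists>a\<in>V. \<exists>t\<in>V. \<exists>b\<in>V. (x \<noteq> y \<and> \<not> E x y) \<and>
      (\<forall>z\<in>V. E a z \<longleftrightarrow> z = x \<or> z = t \<or> z = b) \<and> (\<forall>z\<in>V. E t z \<longleftrightarrow> z = x \<or> z = a \<or> z = b) \<and>
      (\<forall>z\<in>V. E b z \<longleftrightarrow> z = y \<or> z = a \<or> z = t) \<and>
      (\<forall>u\<in>V. (u = x \<or> u = y \<or> u = a \<or> u = t \<or> u = b) \<or> (\<forall>z\<in>V. E u z \<longleftrightarrow> z = x \<or> z = y)))"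
    by (simp add: triangled_fo_def numeral_eq_Suc)
  also have "\<dots> \<longleftrightarrow> triangled V E"
    unfolding triangled_def by (intro bex_cong refl) (auto simp: nb3 nb2)
  finally show ?thesis .
qed

section \<open>The algorithm\<close>

lemma HIST_iff_not_obstructed:
  assumes G: "pair_graph G" and "graph_diameter G \<le> 2" "card (pverts G) \<ge> 20"
  defines "E \<equiv> \<lambda>u v. (u, v) \<in> parcs G"
  shows "(\<exists>T. HIST T G) \<longleftrightarrow> \<not> starved (pverts G) E \<and> \<not> triangled (pverts G) E"
proof -
  interpret diam2_graph "pverts G" E
  proof
    show "finite (pverts G)"
      by (rule pair_graph_finite[OF G])
    show "E u v \<Longrightarrow> E v u" for u v
      unfolding E_def by (rule pair_graph_sym[OF G])
    show "\<not> E u u" for u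
      unfolding E_def by (rule pair_graph_irrefl[OF G])
    show "E u v \<Longrightarrow> u \<in> pverts G" for u v
      unfolding E_def using pair_graph_wf[OF G] by blast
    show "u \<in> pverts G \<Longrightarrow> v \<in> pverts G \<Longrightarrow> u = v \<or> E u v \<or> (\<exists>w. E u w \<and> E w v)" for u v
      unfolding E_def by (rule diameter_le_2D[OF assms(1,2)])
  qed
  show ?thesis
    using has_hist_large[OF assms(3)] has_hist_imp_HIST[OF G] starved_no_HIST[OF G] triangled_no_HIST[OF G]
    unfolding E_def by blast
qed

text \<open>For fewer than 20 vertices the answer is read off a finite table, which is meaningful because
  it depends on the encoding only.\<close>

definition small_answer :: "nat \<Rightarrow> nat list \<Rightarrow> bool" where
  "small_answer n l \<longleftrightarrow> (\<exists>(G :: nat pair_pre_digraph) vs T. pair_graph G \<and> distinct vs \<and> set vs = pverts G \<and>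
    encode_graph vs G = n # l \<and> HIST T G)"

lemma small_answer_iff:
  fixes G :: "nat pair_pre_digraph"
  assumes "pair_graph G" "distinct vs" "set vs = pverts G" "encode_graph vs G = n # l"
  shows "small_answer n l \<longleftrightarrow> (\<exists>T. HIST T G)"
proof
  assume "small_answer n l"
  then obtain H :: "nat pair_pre_digraph" and ws T where H: "pair_graph H" "distinct ws" "set ws = pverts H"
    "encode_graph ws H = n # l" "HIST T H"
    unfolding small_answer_def by blast
  then show "\<exists>T. HIST T G"
    using HIST_encode_graph[OF H(1-3) assms(1-3) _ H(5)] assms(4) by simp
next
  assume "\<exists>T. HIST T G"
  then show "small_answer n l"
    unfolding small_answer_def using assms by blast
qed

lemma sat_no_obstruction:
  assumes G: "pair_graph G" and vs: "distinct vs" "set vs = pverts G" and "graph_diameter G \<le> 2" "length vs \<ge> 20"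
  shows "sat {..<length vs} (\<lambda>i j. (vs ! i, vs ! j) \<in> parcs G) 0 \<rho> (Conj (Neg starved_fo) (Neg triangled_fo)) \<longleftrightarrow>
    (\<exists>T. HIST T G)"
proof -
  let ?E = "\<lambda>u v. (u, v) \<in> parcs G"
  have bij: "bij_betw ((!) vs) {..<length vs} (pverts G)"
    using vs by (intro bij_betw_nth) auto
  have "card (pverts G) \<ge> 20"
    using assms(5) distinct_card[OF vs(1)] vs(2) by simp
  note obs = HIST_iff_not_obstructed[OF G assms(4) this]
  have wf: "?E u v \<Longrightarrow> u \<in> pverts G \<and> v \<in> pverts G" for u v
    by (rule pair_graph_wf[OF G])
  have "scoped 7 0 (Conj (Neg starved_fo) (Neg triangled_fo))"
    by (simp add: starved_fo_def triangled_fo_def)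
  then have "sat {..<length vs} (\<lambda>i j. ?E (vs ! i) (vs ! j)) 0 \<rho> (Conj (Neg starved_fo) (Neg triangled_fo)) \<longleftrightarrow>
      sat (pverts G) ?E 0 ((!) vs \<circ> \<rho>) (Conj (Neg starved_fo) (Neg triangled_fo))"
    by (rule sat_bij[OF _ bij]) auto
  also have "\<dots> \<longleftrightarrow> \<not> starved (pverts G) ?E \<and> \<not> triangled (pverts G) ?E"
    using sat_starved_fo[where E = ?E, OF pair_graph_finite[OF G] wf] sat_triangled_fo[where E = ?E, OF wf] by simp
  finally show ?thesis
    using obs by simp
qed

theorem theorem1:
  shows "\<exists>(c :: prog) (p :: nat poly). \<forall>(G :: nat pair_pre_digraph) vs.
    pair_graph G \<and> distinct vs \<and> set vs = pverts G \<and>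
    Digraph_Component.connected (with_proj G) \<and> graph_diameter G \<le> 2 \<longrightarrow>
    answers_within c (encode_graph vs G) (poly p (length (encode_graph vs G))) (\<exists>T. HIST T G)"
proof (intro exI allI impI)
  fix G :: "nat pair_pre_digraph" and vs
  let ?\<phi> = "Conj (Neg starved_fo) (Neg triangled_fo)"
  assume "pair_graph G \<and> distinct vs \<and> set vs = pverts G \<and>
    Digraph_Component.connected (with_proj G) \<and> graph_diameter G \<le> 2"
  then have G: "pair_graph G" "distinct vs" "set vs = pverts G" "graph_diameter G \<le> 2"
    by blast+
  obtain l where l: "encode_graph vs G = length vs # l" "length l = length vs * length vs"
    "\<And>i j. i < length vs \<Longrightarrow> j < length vs \<Longrightarrow> l ! (i * length vs + j) = of_bool ((vs ! i, vs ! j) \<in> parcs G)"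
    using encode_graph_matrix[of vs G] by blast
  have "scoped 7 0 ?\<phi>"
    by (simp add: starved_fo_def triangled_fo_def)
  then show "answers_within (solver 20 7 small_answer ?\<phi>) (encode_graph vs G)
      (poly ([:2 * 20 + 2 * (20 * 20) + 20, 10:] + cost ?\<phi>) (length (encode_graph vs G))) (\<exists>T. HIST T G)"
    unfolding l(1)
    by (rule solver_correct[OF _ l(2,3)])
      (use small_answer_iff[OF G(1-3) l(1)] sat_no_obstruction[OF G] in auto)
qed

end
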